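(* Let $M$ be a smooth manifold with a distribution $H\subseteq TM$. Suppose $a(t),b(t)$ are smooth curves in $M$ with $a(0)=b(0)=m$, such that $a'(0)$ and $b'(0)$ are in $H_m$. Then in the parabolic tangent groupoid $\mathbb{T}_HM$, endowed with its manifold structure defined by $H$-adapted exponential maps, $$\lim_{t\to0}\,(a(t),b(t),t)=[a]_H\ast[b]_H^{-1}\in T_HM_m.$$
   Context: $M$ is a smooth manifold of dimension $p+q$, $H\subseteq TM$ is a distribution of rank $p$, $N=TM/H$. The limit is taken over $t>0$. An $H$-coordinate chart at $m\in M$ is a coordinate chart $\phi:U\to\mathbb{R}^{p+q}$ with $\phi(m)=0$ such that the first $p$ coordinate vectors at $m$ span $H_m$. Two smooth curves $c_1,c_2$ in $M$, defined near $t=0$ and tangent to $H$ at $t=0$, satisfy $c_1\sim_Hc_2$ if $c_1(0)=c_2(0)$ and, in $H$-coordinates centered at that point, $c_1'(0)=c_2'(0)$ and $c_1''(0)-c_2''(0)\in\mathbb{R}^p\times\{0\}$ (independent of the $H$-coordinates). A class $[c]_H$ is a parabolic arrow at $c(0)$; $T_HM_m$ is the set of parabolic arrows at $m$, and $T_HM=\bigcup_mT_HM_m$. Dilations $\delta_s$ ($s>0$) on $T_HM_m$ are $\delta_s([c]_H)=[c_s]_H$, $c_s(t)=c(st)$. Given $H$-coordinates at $m$, the arrow of the curve $(th,t^2n)$ has Taylor coordinates $(h,n)\in\mathbb{R}^p\times\mathbb{R}^q$; these make $T_HM_m$ a smooth manifold (independently of the $H$-coordinates). A parabolic flow is a smooth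 local flow $\Phi_t$ on $M$ with $\Phi_0=\mathrm{id}$ (no one-parameter group property required) such that $m\mapsto\frac{\partial\Phi}{\partial t}(m,0)$ is a section of $H$. $T_HM_m$ is a Lie group under $[\Phi^m]_H\ast[\Psi^m]_H=[(\Phi\circ\Psi)^m]_H$, where $\Phi,\Psi$ are parabolic flows, $\Phi^m(t)=\Phi_t(m)$, and $(\Phi\circ\Psi)_t=\Phi_t\circ\Psi_t$; $[b]_H^{-1}$ is the inverse in this group. $\mathrm{Lie}(T_HM_m)=T_0(T_HM_m)$ is identified with $H_m\oplus N_m$ by matching the linear coordinates induced by Taylor coordinates with those given by $\partial_1,\dots,\partial_p$ on $H_m$ and the classes of $\partial_{p+1},\dots,\partial_{p+q}$ on $N_m$ (independent of the $H$-coordinates). The total space $T_HM$ has the smooth structure transported from $H\oplus N$ by the fiberwise Lie exponential maps $H_m\oplus N_m\to T_HM_m$. An $H$-adapted exponential map is a smooth map $\exp:T_HM\to M$, with restrictions $\exp_m:T_HM_m\to M$, such that for each $v\in T_HM_m$ the curve $c(t)=\exp_m(\delta_tv)$ represents $v$, i.e. $[c]_H=v$ in $T_HM_m$. The parabolic tangent groupoid is, as a set, $\mathbb{T}_HM=T_HM\sqcup\left(M\times M\times(0,1]\right)$. Its structure of manifold with boundary is such that $M\times M\times(0,1]$ is an open subset with its usual smooth structure and such that, for any $H$-adapted exponential map, the map $$\psi:T_HM\times[0,1)\to\mathbb{T}_HM,\quad\psi(m,v,t)=(\exp_m(\delta_tv),m,t)\ (t>0),\quad\psi(m,v,0)=(m,v)\in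 T_HM_m,$$ restricted to a suitable open neighbourhood of $T_HM\times\{0\}$, is a diffeomorphism onto an open neighbourhood of $T_HM$ in $\mathbb{T}_HM$. This structure does not depend on the choice of the $H$-adapted exponential map. *)

theory Defs
  imports "HOL-Analysis.Analysis" "HOL-Algebra.Group"
begin

section \<open>Smooth functions between Euclidean spaces\<close>

text \<open>Only meaningful on open sets: the derivatives are not taken within \<open>S\<close>.\<close>

fun Ck_on :: "nat \<Rightarrow> ('a::euclidean_space \<Rightarrow> 'b::euclidean_space) \<Rightarrow> 'a set \<Rightarrow> bool" where
  "Ck_on 0 f S \<longleftrightarrow> continuous_on S f"
| "Ck_on (Suc k) f S \<longleftrightarrow> (\<forall>x\<in>S. f differentiable (at x)) \<and>
     (\<forall>v. Ck_on k (\<lambda>x. frechet_derivative f (at x) v) S)"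

text \<open>On an arbitrary set (such as an open subset of a half-space), smoothness means that there
  are local extensions to smooth functions on open sets.\<close>

definition smooth_on :: "'a::euclidean_space set \<Rightarrow> ('a \<Rightarrow> 'b::euclidean_space) \<Rightarrow> bool" where
  "smooth_on S f \<longleftrightarrow> (\<forall>x\<in>S. \<exists>W g. open W \<and> x \<in> W \<and> (\<forall>k. Ck_on k g W) \<and> (\<forall>y\<in>S \<inter> W. g y = f y))"


section \<open>Smooth manifolds\<close>

text \<open>A chart is a domain together with a map, whose values outside the domain are irrelevant.
  The underlying set and the topology of a manifold are both determined by its atlas.\<close>

type_synonym ('x, 'e) chart = "'x set \<times> ('x \<Rightarrow> 'e)"
type_synonym ('x, 'e) atlas = "('x, 'e) chart set"

abbreviation chart_inv :: "('x, 'e) chart \<Rightarrow> 'e \<Rightarrow> 'x" where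
  "chart_inv c \<equiv> inv_into (fst c) (snd c)"

abbreviation chart_image :: "('x, 'e) chart \<Rightarrow> 'e set" where
  "chart_image c \<equiv> snd c ` fst c"

definition points :: "('x, 'e) atlas \<Rightarrow> 'x set" where
  "points A = (\<Union>c\<in>A. fst c)"

definition atlas_topology :: "('x, 'e::euclidean_space) atlas \<Rightarrow> 'x topology" where
  "atlas_topology A = topology (\<lambda>W. W \<subseteq> points A \<and>
     (\<forall>c\<in>A. openin (top_of_set (chart_image c)) (snd c ` (fst c \<inter> W))))"

definition compatible :: "('x, 'e::euclidean_space) chart \<Rightarrow> ('x, 'e) chart \<Rightarrow> bool" where
  "compatible c d \<longleftrightarrow>
     openin (top_of_set (chart_image c)) (snd c ` (fst c \<inter> fst d)) \<and>
     openin (top_of_set (chart_image d)) (snd d ` (fst c \<inter> fst d)) \<and>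
     smooth_on (snd c ` (fst c \<inter> fst d)) (snd d \<circ> chart_inv c) \<and>
     smooth_on (snd d ` (fst c \<inter> fst d)) (snd c \<circ> chart_inv d)"

definition smooth_atlas :: "('x, 'e::euclidean_space) atlas \<Rightarrow> bool" where
  "smooth_atlas A \<longleftrightarrow> (\<forall>c\<in>A. inj_on (snd c) (fst c)) \<and> (\<forall>c\<in>A. \<forall>d\<in>A. compatible c d)"

definition smooth_manifold :: "('x, 'e::euclidean_space) atlas \<Rightarrow> bool" where
  "smooth_manifold A \<longleftrightarrow> smooth_atlas A \<and> (\<forall>c\<in>A. open (chart_image c)) \<and>
     Hausdorff_space (atlas_topology A) \<and> second_countable (atlas_topology A)"

definition smooth_manifold_with_boundary :: "('x, 'e::euclidean_space \<times> real) atlas \<Rightarrow> bool" where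
  "smooth_manifold_with_boundary A \<longleftrightarrow> smooth_atlas A \<and>
     (\<forall>c\<in>A. openin (top_of_set (UNIV \<times> {0..})) (chart_image c)) \<and>
     Hausdorff_space (atlas_topology A) \<and> second_countable (atlas_topology A)"

text \<open>The maximal atlas; for manifolds without boundary only, since images are open.\<close>

definition smooth_charts :: "('x, 'e::euclidean_space) atlas \<Rightarrow> ('x, 'e) chart set" where
  "smooth_charts A = {c. fst c \<subseteq> points A \<and> inj_on (snd c) (fst c) \<and> open (chart_image c) \<and>
     (\<forall>d\<in>A. compatible c d)}"

definition smooth_map ::
  "('x, 'e::euclidean_space) atlas \<Rightarrow> ('y, 'f::euclidean_space) atlas \<Rightarrow> ('x \<Rightarrow> 'y) \<Rightarrow> bool" where
  "smooth_map A B f \<longleftrightarrow> f \<in> points A \<rightarrow> points B \<and>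
     continuous_map (atlas_topology A) (atlas_topology B) f \<and>
     (\<forall>c\<in>A. \<forall>d\<in>B. smooth_on (snd c ` {x \<in> fst c. f x \<in> fst d}) (snd d \<circ> f \<circ> chart_inv c))"

definition diffeomorphism ::
  "('x, 'e::euclidean_space) atlas \<Rightarrow> ('y, 'f::euclidean_space) atlas \<Rightarrow> ('x \<Rightarrow> 'y) \<Rightarrow> bool" where
  "diffeomorphism A B f \<longleftrightarrow> bij_betw f (points A) (points B) \<and>
     smooth_map A B f \<and> smooth_map B A (inv_into (points A) f)"

definition restrict_atlas :: "('x, 'e) atlas \<Rightarrow> 'x set \<Rightarrow> ('x, 'e) atlas" where
  "restrict_atlas A W = (\<lambda>c. (fst c \<inter> W, snd c)) ` A"

definition prod_atlas :: "('x, 'e) atlas \<Rightarrow> ('y, 'f) atlas \<Rightarrow> ('x \<times> 'y, 'e \<times> 'f) atlas" where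
  "prod_atlas A B = {(fst c \<times> fst d, map_prod (snd c) (snd d)) | c d. c \<in> A \<and> d \<in> B}"

definition interval_atlas :: "real set \<Rightarrow> (real, real) atlas" where
  "interval_atlas I = {(I, id)}"

text \<open>The map \<open>f\<close>, restricted to the open set \<open>W\<close>, is a diffeomorphism onto an open subset.\<close>

definition open_diffeomorphism_on ::
  "'x set \<Rightarrow> ('x, 'e::euclidean_space) atlas \<Rightarrow> ('y, 'f::euclidean_space) atlas \<Rightarrow> ('x \<Rightarrow> 'y) \<Rightarrow> bool"
where
  "open_diffeomorphism_on W A B f \<longleftrightarrow> openin (atlas_topology A) W \<and>
     openin (atlas_topology B) (f ` W) \<and>
     diffeomorphism (restrict_atlas A W) (restrict_atlas B (f ` W)) f"


section \<open>Curves and tangent vectors\<close>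

text \<open>Curves are total functions, but only their values near \<open>t = 0\<close> matter; a tangent vector is the
  set of all curves that represent it.\<close>

definition smooth_curve :: "('m, 'e::euclidean_space) atlas \<Rightarrow> (real \<Rightarrow> 'm) \<Rightarrow> bool" where
  "smooth_curve A c \<longleftrightarrow> (\<exists>\<epsilon>>0. smooth_map (interval_atlas {-\<epsilon><..<\<epsilon>}) A c)"

definition velocity :: "('m, 'e::euclidean_space) chart \<Rightarrow> (real \<Rightarrow> 'm) \<Rightarrow> real \<Rightarrow> 'e" where
  "velocity u c t = vector_derivative (snd u \<circ> c) (at t)"

definition acceleration :: "('m, 'e::euclidean_space) chart \<Rightarrow> (real \<Rightarrow> 'm) \<Rightarrow> real \<Rightarrow> 'e" where
  "acceleration u c t = vector_derivative (velocity u c) (at t)"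

type_synonym 'm tangent = "(real \<Rightarrow> 'm) set"

definition tangent_class ::
  "('m, 'e::euclidean_space) atlas \<Rightarrow> (real \<Rightarrow> 'm) \<Rightarrow> 'm tangent" where
  "tangent_class A c = {c'. smooth_curve A c' \<and> c' 0 = c 0 \<and>
     (\<forall>u\<in>smooth_charts A. c 0 \<in> fst u \<longrightarrow> velocity u c' 0 = velocity u c 0)}"

definition tangent_space :: "('m, 'e::euclidean_space) atlas \<Rightarrow> 'm \<Rightarrow> 'm tangent set" where
  "tangent_space A x = {tangent_class A c | c. smooth_curve A c \<and> c 0 = x}"

definition base_point :: "(real \<Rightarrow> 'm) set \<Rightarrow> 'm" where
  "base_point v = (THE x. \<exists>c\<in>v. c 0 = x)"

text \<open>The tangent vector at \<open>x\<close> with components \<open>w\<close> in the chart \<open>u\<close>; the linear structure on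
  tangent spaces is the one transported by charts.\<close>

definition tangent_vector ::
  "('m, 'e::euclidean_space) atlas \<Rightarrow> ('m, 'e) chart \<Rightarrow> 'm \<Rightarrow> 'e \<Rightarrow> 'm tangent" where
  "tangent_vector A u x w = tangent_class A (\<lambda>t. chart_inv u (snd u x + t *\<^sub>R w))"

definition tangent_add ::
  "('m, 'e::euclidean_space) atlas \<Rightarrow> 'm \<Rightarrow> 'm tangent \<Rightarrow> 'm tangent \<Rightarrow> 'm tangent" where
  "tangent_add A x v v' = (THE z. \<exists>u\<in>smooth_charts A. x \<in> fst u \<and>
     (\<exists>w w'. v = tangent_vector A u x w \<and> v' = tangent_vector A u x w' \<and>
       z = tangent_vector A u x (w + w')))"


section \<open>Distributions, and the bundle \<open>H \<oplus> N\<close> with \<open>N = TM / H\<close>\<close>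

text \<open>The model space of \<open>M\<close> is \<open>'e\<close>, whose standard coordinates are indexed by \<open>Basis\<close>.  A subset
  \<open>P\<close> of \<open>Basis\<close> with \<open>p = card P\<close> elements takes the role of the first \<open>p\<close> coordinates and
  \<open>Basis - P\<close> that of the last \<open>q\<close> coordinates; either may be empty.  So \<open>span P\<close> stands for
  \<open>\<real>\<^sup>p \<times> {0}\<close>.  A distribution is given by its fibres \<open>H x\<close>.\<close>

definition lincomb :: "'e::euclidean_space set \<Rightarrow> ('e \<Rightarrow> 'e) \<Rightarrow> 'e \<Rightarrow> 'e" where
  "lincomb I E y = (\<Sum>i\<in>I. (y \<bullet> i) *\<^sub>R E i)"

text \<open>A smooth local frame of \<open>TM\<close> over the domain of the chart \<open>u\<close> whose members with index in \<open>P\<close>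
  frame \<open>H\<close>; \<open>E i x\<close> are the components of the \<open>i\<close>-th frame field at \<open>x\<close> in the chart \<open>u\<close>.\<close>

definition adapted_frame ::
  "('m, 'e::euclidean_space) atlas \<Rightarrow> 'e set \<Rightarrow> ('m \<Rightarrow> 'm tangent set) \<Rightarrow>
   ('m, 'e) chart \<Rightarrow> ('e \<Rightarrow> 'm \<Rightarrow> 'e) \<Rightarrow> bool" where
  "adapted_frame A P H u E \<longleftrightarrow> u \<in> smooth_charts A \<and>
     (\<forall>i\<in>Basis. smooth_on (chart_image u) (E i \<circ> chart_inv u)) \<and>
     (\<forall>x\<in>fst u. inj (lincomb Basis (\<lambda>i. E i x)) \<and>
        H x = tangent_vector A u x ` span ((\<lambda>i. E i x) ` P))"

definition distribution ::
  "('m, 'e::euclidean_space) atlas \<Rightarrow> 'e set \<Rightarrow> ('m \<Rightarrow> 'm tangent set) \<Rightarrow> bool" where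
  "distribution A P H \<longleftrightarrow> P \<subseteq> Basis \<and> (\<forall>x\<in>points A. \<exists>u E. adapted_frame A P H u E \<and> x \<in> fst u)"

definition normal_class ::
  "('m, 'e::euclidean_space) atlas \<Rightarrow> ('m \<Rightarrow> 'm tangent set) \<Rightarrow> 'm \<Rightarrow> 'm tangent \<Rightarrow> 'm tangent set"
where
  "normal_class A H x v = tangent_add A x v ` H x"

definition normal_space ::
  "('m, 'e::euclidean_space) atlas \<Rightarrow> ('m \<Rightarrow> 'm tangent set) \<Rightarrow> 'm \<Rightarrow> 'm tangent set set" where
  "normal_space A H x = normal_class A H x ` tangent_space A x"

type_synonym 'm hn = "'m tangent \<times> 'm tangent set"

definition hn_bundle ::
  "('m, 'e::euclidean_space) atlas \<Rightarrow> ('m \<Rightarrow> 'm tangent set) \<Rightarrow> 'm hn set" where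
  "hn_bundle A H = (\<Union>x\<in>points A. H x \<times> normal_space A H x)"

text \<open>The element of \<open>H\<^sub>x \<oplus> N\<^sub>x\<close> with coordinates \<open>y\<close> with respect to a basis of the tangent space
  at \<open>x\<close> with components \<open>E i\<close> in the chart \<open>u\<close>.\<close>

definition hn_point ::
  "('m, 'e::euclidean_space) atlas \<Rightarrow> 'e set \<Rightarrow> ('m \<Rightarrow> 'm tangent set) \<Rightarrow>
   ('m, 'e) chart \<Rightarrow> ('e \<Rightarrow> 'e) \<Rightarrow> 'm \<Rightarrow> 'e \<Rightarrow> 'm hn" where
  "hn_point A P H u E x y =
     (tangent_vector A u x (lincomb P E y),
      normal_class A H x (tangent_vector A u x (lincomb (Basis - P) E y)))"

definition hn_chart ::
  "('m, 'e::euclidean_space) atlas \<Rightarrow> 'e set \<Rightarrow> ('m \<Rightarrow> 'm tangent set) \<Rightarrow>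
   ('m, 'e) chart \<Rightarrow> ('e \<Rightarrow> 'm \<Rightarrow> 'e) \<Rightarrow> ('m hn, 'e \<times> 'e) chart" where
  "hn_chart A P H u E =
     (let D = chart_image u \<times> UNIV;
          G = (\<lambda>(z, y). hn_point A P H u (\<lambda>i. E i (chart_inv u z)) (chart_inv u z) y)
      in (G ` D, inv_into D G))"

definition hn_atlas ::
  "('m, 'e::euclidean_space) atlas \<Rightarrow> 'e set \<Rightarrow> ('m \<Rightarrow> 'm tangent set) \<Rightarrow> ('m hn, 'e \<times> 'e) atlas"
where
  "hn_atlas A P H = {hn_chart A P H u E | u E. adapted_frame A P H u E}"


section \<open>Parabolic arrows\<close>

definition H_charts ::
  "('m, 'e::euclidean_space) atlas \<Rightarrow> 'e set \<Rightarrow> ('m \<Rightarrow> 'm tangent set) \<Rightarrow> 'm \<Rightarrow> ('m, 'e) chart set"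
where
  "H_charts A P H m = {u \<in> smooth_charts A. m \<in> fst u \<and> snd u m = 0 \<and>
     H m = tangent_vector A u m ` span P}"

type_synonym 'm arrow = "(real \<Rightarrow> 'm) set"

definition horizontal_curve ::
  "('m, 'e::euclidean_space) atlas \<Rightarrow> ('m \<Rightarrow> 'm tangent set) \<Rightarrow> (real \<Rightarrow> 'm) \<Rightarrow> bool" where
  "horizontal_curve A H c \<longleftrightarrow> smooth_curve A c \<and> tangent_class A c \<in> H (c 0)"

definition arrow_class ::
  "('m, 'e::euclidean_space) atlas \<Rightarrow> 'e set \<Rightarrow> ('m \<Rightarrow> 'm tangent set) \<Rightarrow> (real \<Rightarrow> 'm) \<Rightarrow> 'm arrow"
where
  "arrow_class A P H c = {c'. horizontal_curve A H c' \<and> c' 0 = c 0 \<and>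
     (\<forall>u\<in>H_charts A P H (c 0). velocity u c' 0 = velocity u c 0 \<and>
        acceleration u c' 0 - acceleration u c 0 \<in> span P)}"

definition arrows ::
  "('m, 'e::euclidean_space) atlas \<Rightarrow> 'e set \<Rightarrow> ('m \<Rightarrow> 'm tangent set) \<Rightarrow> 'm \<Rightarrow> 'm arrow set" where
  "arrows A P H m = {arrow_class A P H c | c. horizontal_curve A H c \<and> c 0 = m}"

definition arrow_space ::
  "('m, 'e::euclidean_space) atlas \<Rightarrow> 'e set \<Rightarrow> ('m \<Rightarrow> 'm tangent set) \<Rightarrow> 'm arrow set" where
  "arrow_space A P H = (\<Union>m\<in>points A. arrows A P H m)"

text \<open>The formula makes sense for every real \<open>s\<close>; values \<open>s \<le> 0\<close> are used to have curves
  \<open>t \<mapsto> exp (\<delta>\<^sub>t v)\<close> that are defined on a neighbourhood of \<open>0\<close>.\<close>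

definition dilation ::
  "('m, 'e::euclidean_space) atlas \<Rightarrow> 'e set \<Rightarrow> ('m \<Rightarrow> 'm tangent set) \<Rightarrow> real \<Rightarrow> 'm arrow \<Rightarrow> 'm arrow"
where
  "dilation A P H s v = (THE w. \<exists>c\<in>v. w = arrow_class A P H (\<lambda>t. c (s * t)))"

text \<open>The arrow with Taylor coordinates \<open>y\<close>, split as \<open>h\<close> in \<open>span P\<close> and \<open>n\<close> in
  \<open>span (Basis - P)\<close>, in the chart \<open>u\<close>, and the resulting global chart of \<open>arrows A P H m\<close>.\<close>

definition taylor_arrow ::
  "('m, 'e::euclidean_space) atlas \<Rightarrow> 'e set \<Rightarrow> ('m \<Rightarrow> 'm tangent set) \<Rightarrow> ('m, 'e) chart \<Rightarrow>
   'e \<Rightarrow> 'm arrow" where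
  "taylor_arrow A P H u y = arrow_class A P H
     (\<lambda>t. chart_inv u (t *\<^sub>R lincomb P id y + t\<^sup>2 *\<^sub>R lincomb (Basis - P) id y))"

definition taylor_coords ::
  "('m, 'e::euclidean_space) atlas \<Rightarrow> 'e set \<Rightarrow> ('m \<Rightarrow> 'm tangent set) \<Rightarrow> ('m, 'e) chart \<Rightarrow>
   'm arrow \<Rightarrow> 'e" where
  "taylor_coords A P H u = inv_into UNIV (taylor_arrow A P H u)"


section \<open>The group structure on parabolic arrows\<close>

text \<open>A local flow is smooth on some neighbourhood of \<open>M \<times> {0}\<close> in \<open>M \<times> \<real>\<close>.\<close>

definition parabolic_flow ::
  "('m, 'e::euclidean_space) atlas \<Rightarrow> ('m \<Rightarrow> 'm tangent set) \<Rightarrow> (real \<Rightarrow> 'm \<Rightarrow> 'm) \<Rightarrow> bool" where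
  "parabolic_flow A H \<Phi> \<longleftrightarrow>
     (\<exists>W. openin (atlas_topology (prod_atlas A (interval_atlas UNIV))) W \<and> points A \<times> {0} \<subseteq> W \<and>
        smooth_map (restrict_atlas (prod_atlas A (interval_atlas UNIV)) W) A (\<lambda>(x, t). \<Phi> t x)) \<and>
     (\<forall>x\<in>points A. \<Phi> 0 x = x \<and> tangent_class A (\<lambda>t. \<Phi> t x) \<in> H x)"

definition arrow_mult ::
  "('m, 'e::euclidean_space) atlas \<Rightarrow> 'e set \<Rightarrow> ('m \<Rightarrow> 'm tangent set) \<Rightarrow> 'm \<Rightarrow>
   'm arrow \<Rightarrow> 'm arrow \<Rightarrow> 'm arrow" where
  "arrow_mult A P H m v w = (THE z. \<exists>\<Phi> \<Psi>. parabolic_flow A H \<Phi> \<and> parabolic_flow A H \<Psi> \<and>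
     v = arrow_class A P H (\<lambda>t. \<Phi> t m) \<and> w = arrow_class A P H (\<lambda>t. \<Psi> t m) \<and>
     z = arrow_class A P H (\<lambda>t. (\<Phi> t \<circ> \<Psi> t) m))"

definition arrow_group ::
  "('m, 'e::euclidean_space) atlas \<Rightarrow> 'e set \<Rightarrow> ('m \<Rightarrow> 'm tangent set) \<Rightarrow> 'm \<Rightarrow> 'm arrow monoid"
where
  "arrow_group A P H m = \<lparr>carrier = arrows A P H m, monoid.mult = arrow_mult A P H m,
     one = arrow_class A P H (\<lambda>_. m)\<rparr>"

text \<open>The one-parameter subgroup generated by \<open>X\<close>, an element of \<open>H\<^sub>m \<oplus> N\<^sub>m\<close> identified with an
  element of the Lie algebra: in an \<open>H\<close>-coordinate chart \<open>u\<close>, the derivative at \<open>0\<close> of the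
  Taylor coordinates of \<open>\<gamma>\<close> is the coordinate vector of \<open>X\<close> with respect to the basis given by the
  coordinate vector fields of \<open>u\<close>, whose components in \<open>u\<close> are the standard basis vectors.\<close>

definition one_parameter_subgroup ::
  "('m, 'e::euclidean_space) atlas \<Rightarrow> 'e set \<Rightarrow> ('m \<Rightarrow> 'm tangent set) \<Rightarrow> 'm \<Rightarrow> 'm hn \<Rightarrow>
   (real \<Rightarrow> 'm arrow) \<Rightarrow> bool" where
  "one_parameter_subgroup A P H m X \<gamma> \<longleftrightarrow>
     \<gamma> \<in> hom \<lparr>carrier = UNIV, monoid.mult = (+), one = 0\<rparr> (arrow_group A P H m) \<and>
     (\<forall>u\<in>H_charts A P H m. smooth_on UNIV (taylor_coords A P H u \<circ> \<gamma>) \<and>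
        (\<exists>y. X = hn_point A P H u id m y \<and>
          ((taylor_coords A P H u \<circ> \<gamma>) has_vector_derivative y) (at 0)))"

definition lie_exp ::
  "('m, 'e::euclidean_space) atlas \<Rightarrow> 'e set \<Rightarrow> ('m \<Rightarrow> 'm tangent set) \<Rightarrow> 'm hn \<Rightarrow> 'm arrow" where
  "lie_exp A P H X =
     (THE v. \<exists>\<gamma>. one_parameter_subgroup A P H (base_point (fst X)) X \<gamma> \<and> v = \<gamma> 1)"

text \<open>The smooth structure on the total space, transported from \<open>H \<oplus> N\<close>.\<close>

definition arrow_atlas ::
  "('m, 'e::euclidean_space) atlas \<Rightarrow> 'e set \<Rightarrow> ('m \<Rightarrow> 'm tangent set) \<Rightarrow> ('m arrow, 'e \<times> 'e) atlas"
where
  "arrow_atlas A P H = (\<lambda>c. (lie_exp A P H ` fst c,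
     snd c \<circ> inv_into (hn_bundle A H) (lie_exp A P H))) ` hn_atlas A P H"


section \<open>The parabolic tangent groupoid\<close>

text \<open>An arrow is a set of curves, so membership says that the curve represents the arrow.\<close>

definition adapted_exponential ::
  "('m, 'e::euclidean_space) atlas \<Rightarrow> 'e set \<Rightarrow> ('m \<Rightarrow> 'm tangent set) \<Rightarrow> ('m arrow \<Rightarrow> 'm) \<Rightarrow> bool"
where
  "adapted_exponential A P H e \<longleftrightarrow> smooth_map (arrow_atlas A P H) A e \<and>
     (\<forall>v\<in>arrow_space A P H. (\<lambda>t. e (dilation A P H t v)) \<in> v)"

type_synonym 'm groupoid = "'m arrow + 'm \<times> 'm \<times> real"

definition tangent_groupoid ::
  "('m, 'e::euclidean_space) atlas \<Rightarrow> 'e set \<Rightarrow> ('m \<Rightarrow> 'm tangent set) \<Rightarrow> 'm groupoid set" where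
  "tangent_groupoid A P H =
     Inl ` arrow_space A P H \<union> Inr ` (points A \<times> points A \<times> {0<..1})"

definition groupoid_param ::
  "('m, 'e::euclidean_space) atlas \<Rightarrow> 'e set \<Rightarrow> ('m \<Rightarrow> 'm tangent set) \<Rightarrow> ('m arrow \<Rightarrow> 'm) \<Rightarrow>
   'm arrow \<times> real \<Rightarrow> 'm groupoid" where
  "groupoid_param A P H e = (\<lambda>(v, t).
     if t = 0 then Inl v else Inr (e (dilation A P H t v), base_point v, t))"

text \<open>The structure \<open>S\<close> of a manifold with boundary on the parabolic tangent groupoid.  It does not
  depend on the choice of the adapted exponential map \<open>e\<close>, so that its defining property is only
  required for one of them.\<close>

definition tangent_groupoid_structure ::
  "('m, 'e::euclidean_space) atlas \<Rightarrow> 'e set \<Rightarrow> ('m \<Rightarrow> 'm tangent set) \<Rightarrow>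
   ('m groupoid, ('e \<times> 'e) \<times> real) atlas \<Rightarrow> bool" where
  "tangent_groupoid_structure A P H S \<longleftrightarrow>
     smooth_manifold_with_boundary S \<and> points S = tangent_groupoid A P H \<and>
     open_diffeomorphism_on (points A \<times> points A \<times> {0<..1})
       (prod_atlas A (prod_atlas A (interval_atlas {0<..1}))) S Inr \<and>
     (\<exists>e W. adapted_exponential A P H e \<and> arrow_space A P H \<times> {0} \<subseteq> W \<and>
        open_diffeomorphism_on W (prod_atlas (arrow_atlas A P H) (interval_atlas {0..<1})) S
          (groupoid_param A P H e))"

end

theory Submission
  imports Defs
begin

text \<open>
  Why the limit is the product. Work in a chart centered at \<open>m\<close> together with a frame of the tangent
  bundle whose first members span \<open>H\<close> and which is the standard basis at \<open>m\<close>. Write \<open>h\<close> and \<open>n\<close> for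
  the horizontal and vertical parts of a vector \<open>y\<close> and \<open>\<delta>\<^sub>t y = t h + t\<^sup>2 n\<close>.

  The group. Composing two parabolic flows and reading off the second order part modulo \<open>H\<close> shows
  that the product of arrows is \<open>y + y' + B(h, h')\<close> in Taylor coordinates (\<open>flow_compose\<close>,
  \<open>arrow_mult_taylor\<close>). Here \<open>B(h, h')\<close> is the vertical part of the derivative in direction \<open>h'\<close> of
  the field with constant frame components \<open>h\<close> (\<open>twist\<close>). Every arrow comes from a flow because a
  local flow can be cut off by a bump function (\<open>flow_exists\<close>). From this formula the inverse is
  \<open>- y + B(h, h)\<close>, and the exponential of the Lie algebra element \<open>y\<close> is \<open>F(y) = y + B(h, h) / 2\<close>
  (\<open>arrow_group_inverse\<close>, \<open>lie_exp_eq\<close>), which commutes with \<open>\<delta>\<^sub>t\<close>. The same holds at every point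
  \<open>z\<close> near \<open>m\<close> after dividing chart and frame by the frame matrix \<open>L\<^sub>z\<close>. So \<open>(z, y)\<close> are coordinates
  of the total space of arrows, and dilations act on them by \<open>(z, \<delta>\<^sub>t y)\<close> (\<open>arrow_chart\<close>,
  \<open>dilation_arrow_at\<close>).

  The limit. Let \<open>exp (z, y)\<close> be the value of an adapted exponential map at the arrow with
  coordinates \<open>(z, y)\<close>. A neighbourhood of an arrow with coordinates \<open>(0, w)\<close> in the groupoid contains all
  triples \<open>(exp (z, \<delta>\<^sub>t w'), z, t)\<close> with \<open>z\<close> near \<open>0\<close>, \<open>w'\<close> near \<open>w\<close> and small \<open>t > 0\<close>
  (\<open>groupoid_neighbourhood\<close>). It is therefore enough to solve \<open>exp (b t, \<delta>\<^sub>t w\<^sub>t) = a t\<close> with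
  \<open>w\<^sub>t\<close> tending to the coordinates \<open>w\<close> of the arrow claimed to be the limit. Rescaled, the equation
  reads \<open>F\<^sub>t(w\<^sub>t) = Y\<^sub>t\<close> with \<open>F\<^sub>t(w) = \<delta>\<^sub>1\<^sub>/\<^sub>t L\<^sup>-\<^sup>1 (exp (b t, \<delta>\<^sub>t w) - b t)\<close> and
  \<open>Y\<^sub>t = \<delta>\<^sub>1\<^sub>/\<^sub>t L\<^sup>-\<^sup>1 (a t - b t)\<close>, where \<open>L\<close> is the frame matrix at \<open>b t\<close>. Since
  \<open>t \<mapsto> exp (z, \<delta>\<^sub>t w)\<close> represents its arrow, \<open>F\<^sub>t\<close> tends to \<open>F\<close> uniformly on compact sets
  (\<open>exp_expansion\<close>). The vectors \<open>Y\<^sub>t\<close> tend to the Taylor coordinates of the product of \<open>[a]\<close> and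
  the inverse of \<open>[b]\<close>: the vertical part of \<open>a - b\<close> contributes the difference of the vertical
  Taylor coordinates, and the first order deviation of \<open>L\<close> from the identity contributes the values
  of \<open>B\<close> (\<open>frame_limit\<close>). As \<open>F\<close> is a homeomorphism with an explicit inverse, Brouwer's theorem for
  \<open>w \<mapsto> F\<^sup>-\<^sup>1(F(w) - F\<^sub>t(w) + Y\<^sub>t)\<close> on a small ball gives the solution (\<open>exp_solution\<close>).
\<close>

section \<open>Smooth functions on open sets\<close>

text \<open>On open sets this agrees with \<open>smooth_on\<close> but avoids the local extensions, so that closure
  properties can be proved by induction on the order of differentiability.\<close>

definition Cinf_on :: "('a::euclidean_space \<Rightarrow> 'b::euclidean_space) \<Rightarrow> 'a set \<Rightarrow> bool" where
  "Cinf_on f S \<longleftrightarrow> (\<forall>k. Ck_on k f S)"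

lemma has_derivative_frechet:
  "f differentiable F \<Longrightarrow> (f has_derivative frechet_derivative f F) F"
  by (simp add: frechet_derivative_works)

lemma Ck_on_cong:
  assumes "open S" "\<And>x. x \<in> S \<Longrightarrow> f x = g x" "Ck_on k f S"
  shows "Ck_on k g S"
  using assms(2,3)
proof (induction k arbitrary: f g)
  case 0
  then show ?case by (auto cong: continuous_on_cong)
next
  case (Suc k)
  have fd: "frechet_derivative f (at x) = frechet_derivative g (at x)" "g differentiable (at x)" if "x \<in> S" for x
  proof -
    have *: "f differentiable (at x)" using Suc.prems(2) that by simp
    show "frechet_derivative f (at x) = frechet_derivative g (at x)"
      using frechet_derivative_transform_within_open[OF * assms(1) that] Suc.prems(1) by auto
    show "g differentiable (at x)"
      using * Suc.prems(1) assms(1) that unfolding differentiable_def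
      by (meson has_derivative_transform_within_open)
  qed
  have "Ck_on k (\<lambda>x. frechet_derivative g (at x) v) S" for v
  proof (rule Suc.IH)
    show "Ck_on k (\<lambda>x. frechet_derivative f (at x) v) S" using Suc.prems(2) by simp
  qed (simp add: fd)
  then show ?case using fd by simp
qed

lemma Ck_on_subset: "Ck_on k f S \<Longrightarrow> T \<subseteq> S \<Longrightarrow> Ck_on k f T"
  by (induction k arbitrary: f) (auto intro: continuous_on_subset)

lemma Ck_on_local:
  assumes "\<And>x. x \<in> S \<Longrightarrow> \<exists>V. open V \<and> x \<in> V \<and> Ck_on k f V"
  shows "Ck_on k f S"
  using assms
proof (induction k arbitrary: f)
  case 0
  have "isCont f x" if x: "x \<in> S" for x
  proof -
    obtain V where "open V" "x \<in> V" "continuous_on V f"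
      using 0[OF x] by auto
    then show ?thesis by (simp add: continuous_on_eq_continuous_at)
  qed
  then show ?case by (simp add: continuous_at_imp_continuous_on)
next
  case (Suc k)
  have "f differentiable (at x)" if "x \<in> S" for x
    using Suc.prems[OF that] by auto
  moreover have "Ck_on k (\<lambda>x. frechet_derivative f (at x) v) S" for v
  proof (rule Suc.IH)
    fix x assume "x \<in> S"
    then obtain V where "open V" "x \<in> V" "Ck_on (Suc k) f V" using Suc.prems by blast
    then show "\<exists>V. open V \<and> x \<in> V \<and> Ck_on k (\<lambda>x. frechet_derivative f (at x) v) V"
      by auto
  qed
  ultimately show ?case by simp
qed

lemma Ck_on_Suc_imp: "Ck_on (Suc k) f S \<Longrightarrow> Ck_on k f S"
proof (induction k arbitrary: f)
  case 0
  then show ?case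
    by (auto intro!: continuous_at_imp_continuous_on differentiable_imp_continuous_within)
next
  case (Suc k)
  have d: "\<forall>x\<in>S. f differentiable (at x)"
    and v: "Ck_on (Suc k) (\<lambda>x. frechet_derivative f (at x) v) S" for v
    using Suc.prems Ck_on.simps(2)[of "Suc k" f S] by blast+
  show ?case
    using Suc.IH[OF v] d Ck_on.simps(2)[of k f S] by blast
qed

lemma Ck_on_const [simp]: "Ck_on k (\<lambda>x. c) S"
  by (induction k arbitrary: c) auto

lemma Ck_on_linear_comp:
  assumes "open S" "bounded_linear L" "Ck_on k f S"
  shows "Ck_on k (\<lambda>x. L (f x)) S"
  using assms(3)
proof (induction k arbitrary: f)
  case 0
  then show ?case using linear_continuous_on_compose[OF _ bounded_linear.linear[OF assms(2)]] by simp
next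
  case (Suc k)
  have d: "((\<lambda>x. L (f x)) has_derivative (\<lambda>h. L (frechet_derivative f (at x) h))) (at x)"
    if "x \<in> S" for x
    using Suc.prems that
    by (intro bounded_linear.has_derivative[OF assms(2)] has_derivative_frechet) auto
  have "Ck_on k (\<lambda>x. frechet_derivative (\<lambda>x. L (f x)) (at x) v) S" for v
  proof (rule Ck_on_cong[OF assms(1)])
    show "Ck_on k (\<lambda>x. L (frechet_derivative f (at x) v)) S"
      using Suc by simp
  qed (simp add: frechet_derivative_at[OF d, symmetric])
  then show ?case by (simp add: Derivative.differentiableI[OF d])
qed

lemma Ck_on_linear: "bounded_linear L \<Longrightarrow> Ck_on k L S"
proof (cases k)
  case (Suc l)
  assume L: "bounded_linear L"
  then have "\<And>x. frechet_derivative L (at x) = L"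
    using frechet_derivative_at[OF bounded_linear.has_derivative[OF L has_derivative_ident]] by auto
  then show ?thesis using Suc L by (auto intro: bounded_linear_imp_differentiable)
qed (simp add: linear_continuous_on)

lemma Ck_on_add:
  assumes "open S" "Ck_on k f S" "Ck_on k g S"
  shows "Ck_on k (\<lambda>x. f x + g x) S"
  using assms(2,3)
proof (induction k arbitrary: f g)
  case 0
  then show ?case by (simp add: continuous_on_add)
next
  case (Suc k)
  have d: "((\<lambda>x. f x + g x) has_derivative
      (\<lambda>h. frechet_derivative f (at x) h + frechet_derivative g (at x) h)) (at x)"
    if "x \<in> S" for x
    using Suc.prems that by (intro has_derivative_add has_derivative_frechet) auto
  have "Ck_on k (\<lambda>x. frechet_derivative (\<lambda>x. f x + g x) (at x) v) S" for v
  proof (rule Ck_on_cong[OF assms(1)])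
    show "Ck_on k (\<lambda>x. frechet_derivative f (at x) v + frechet_derivative g (at x) v) S"
      using Suc by simp
  qed (simp add: frechet_derivative_at[OF d, symmetric])
  then show ?case by (simp add: Derivative.differentiableI[OF d])
qed

lemma Ck_on_sum:
  assumes "open S" "\<And>i. i \<in> I \<Longrightarrow> Ck_on k (f i) S"
  shows "Ck_on k (\<lambda>x. \<Sum>i\<in>I. f i x) S"
  using assms(2)
  by (induction I rule: infinite_finite_induct) (auto intro!: Ck_on_add[OF assms(1)])

lemma Ck_on_scaleR:
  assumes "open S" "Ck_on k a S" "Ck_on k g S"
  shows "Ck_on k (\<lambda>x. a x *\<^sub>R g x) S"
  using assms(2,3)
proof (induction k arbitrary: a g)
  case 0
  then show ?case by (simp add: continuous_on_scaleR)
next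
  case (Suc k)
  have d: "((\<lambda>x. a x *\<^sub>R g x) has_derivative
      (\<lambda>h. a x *\<^sub>R frechet_derivative g (at x) h + frechet_derivative a (at x) h *\<^sub>R g x)) (at x)"
    if "x \<in> S" for x
    using Suc.prems that by (intro has_derivative_scaleR has_derivative_frechet) auto
  have "Ck_on k (\<lambda>x. frechet_derivative (\<lambda>x. a x *\<^sub>R g x) (at x) v) S" for v
  proof (rule Ck_on_cong[OF assms(1)])
    show "Ck_on k (\<lambda>x. a x *\<^sub>R frechet_derivative g (at x) v + frechet_derivative a (at x) v *\<^sub>R g x) S"
    proof (intro Ck_on_add[OF assms(1)] Suc.IH)
      show "Ck_on k a S" "Ck_on k g S" using Suc.prems by (simp_all only: Ck_on_Suc_imp)
    qed (use Suc.prems in auto)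
  qed (simp add: frechet_derivative_at[OF d, symmetric])
  then show ?case by (simp add: Derivative.differentiableI[OF d])
qed

lemma linear_expand_Basis:
  fixes L :: "'a::euclidean_space \<Rightarrow> 'b::real_vector"
  assumes "linear L"
  shows "L v = (\<Sum>i\<in>Basis. (v \<bullet> i) *\<^sub>R L i)"
proof -
  have "L v = L (\<Sum>i\<in>Basis. (v \<bullet> i) *\<^sub>R i)" by (simp add: euclidean_representation)
  then show ?thesis by (simp add: linear_sum[OF assms] linear_cmul[OF assms])
qed

text \<open>The chain rule, expanded in the standard basis, writes a directional derivative of the
  composition as a sum of products of functions to which the induction hypothesis applies.\<close>

lemma Ck_on_compose:
  assumes "open S" "open T" "f ` S \<subseteq> T" "Ck_on k f S" "Ck_on k g T"
  shows "Ck_on k (\<lambda>x. g (f x)) S"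
  using assms(4,5)
proof (induction k arbitrary: g)
  case 0
  then show ?case using assms(3) by (auto intro: continuous_on_compose2)
next
  case (Suc k)
  have d: "((\<lambda>x. g (f x)) has_derivative
      (\<lambda>h. frechet_derivative g (at (f x)) (frechet_derivative f (at x) h))) (at x)"
    if "x \<in> S" for x
  proof (rule has_derivative_compose[OF has_derivative_frechet has_derivative_frechet])
    show "f differentiable (at x)" using Suc.prems(1) that by simp
    show "g differentiable (at (f x))" using Suc.prems(2) that assms(3) by auto
  qed
  have lin: "linear (frechet_derivative g (at (f x)))" if "x \<in> S" for x
  proof (rule linear_frechet_derivative)
    show "g differentiable (at (f x))" using Suc.prems(2) that assms(3) by auto
  qed
  have "Ck_on k (\<lambda>x. frechet_derivative (\<lambda>x. g (f x)) (at x) v) S" for v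
  proof (rule Ck_on_cong[OF assms(1)])
    show "Ck_on k (\<lambda>x. \<Sum>i\<in>Basis. (frechet_derivative f (at x) v \<bullet> i) *\<^sub>R
        frechet_derivative g (at (f x)) i) S"
    proof (intro Ck_on_sum Ck_on_scaleR assms(1))
      fix i :: 'b assume "i \<in> Basis"
      show "Ck_on k (\<lambda>x. frechet_derivative f (at x) v \<bullet> i) S"
        using Suc.prems(1) by (intro Ck_on_linear_comp[OF assms(1) bounded_linear_inner_left]) simp
      show "Ck_on k (\<lambda>x. frechet_derivative g (at (f x)) i) S"

      proof (rule Suc.IH)
        show "Ck_on k f S" using Suc.prems(1) by (rule Ck_on_Suc_imp)
        show "Ck_on k (\<lambda>x. frechet_derivative g (at x) i) T" using Suc.prems(2) by simp
      qed
    qed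
    fix x assume "x \<in> S"
    then show "(\<Sum>i\<in>Basis. (frechet_derivative f (at x) v \<bullet> i) *\<^sub>R frechet_derivative g (at (f x)) i)
      = frechet_derivative (\<lambda>x. g (f x)) (at x) v"
      using linear_expand_Basis[OF lin] frechet_derivative_at[OF d] by metis
  qed
  then show ?case by (simp add: Derivative.differentiableI[OF d])
qed

lemma Cinf_on_cong: "open S \<Longrightarrow> (\<And>x. x \<in> S \<Longrightarrow> f x = g x) \<Longrightarrow> Cinf_on f S \<Longrightarrow> Cinf_on g S"
  unfolding Cinf_on_def using Ck_on_cong by blast

lemma Cinf_on_subset: "Cinf_on f S \<Longrightarrow> T \<subseteq> S \<Longrightarrow> Cinf_on f T"
  unfolding Cinf_on_def using Ck_on_subset by blast

lemma Cinf_on_local: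
  "(\<And>x. x \<in> S \<Longrightarrow> \<exists>V. open V \<and> x \<in> V \<and> Cinf_on f V) \<Longrightarrow> Cinf_on f S"
  unfolding Cinf_on_def by (intro allI Ck_on_local) blast

lemma Cinf_on_const [simp]: "Cinf_on (\<lambda>x. c) S"
  unfolding Cinf_on_def by simp

lemma Cinf_on_linear: "bounded_linear L \<Longrightarrow> Cinf_on L S"
  unfolding Cinf_on_def using Ck_on_linear by blast

lemma Cinf_on_linear_comp:
  "open S \<Longrightarrow> bounded_linear L \<Longrightarrow> Cinf_on f S \<Longrightarrow> Cinf_on (\<lambda>x. L (f x)) S"
  unfolding Cinf_on_def using Ck_on_linear_comp by blast

lemma Cinf_on_add: "open S \<Longrightarrow> Cinf_on f S \<Longrightarrow> Cinf_on g S \<Longrightarrow> Cinf_on (\<lambda>x. f x + g x) S"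
  unfolding Cinf_on_def using Ck_on_add by blast

lemma Cinf_on_diff: "open S \<Longrightarrow> Cinf_on f S \<Longrightarrow> Cinf_on g S \<Longrightarrow> Cinf_on (\<lambda>x. f x - g x) S"
  using Cinf_on_add[of S f "\<lambda>x. - g x"] Cinf_on_linear_comp[of S uminus g]
  by (simp add: bounded_linear_minus[OF bounded_linear_ident])

lemma Cinf_on_sum:
  "open S \<Longrightarrow> (\<And>i. i \<in> I \<Longrightarrow> Cinf_on (f i) S) \<Longrightarrow> Cinf_on (\<lambda>x. \<Sum>i\<in>I. f i x) S"
  unfolding Cinf_on_def using Ck_on_sum[of S I] by blast

lemma Cinf_on_scaleR:
  "open S \<Longrightarrow> Cinf_on a S \<Longrightarrow> Cinf_on g S \<Longrightarrow> Cinf_on (\<lambda>x. a x *\<^sub>R g x) S"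
  unfolding Cinf_on_def using Ck_on_scaleR by blast

lemma Cinf_on_Pair:
  assumes "open S" "Cinf_on f S" "Cinf_on g S"
  shows "Cinf_on (\<lambda>x. (f x, g x)) S"
  using Cinf_on_add[OF assms(1)
      Cinf_on_linear_comp[OF assms(1) bounded_linear_Pair[OF bounded_linear_ident bounded_linear_zero] assms(2)]
      Cinf_on_linear_comp[OF assms(1) bounded_linear_Pair[OF bounded_linear_zero bounded_linear_ident] assms(3)]]
  by simp

lemma Cinf_on_compose:
  "open S \<Longrightarrow> open T \<Longrightarrow> f ` S \<subseteq> T \<Longrightarrow> Cinf_on f S \<Longrightarrow> Cinf_on g T \<Longrightarrow> Cinf_on (\<lambda>x. g (f x)) S"
  unfolding Cinf_on_def using Ck_on_compose by blast

lemma Cinf_on_continuous: "Cinf_on f S \<Longrightarrow> continuous_on S f"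
  unfolding Cinf_on_def using Ck_on.simps(1) by blast

lemma Cinf_on_differentiable: "Cinf_on f S \<Longrightarrow> x \<in> S \<Longrightarrow> f differentiable (at x)"
  unfolding Cinf_on_def using Ck_on.simps(2)[of 0] by blast

lemma Cinf_on_has_derivative:
  "Cinf_on f S \<Longrightarrow> x \<in> S \<Longrightarrow> (f has_derivative frechet_derivative f (at x)) (at x)"
  using Cinf_on_differentiable frechet_derivative_works by blast

lemma Cinf_on_frechet_derivative: "Cinf_on f S \<Longrightarrow> Cinf_on (\<lambda>x. frechet_derivative f (at x) v) S"
  unfolding Cinf_on_def using Ck_on.simps(2) by blast

lemma smooth_on_iff_Cinf_on:
  assumes "open S"
  shows "smooth_on S f \<longleftrightarrow> Cinf_on f S"
proof
  assume s: "smooth_on S f"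
  show "Cinf_on f S"
  proof (rule Cinf_on_local)
    fix x assume x: "x \<in> S"
    obtain W g where W: "open W" "x \<in> W" "\<forall>k. Ck_on k g W" "\<forall>y\<in>S \<inter> W. g y = f y"
      using s x unfolding smooth_on_def by meson
    have "Cinf_on f (S \<inter> W)"
      by (rule Cinf_on_cong[where f = g])
        (use W assms in \<open>auto simp: Cinf_on_def intro: Ck_on_subset\<close>)
    then show "\<exists>V. open V \<and> x \<in> V \<and> Cinf_on f V" using W x assms by blast
  qed
next
  assume "Cinf_on f S"
  then show "smooth_on S f"
    unfolding smooth_on_def Cinf_on_def using assms by (intro ballI exI[of _ S] exI[of _ f]) simp
qed

lemma smooth_on_imp_Cinf_on: "smooth_on S f \<Longrightarrow> open S \<Longrightarrow> Cinf_on f S"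
  by (simp add: smooth_on_iff_Cinf_on)

definition dir_deriv :: "'a::euclidean_space \<Rightarrow> ('a \<Rightarrow> 'b::euclidean_space) \<Rightarrow> 'a \<Rightarrow> 'b" where
  "dir_deriv v f x = frechet_derivative f (at x) v"

lemma Cinf_on_dir_deriv: "Cinf_on f S \<Longrightarrow> Cinf_on (dir_deriv v f) S"
  unfolding dir_deriv_def[abs_def] by (rule Cinf_on_frechet_derivative)

lemma dir_deriv_along_line:
  assumes "Cinf_on g U" "x + s *\<^sub>R v \<in> U"
  shows "((\<lambda>s. g (x + s *\<^sub>R v)) has_vector_derivative dir_deriv v g (x + s *\<^sub>R v)) (at s)"
proof -
  have 1: "((\<lambda>s. x + s *\<^sub>R v) has_derivative (\<lambda>h. h *\<^sub>R v)) (at s)"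
    by (auto intro!: derivative_eq_intros)
  have 2: "(g has_derivative frechet_derivative g (at (x + s *\<^sub>R v))) (at (x + s *\<^sub>R v))"
    using assms Cinf_on_has_derivative by blast
  show ?thesis
    unfolding has_vector_derivative_def dir_deriv_def
    using has_derivative_compose[OF 1 2] linear_cmul[OF has_derivative_linear[OF 2]] by simp
qed

section \<open>Second order expansions along curves\<close>

text \<open>Two applications of the mean value inequality. The error is measured against an arbitrary
  constant \<open>c\<close>, and parameters of \<open>g\<close> enter only through \<open>e\<close>; the bound is therefore uniform in
  parameters as soon as the second derivative is uniformly close to \<open>c\<close>.\<close>

lemma taylor2_bound:
  fixes g :: "real \<Rightarrow> 'a::real_normed_vector"
  assumes t: "t \<ge> 0"
    and g: "\<And>s. s \<in> {0..t} \<Longrightarrow> (g has_vector_derivative g1 s) (at s)"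
    and g1: "\<And>s. s \<in> {0..t} \<Longrightarrow> (g1 has_vector_derivative g2 s) (at s)"
    and e: "\<And>s. s \<in> {0..t} \<Longrightarrow> norm (g2 s - c) \<le> e"
  shows "norm (g t - g 0 - t *\<^sub>R g1 0 - (t\<^sup>2 / 2) *\<^sub>R c) \<le> e * t\<^sup>2"
proof -
  have e0: "e \<ge> 0" using e[of 0] t by (meson atLeastAtMost_iff norm_ge_zero order_refl order_trans)
  have b: "norm (f s) \<le> B * s"
    if "s \<in> {0..t}" "f 0 = 0" "\<And>s. s \<in> {0..t} \<Longrightarrow> (f has_vector_derivative f1 s) (at s)"
      "\<And>s. s \<in> {0..t} \<Longrightarrow> norm (f1 s) \<le> B" for f :: "real \<Rightarrow> 'a" and f1 B s
  proof -
    have "norm (f s - f 0) \<le> B * norm (s - 0)"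
    proof (rule differentiable_bound[of "{0..t}" f "\<lambda>x h. h *\<^sub>R f1 x"])
      show "(f has_derivative (\<lambda>h. h *\<^sub>R f1 x)) (at x within {0..t})" if "x \<in> {0..t}" for x
        using \<open>\<And>s. s \<in> {0..t} \<Longrightarrow> (f has_vector_derivative f1 s) (at s)\<close>[OF that]
        by (simp add: has_vector_derivative_def has_derivative_at_withinI)
      show "onorm (\<lambda>h. h *\<^sub>R f1 x) \<le> B" if "x \<in> {0..t}" for x
      proof (rule onorm_le)
        fix h show "norm (h *\<^sub>R f1 x) \<le> B * norm h"
          using \<open>\<And>s. s \<in> {0..t} \<Longrightarrow> norm (f1 s) \<le> B\<close>[OF that]
          by (metis abs_ge_zero mult.commute mult_left_mono norm_scaleR real_norm_def)
      qed
    qed (use that t in auto)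
    then show ?thesis using that by auto
  qed
  have 1: "norm (g1 s - g1 0 - s *\<^sub>R c) \<le> e * s" if "s \<in> {0..t}" for s
    proof (rule b[where ?f1.0 = "\<lambda>s. g2 s - c"])
    show "((\<lambda>s. g1 s - g1 0 - s *\<^sub>R c) has_vector_derivative g2 s - c) (at s)" if "s \<in> {0..t}" for s
      using g1[OF that] by (auto intro!: derivative_eq_intros)
  qed (use that e in auto)
  have "norm (g t - g 0 - t *\<^sub>R g1 0 - (t\<^sup>2 / 2) *\<^sub>R c) \<le> (e * t) * t"
  proof (rule b[where ?f1.0 = "\<lambda>s. g1 s - g1 0 - s *\<^sub>R c"])
    fix s assume s: "s \<in> {0..t}"
    show "((\<lambda>t. g t - g 0 - t *\<^sub>R g1 0 - (t\<^sup>2 / 2) *\<^sub>R c) has_vector_derivative g1 s - g1 0 - s *\<^sub>R c) (at s)"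
      using g[OF s] by (auto intro!: derivative_eq_intros)
    have "e * s \<le> e * t" using s e0 by (intro mult_left_mono) auto
    then show "norm (g1 s - g1 0 - s *\<^sub>R c) \<le> e * t" using 1[OF s] by linarith
  qed (use t in auto)
  then show ?thesis by (simp add: power2_eq_square)
qed

lemma taylor2_along_line:
  assumes f: "Cinf_on f U" and t: "t \<ge> 0"
    and line: "\<And>s. s \<in> {0..t} \<Longrightarrow> x + s *\<^sub>R v \<in> U"
    and e: "\<And>s. s \<in> {0..t} \<Longrightarrow> norm (dir_deriv v (dir_deriv v f) (x + s *\<^sub>R v) - c) \<le> e"
  shows "norm (f (x + t *\<^sub>R v) - f x - t *\<^sub>R dir_deriv v f x - (t\<^sup>2 / 2) *\<^sub>R c) \<le> e * t\<^sup>2"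
  using taylor2_bound[OF t, of "\<lambda>s. f (x + s *\<^sub>R v)" "\<lambda>s. dir_deriv v f (x + s *\<^sub>R v)", OF
      dir_deriv_along_line[OF f line] dir_deriv_along_line[OF Cinf_on_dir_deriv[OF f] line] e]
  by simp

lemma Cinf_on_vector_derivative:
  assumes "open V" "Cinf_on c V" "t \<in> V"
  shows "(c has_vector_derivative vector_derivative c (at t)) (at t)"
  using Cinf_on_differentiable[OF assms(2,3)] by (simp add: vector_derivative_works[symmetric])

lemma Cinf_on_vector_derivative_smooth:
  fixes c :: "real \<Rightarrow> 'a::euclidean_space"
  assumes "open V" "Cinf_on c V"
  shows "Cinf_on (\<lambda>t. vector_derivative c (at t)) V"
proof (rule Cinf_on_cong[OF assms(1)])
  show "Cinf_on (\<lambda>x. frechet_derivative c (at x) 1) V"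
    using assms by (intro Cinf_on_frechet_derivative)
  show "frechet_derivative c (at x) 1 = vector_derivative c (at x)" if "x \<in> V" for x
    using frechet_derivative_eq_vector_derivative[OF Cinf_on_differentiable[OF assms(2) that]] by simp
qed

text \<open>The second derivative as a quadratic form: the chain rule for accelerations uses only its
  diagonal values.\<close>

definition second_deriv ::
  "('a::euclidean_space \<Rightarrow> 'b::euclidean_space) \<Rightarrow> 'a \<Rightarrow> 'a \<Rightarrow> 'b" where
  "second_deriv f x v =
     (\<Sum>i\<in>Basis. (v \<bullet> i) *\<^sub>R frechet_derivative (\<lambda>x. frechet_derivative f (at x) i) (at x) v)"

lemma second_deriv_scaleR:
  assumes "Cinf_on f U" "x \<in> U"
  shows "second_deriv f x (s *\<^sub>R v) = s\<^sup>2 *\<^sub>R second_deriv f x v"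
proof -
  have "linear (frechet_derivative (\<lambda>x. frechet_derivative f (at x) i) (at x))" for i
    using Cinf_on_differentiable[OF Cinf_on_frechet_derivative[OF assms(1)] assms(2)]
    by (rule linear_frechet_derivative)
  then show ?thesis
    unfolding second_deriv_def by (simp add: linear_cmul scaleR_sum_right power2_eq_square ac_simps)
qed

lemma compose_vector_derivative:
  fixes c :: "real \<Rightarrow> 'a::euclidean_space" and f :: "'a \<Rightarrow> 'b::euclidean_space"
  assumes "open V" "Cinf_on c V" "open U" "Cinf_on f U" "t \<in> V" "c t \<in> U"
  shows "((\<lambda>t. f (c t)) has_vector_derivative frechet_derivative f (at (c t)) (vector_derivative c (at t))) (at t)"
  using vector_derivative_diff_chain_within[OF Cinf_on_vector_derivative[OF assms(1,2,5)]
      Cinf_on_has_derivative[OF assms(4,6), THEN has_derivative_at_withinI]]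
  by (simp add: o_def)

text \<open>The inner derivative is expanded in the standard basis, so that only derivatives of functions
  with values in the target space occur.\<close>

lemma compose_second_derivative:
  fixes c :: "real \<Rightarrow> 'a::euclidean_space" and f :: "'a \<Rightarrow> 'b::euclidean_space"
  assumes V: "open V" "Cinf_on c V" and U: "open U" "Cinf_on f U" and t: "t \<in> V" "c t \<in> U"
  defines "c1 \<equiv> \<lambda>t. vector_derivative c (at t)"
  shows "((\<lambda>t. vector_derivative (\<lambda>t. f (c t)) (at t)) has_vector_derivative
     frechet_derivative f (at (c t)) (vector_derivative c1 (at t)) + second_deriv f (c t) (c1 t)) (at t)"
proof -
  define g where "g = (\<lambda>i x. frechet_derivative f (at x) i)"
  have g: "Cinf_on (g i) U" for i
    unfolding g_def by (rule Cinf_on_frechet_derivative[OF U(2)])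
  have c1: "(c1 has_vector_derivative vector_derivative c1 (at t)) (at t)"
    unfolding c1_def
    by (rule Cinf_on_vector_derivative[OF V(1) Cinf_on_vector_derivative_smooth[OF V] t(1)])
  have lin: "linear (frechet_derivative f (at x))" if "x \<in> U" for x
    using Cinf_on_differentiable[OF U(2) that] by (rule linear_frechet_derivative)
  have rep: "frechet_derivative f (at x) v = (\<Sum>i\<in>Basis. (v \<bullet> i) *\<^sub>R g i x)" if "x \<in> U" for x v
    unfolding g_def by (rule linear_expand_Basis[OF lin[OF that]])
  have gi: "((\<lambda>t. (c1 t \<bullet> i) *\<^sub>R g i (c t)) has_vector_derivative
     (c1 t \<bullet> i) *\<^sub>R frechet_derivative (g i) (at (c t)) (c1 t)
     + (vector_derivative c1 (at t) \<bullet> i) *\<^sub>R g i (c t)) (at t)" for i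
  proof (rule has_vector_derivative_scaleR)
    show "((\<lambda>t. g i (c t)) has_vector_derivative frechet_derivative (g i) (at (c t)) (c1 t)) (at t)"
      unfolding c1_def by (rule compose_vector_derivative[OF V U(1) g t])
    show "((\<lambda>t. c1 t \<bullet> i) has_real_derivative vector_derivative c1 (at t) \<bullet> i) (at t)"
      unfolding has_real_derivative_iff_has_vector_derivative
      using bounded_linear.has_vector_derivative[OF bounded_linear_inner_left c1] .
  qed
  have "((\<lambda>t. \<Sum>i\<in>Basis. (c1 t \<bullet> i) *\<^sub>R g i (c t)) has_vector_derivative
     (\<Sum>i\<in>Basis. (c1 t \<bullet> i) *\<^sub>R frechet_derivative (g i) (at (c t)) (c1 t)
     + (vector_derivative c1 (at t) \<bullet> i) *\<^sub>R g i (c t))) (at t)"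
    by (rule has_vector_derivative_sum) (rule gi)
  also have "(\<Sum>i\<in>Basis. (c1 t \<bullet> i) *\<^sub>R frechet_derivative (g i) (at (c t)) (c1 t)
     + (vector_derivative c1 (at t) \<bullet> i) *\<^sub>R g i (c t)) =
     frechet_derivative f (at (c t)) (vector_derivative c1 (at t)) + second_deriv f (c t) (c1 t)"
    unfolding second_deriv_def rep[OF t(2)] by (simp add: sum.distrib g_def add.commute)
  finally have main: "((\<lambda>t. \<Sum>i\<in>Basis. (c1 t \<bullet> i) *\<^sub>R g i (c t)) has_vector_derivative
     frechet_derivative f (at (c t)) (vector_derivative c1 (at t)) + second_deriv f (c t) (c1 t)) (at t)" .
  have op: "open (V \<inter> c -` U)"
    using continuous_open_preimage[OF Cinf_on_continuous[OF V(2)] V(1) U(1)] .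
  have *: "(\<Sum>i\<in>Basis. (c1 s \<bullet> i) *\<^sub>R g i (c s)) = vector_derivative (\<lambda>t. f (c t)) (at s)"
    if "s \<in> V \<inter> c -` U" for s
    using compose_vector_derivative[OF V U, of s] that rep[of "c s" "c1 s"]
    by (auto simp: c1_def dest!: vector_derivative_at)
  show ?thesis
    by (rule has_vector_derivative_transform_within_open[OF main op _ *]) (use t in auto)
qed

section \<open>A smooth bump\<close>

text \<open>The functions \<open>s\<^sup>-\<^sup>n exp (- 1 / s)\<close>, extended by \<open>0\<close>. All \<open>n\<close> are treated together because the
  derivatives of one member of the family are combinations of other members.\<close>

definition bump :: "nat \<Rightarrow> real \<Rightarrow> real" where
  "bump n s = (if s \<le> 0 then 0 else (1 / s) ^ n * exp (- 1 / s))"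

text \<open>The exponential series dominates its term of order \<open>n + 2\<close>; the quadratic decay makes the
  derivative at \<open>0\<close> vanish.\<close>

lemma bump_le: "\<bar>bump n s\<bar> \<le> fact (n + 2) * s\<^sup>2"
proof (cases "s \<le> 0")
  case False
  have "(1 / s) ^ (n + 2) / fact (n + 2) \<le> exp (1 / s)"
  proof -
    have "(\<Sum>i\<in>{n+2}. inverse (fact i) *\<^sub>R (1 / s) ^ i) \<le> exp (1 / s)"
      unfolding exp_def
      by (rule sum_le_suminf[OF summable_exp_generic]) (use False in auto)
    then show ?thesis by (simp add: field_simps)
  qed
  then have "(1 / s) ^ (n + 2) \<le> fact (n + 2) * exp (1 / s)"
    by (simp add: pos_divide_le_eq mult.commute del: fact_Suc power_Suc)
  then have "(1 / s) ^ (n + 2) * (s\<^sup>2 * exp (- 1 / s)) \<le> fact (n + 2) * exp (1 / s) * (s\<^sup>2 * exp (- 1 / s))"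
    by (intro mult_right_mono) auto
  moreover have "(1 / s) ^ (n + 2) * (s\<^sup>2 * exp (- 1 / s)) = (1 / s) ^ n * exp (- 1 / s)"
    unfolding power_add using False by (simp add: power_divide)
  moreover have "fact (n + 2) * exp (1 / s) * (s\<^sup>2 * exp (- 1 / s)) = fact (n + 2) * s\<^sup>2"
    by (simp add: exp_minus del: fact_Suc)
  ultimately have "(1 / s) ^ n * exp (- 1 / s) \<le> fact (n + 2) * s\<^sup>2" by (simp only:)
  then show ?thesis using False by (simp add: bump_def del: fact_Suc)
qed (simp add: bump_def)

lemma bump_has_derivative:
  "(bump n has_real_derivative (bump (n + 2) s - real n * bump (n + 1) s)) (at s)"
proof -
  consider "s < 0" | "s = 0" | "s > 0" by linarith
  then show ?thesis
  proof cases
    case 1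
    have "((\<lambda>s. 0) has_real_derivative (bump (n + 2) s - real n * bump (n + 1) s)) (at s)"
      using 1 by (simp add: bump_def)
    then show ?thesis
      by (rule has_field_derivative_transform_within_open[of _ _ _ "{..<0}"]) (use 1 in \<open>auto simp: bump_def\<close>)
  next
    case 2
    have "((\<lambda>h. (bump n (0 + h) - bump n 0) / h) \<longlongrightarrow> 0) (at 0)"
    proof (rule Lim_null_comparison)
      show "\<forall>\<^sub>F h in at 0. norm ((bump n (0 + h) - bump n 0) / h) \<le> fact (n + 2) * \<bar>h\<bar>"
      proof (rule eventually_at_filter[THEN iffD2], rule always_eventually, intro allI impI)
        fix h :: real assume "h \<noteq> 0"
        have "norm ((bump n (0 + h) - bump n 0) / h) = \<bar>bump n h\<bar> / \<bar>h\<bar>"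
          by (simp add: bump_def)
        also have "\<dots> \<le> fact (n + 2) * h\<^sup>2 / \<bar>h\<bar>" by (intro divide_right_mono bump_le) auto
        also have "\<dots> = fact (n + 2) * (h\<^sup>2 / \<bar>h\<bar>)" by (simp del: fact_Suc)
        also have "h\<^sup>2 / \<bar>h\<bar> = \<bar>h\<bar>"
          using \<open>h \<noteq> 0\<close> by (simp add: power2_eq_square abs_if)
        finally show "norm ((bump n (0 + h) - bump n 0) / h) \<le> fact (n + 2) * \<bar>h\<bar>" .
      qed
      have "((\<lambda>h. fact (n + 2) * \<bar>h\<bar>) \<longlongrightarrow> fact (n + 2) * \<bar>0::real\<bar>) (at 0)"
        by (intro tendsto_intros)
      then show "((\<lambda>h. fact (n + 2) * \<bar>h\<bar>) \<longlongrightarrow> (0::real)) (at 0)" by simp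
    qed
    then show ?thesis using 2 by (simp add: DERIV_def bump_def)
  next
    case 3
    have r: "((\<lambda>s. 1 / s) has_real_derivative - ((1 / s)\<^sup>2)) (at s)"
      using 3 by (auto intro!: derivative_eq_intros simp: power2_eq_square)
    have "((\<lambda>s. exp (- (1 / s))) has_real_derivative exp (- (1 / s)) * - (- ((1 / s)\<^sup>2))) (at s)"
      by (rule DERIV_fun_exp[OF DERIV_minus[OF r]])
    from DERIV_mult[OF DERIV_power[OF r, of n] this]
    have "((\<lambda>s. (1 / s) ^ n * exp (- 1 / s)) has_real_derivative
        real n * (- ((1 / s)\<^sup>2) * (1 / s) ^ (n - 1)) * exp (- 1 / s)
        + exp (- 1 / s) * (1 / s)\<^sup>2 * (1 / s) ^ n) (at s)"
      by simp
    also have "real n * (- ((1 / s)\<^sup>2) * (1 / s) ^ (n - 1)) * exp (- 1 / s)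
        + exp (- 1 / s) * (1 / s)\<^sup>2 * (1 / s) ^ n = bump (n + 2) s - real n * bump (n + 1) s"
      using 3 by (cases n) (simp_all add: bump_def power2_eq_square ac_simps)
    finally have "((\<lambda>s. (1 / s) ^ n * exp (- 1 / s)) has_real_derivative
        (bump (n + 2) s - real n * bump (n + 1) s)) (at s)" .
    then show ?thesis
      by (rule has_field_derivative_transform_within_open[of _ _ _ "{0<..}"]) (use 3 in \<open>auto simp: bump_def\<close>)
  qed
qed

lemma Cinf_on_bump: "Cinf_on (bump n) UNIV"
proof -
  have "Ck_on k (bump n) UNIV" for k
  proof (induction k arbitrary: n)
    case 0
    have "isCont (bump n) s" for s
      by (rule DERIV_isCont[OF bump_has_derivative])
    then show ?case by (simp add: continuous_at_imp_continuous_on)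
  next
    case (Suc k)
    have d: "frechet_derivative (bump n) (at s) v = v *\<^sub>R (bump (n + 2) s + (- real n) *\<^sub>R bump (n + 1) s)" for s v
      using frechet_derivative_at[OF bump_has_derivative[unfolded has_field_derivative_def], symmetric]
      by (simp add: mult.commute)
    have "Ck_on k (\<lambda>s. frechet_derivative (bump n) (at s) v) UNIV" for v
      unfolding d by (intro Ck_on_scaleR Ck_on_add Suc open_UNIV Ck_on_const)
    moreover have "bump n differentiable (at s)" for s
      by (rule Derivative.differentiableI[OF bump_has_derivative[unfolded has_field_derivative_def]])
    ultimately show ?case by simp
  qed
  then show ?thesis by (simp add: Cinf_on_def)
qed

section \<open>Smooth maps in charts\<close>

definition injective_charts :: "('x, 'e) atlas \<Rightarrow> bool" where
  "injective_charts B \<longleftrightarrow> (\<forall>c\<in>B. inj_on (snd c) (fst c))"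

text \<open>Injectivity of the charts makes images commute with intersections, and hence the sets in the
  definition of the atlas topology closed under intersections.\<close>

lemma openin_atlas_topology:
  assumes "injective_charts B"
  shows "openin (atlas_topology B) W \<longleftrightarrow> W \<subseteq> points B \<and>
     (\<forall>c\<in>B. openin (top_of_set (chart_image c)) (snd c ` (fst c \<inter> W)))"
proof -
  have "istopology (\<lambda>W. W \<subseteq> points B \<and>
     (\<forall>c\<in>B. openin (top_of_set (chart_image c)) (snd c ` (fst c \<inter> W))))" (is "istopology ?Q")
    unfolding istopology_def
  proof (intro conjI allI impI)
    fix S T assume ST: "?Q S" "?Q T"
    then show "S \<inter> T \<subseteq> points B" by blast
    show "\<forall>c\<in>B. openin (top_of_set (chart_image c)) (snd c ` (fst c \<inter> (S \<inter> T)))"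
    proof
      fix c assume c: "c \<in> B"
      then have "snd c ` (fst c \<inter> (S \<inter> T)) = snd c ` (fst c \<inter> S) \<inter> snd c ` (fst c \<inter> T)"
        using assms unfolding injective_charts_def inj_on_def by blast
      then show "openin (top_of_set (chart_image c)) (snd c ` (fst c \<inter> (S \<inter> T)))"
        using ST c by (simp add: openin_Int)
    qed
  next
    fix K assume K: "\<forall>S\<in>K. ?Q S"
    then show "\<Union>K \<subseteq> points B" by blast
    show "\<forall>c\<in>B. openin (top_of_set (chart_image c)) (snd c ` (fst c \<inter> \<Union>K))"
    proof
      fix c assume c: "c \<in> B"
      have "snd c ` (fst c \<inter> \<Union>K) = (\<Union>S\<in>K. snd c ` (fst c \<inter> S))" by blast
      then show "openin (top_of_set (chart_image c)) (snd c ` (fst c \<inter> \<Union>K))"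
        using K c by auto
    qed
  qed
  then show ?thesis unfolding atlas_topology_def by simp
qed

lemma topspace_atlas_topology:
  assumes "injective_charts B"
  shows "topspace (atlas_topology B) = points B"
proof
  show "topspace (atlas_topology B) \<subseteq> points B"
    using openin_atlas_topology[OF assms] by (metis openin_topspace)
  have "fst c \<inter> points B = fst c" if "c \<in> B" for c using that by (auto simp: points_def)
  then have "openin (atlas_topology B) (points B)"
    unfolding openin_atlas_topology[OF assms] by simp
  then show "points B \<subseteq> topspace (atlas_topology B)" by (rule openin_subset)
qed

lemma chart_inv_in: "z \<in> chart_image c \<Longrightarrow> chart_inv c z \<in> fst c"
  by (rule inv_into_into)

lemma snd_chart_inv: "z \<in> chart_image c \<Longrightarrow> snd c (chart_inv c z) = z"
  by (rule f_inv_into_f)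

lemma chart_inv_snd: "inj_on (snd c) (fst c) \<Longrightarrow> x \<in> fst c \<Longrightarrow> chart_inv c (snd c x) = x"
  by (rule inv_into_f_f)

lemma injective_charts_inv:
  "injective_charts B \<Longrightarrow> c \<in> B \<Longrightarrow> x \<in> fst c \<Longrightarrow> chart_inv c (snd c x) = x"
  unfolding injective_charts_def by (simp add: inv_into_f_f)

lemma compatible_sym: "compatible c d \<Longrightarrow> compatible d c"
  unfolding compatible_def by (simp add: Int_commute)

lemma compatible_transition:
  assumes "compatible c d" "open (chart_image c)"
  shows "open (snd c ` (fst c \<inter> fst d))"
    and "Cinf_on (\<lambda>z. snd d (chart_inv c z)) (snd c ` (fst c \<inter> fst d))"
proof -
  show o: "open (snd c ` (fst c \<inter> fst d))"
    using assms openin_open_trans unfolding compatible_def by blast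
  show "Cinf_on (\<lambda>z. snd d (chart_inv c z)) (snd c ` (fst c \<inter> fst d))"
    using assms(1) unfolding compatible_def o_def smooth_on_iff_Cinf_on[OF o] by blast
qed

locale manifold =
  fixes A :: "('m, 'e::euclidean_space) atlas"
  assumes manifold: "smooth_manifold A"
begin

lemma inj_A: "injective_charts A"
  using manifold unfolding injective_charts_def smooth_manifold_def smooth_atlas_def by blast

lemma atlas_smooth_charts: "d \<in> A \<Longrightarrow> d \<in> smooth_charts A"
  using manifold unfolding smooth_charts_def smooth_manifold_def smooth_atlas_def points_def by auto

lemma smooth_chartD:
  assumes "u \<in> smooth_charts A"
  shows "fst u \<subseteq> points A" "inj_on (snd u) (fst u)" "open (chart_image u)"
    "d \<in> A \<Longrightarrow> compatible u d"
  using assms unfolding smooth_charts_def by auto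

lemma chart_around:
  assumes "x \<in> points A" obtains d where "d \<in> A" "x \<in> fst d"
  using assms unfolding points_def by auto

lemma openin_A:
  "openin (atlas_topology A) W \<longleftrightarrow> W \<subseteq> points A \<and> (\<forall>c\<in>A. open (snd c ` (fst c \<inter> W)))"
  unfolding openin_atlas_topology[OF inj_A]
  using smooth_chartD(3)[OF atlas_smooth_charts] by (auto simp: openin_open_eq intro: imageI)

lemma open_chart_domain: "u \<in> smooth_charts A \<Longrightarrow> openin (atlas_topology A) (fst u)"
  unfolding openin_atlas_topology[OF inj_A] using smooth_chartD compatible_sym
  unfolding compatible_def by metis

lemma transition_into_atlas:
  assumes "u \<in> smooth_charts A" "d \<in> A"
  shows "open (snd u ` (fst u \<inter> fst d))"
    and "Cinf_on (\<lambda>z. snd d (chart_inv u z)) (snd u ` (fst u \<inter> fst d))"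
    and "open (snd d ` (fst d \<inter> fst u))"
    and "Cinf_on (\<lambda>z. snd u (chart_inv d z)) (snd d ` (fst d \<inter> fst u))"
  using compatible_transition[OF smooth_chartD(4)[OF assms] smooth_chartD(3)[OF assms(1)]]
    compatible_transition[OF compatible_sym[OF smooth_chartD(4)[OF assms]]
      smooth_chartD(3)[OF atlas_smooth_charts[OF assms(2)]]] by blast+

text \<open>The topology is defined by the charts of \<open>A\<close> only. A chart of the maximal atlas is still open,
  since near each point it factors through a chart of \<open>A\<close> and a transition map.\<close>

lemma open_chart_image_Int:
  assumes u: "u \<in> smooth_charts A" and W: "openin (atlas_topology A) W"
  shows "open (snd u ` (fst u \<inter> W))"
proof (subst open_subopen, intro ballI)
  fix z assume "z \<in> snd u ` (fst u \<inter> W)"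
  then obtain x where x: "x \<in> fst u" "x \<in> W" "z = snd u x" by auto
  obtain d where d: "d \<in> A" "x \<in> fst d"
    using chart_around x(1) smooth_chartD(1)[OF u] by blast
  note t = transition_into_atlas[OF u d(1)]
  define T where "T = snd u ` (fst u \<inter> fst d) \<inter> (\<lambda>z. snd d (chart_inv u z)) -` (snd d ` (fst d \<inter> W))"
  have "open T" unfolding T_def
    by (rule continuous_open_preimage[OF Cinf_on_continuous[OF t(2)] t(1)])
      (use W d(1) openin_A in blast)
  moreover have "z \<in> T" using x d chart_inv_snd[OF smooth_chartD(2)[OF u]] by (auto simp: T_def)
  moreover have "T \<subseteq> snd u ` (fst u \<inter> W)"
  proof
    fix y assume "y \<in> T"
    then obtain x' x'' where x': "x' \<in> fst u" "x' \<in> fst d" "y = snd u x'" "x'' \<in> fst d" "x'' \<in> W"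
      "snd d (chart_inv u y) = snd d x''" by (auto simp: T_def)
    then have "x' = x''"
      using chart_inv_snd[OF smooth_chartD(2)[OF u] x'(1)] smooth_chartD(2)[OF atlas_smooth_charts[OF d(1)]]
      by (auto dest: inj_onD)
    then show "y \<in> snd u ` (fst u \<inter> W)" using x' by auto
  qed
  ultimately show "\<exists>T. open T \<and> z \<in> T \<and> T \<subseteq> snd u ` (fst u \<inter> W)" by blast
qed

lemma transition:
  assumes u: "u \<in> smooth_charts A" and v: "v \<in> smooth_charts A"
  shows "open (snd u ` (fst u \<inter> fst v))"
    and "Cinf_on (\<lambda>z. snd v (chart_inv u z)) (snd u ` (fst u \<inter> fst v))"
proof -
  show "open (snd u ` (fst u \<inter> fst v))"
    by (rule open_chart_image_Int[OF u open_chart_domain[OF v]])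
  show "Cinf_on (\<lambda>z. snd v (chart_inv u z)) (snd u ` (fst u \<inter> fst v))"
  proof (rule Cinf_on_local)
    fix z assume "z \<in> snd u ` (fst u \<inter> fst v)"
    then obtain x where x: "x \<in> fst u" "x \<in> fst v" "z = snd u x" by auto
    obtain d where d: "d \<in> A" "x \<in> fst d"
      using chart_around x(1) smooth_chartD(1)[OF u] by blast
    have dS: "d \<in> smooth_charts A" by (rule atlas_smooth_charts[OF d(1)])
    define V where "V = snd u ` (fst u \<inter> (fst v \<inter> fst d))"
    have V: "open V" unfolding V_def
      by (intro open_chart_image_Int[OF u] openin_Int open_chart_domain v dS)
    have inv: "chart_inv u y \<in> fst v" "chart_inv u y \<in> fst d" if "y \<in> V" for y
      using that chart_inv_snd[OF smooth_chartD(2)[OF u]] by (auto simp: V_def)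
    have "Cinf_on (\<lambda>z. snd v (chart_inv d (snd d (chart_inv u z)))) V"
    proof (rule Cinf_on_compose[OF V, where f = "\<lambda>z. snd d (chart_inv u z)"
          and g = "\<lambda>z. snd v (chart_inv d z)" and T = "snd d ` (fst d \<inter> fst v)"])
      show "Cinf_on (\<lambda>z. snd v (chart_inv d z)) (snd d ` (fst d \<inter> fst v))"
        "open (snd d ` (fst d \<inter> fst v))"
        using transition_into_atlas[OF v d(1)] by auto
      show "Cinf_on (\<lambda>z. snd d (chart_inv u z)) V"
        using transition_into_atlas(2)[OF u d(1)] by (rule Cinf_on_subset) (auto simp: V_def)
      show "(\<lambda>z. snd d (chart_inv u z)) ` V \<subseteq> snd d ` (fst d \<inter> fst v)"
        using inv by blast
    qed
    then have "Cinf_on (\<lambda>z. snd v (chart_inv u z)) V"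
      by (rule Cinf_on_cong[OF V, rotated])
        (simp add: inv chart_inv_snd[OF smooth_chartD(2)[OF dS]])
    moreover have "z \<in> V" unfolding V_def x(3) using x d(2) by blast
    ultimately show "\<exists>V. open V \<and> z \<in> V \<and> Cinf_on (\<lambda>z. snd v (chart_inv u z)) V"
      using V by blast
  qed
qed

text \<open>Smooth maps are defined by the charts of a given atlas of the target; this passes to an arbitrary
  chart of its maximal atlas, at the price of shrinking the domain.\<close>

lemma smooth_map_local:
  assumes f: "smooth_map B A f" and B: "injective_charts B" and c: "c \<in> B" "open (chart_image c)"
    and x: "x \<in> fst c" and u: "u \<in> smooth_charts A" "f x \<in> fst u"
  obtains V where "open V" "snd c x \<in> V" "V \<subseteq> chart_image c"
    "\<forall>z\<in>V. f (chart_inv c z) \<in> fst u"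
    "Cinf_on (\<lambda>z. snd u (f (chart_inv c z))) V"
proof -
  have inv: "chart_inv c (snd c y) = y" if "y \<in> fst c" for y
    by (rule injective_charts_inv[OF B c(1) that])
  have cont: "open (snd c ` {y \<in> fst c. f y \<in> W})" if "openin (atlas_topology A) W" for W
  proof -
    have "openin (atlas_topology B) {y \<in> points B. f y \<in> W}"
      using openin_continuous_map_preimage[of "atlas_topology B" "atlas_topology A" f W] f that
      unfolding smooth_map_def topspace_atlas_topology[OF B] by blast
    moreover have "fst c \<inter> {y \<in> points B. f y \<in> W} = {y \<in> fst c. f y \<in> W}"
      using c(1) by (auto simp: points_def)
    ultimately have "openin (top_of_set (chart_image c)) (snd c ` {y \<in> fst c. f y \<in> W})"
      unfolding openin_atlas_topology[OF B] using c(1) by auto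
    then show ?thesis using c(2) openin_open_trans by blast
  qed
  obtain d where d: "d \<in> A" "f x \<in> fst d"
    using chart_around u smooth_chartD(1)[OF u(1)] by blast
  have dS: "d \<in> smooth_charts A" by (rule atlas_smooth_charts[OF d(1)])
  define V where "V = snd c ` {y \<in> fst c. f y \<in> fst u \<inter> fst d}"
  have V: "open V" unfolding V_def by (intro cont openin_Int open_chart_domain u(1) dS)
  have fd: "f (chart_inv c z) \<in> fst u" "f (chart_inv c z) \<in> fst d" if "z \<in> V" for z
    using that inv by (auto simp: V_def)
  have "smooth_on (snd c ` {y \<in> fst c. f y \<in> fst d}) (snd d \<circ> f \<circ> chart_inv c)"
    using f c(1) d(1) unfolding smooth_map_def by blast
  then have "Cinf_on (\<lambda>z. snd d (f (chart_inv c z))) (snd c ` {y \<in> fst c. f y \<in> fst d})"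
    using smooth_on_imp_Cinf_on[OF _ cont[OF open_chart_domain[OF dS]]] by (simp add: o_def)
  then have 1: "Cinf_on (\<lambda>z. snd d (f (chart_inv c z))) V"
    by (rule Cinf_on_subset) (auto simp: V_def)
  have "Cinf_on (\<lambda>z. snd u (chart_inv d (snd d (f (chart_inv c z))))) V"
    by (rule Cinf_on_compose[OF V transition(1)[OF dS u(1)] _ 1 transition(2)[OF dS u(1)]])
      (use fd in auto)
  then have "Cinf_on (\<lambda>z. snd u (f (chart_inv c z))) V"
    by (rule Cinf_on_cong[OF V, rotated])
      (simp add: fd chart_inv_snd[OF smooth_chartD(2)[OF dS]])
  moreover have "snd c x \<in> V" "V \<subseteq> chart_image c" using x u d by (auto simp: V_def)
  ultimately show ?thesis using that V fd by blast
qed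

text \<open>Conversely, continuity and smoothness may be checked near each point in a chart of the maximal
  atlas chosen for that point.\<close>

lemma smooth_mapI_local:
  assumes B: "injective_charts B" "\<And>c. c \<in> B \<Longrightarrow> open (chart_image c)"
    and f: "f \<in> points B \<rightarrow> points A"
    and loc: "\<And>c x. c \<in> B \<Longrightarrow> x \<in> fst c \<Longrightarrow> \<exists>u V. u \<in> smooth_charts A \<and> open V \<and> snd c x \<in> V \<and>
      V \<subseteq> chart_image c \<and> (\<forall>z\<in>V. f (chart_inv c z) \<in> fst u) \<and>
      Cinf_on (\<lambda>z. snd u (f (chart_inv c z))) V"
  shows "smooth_map B A f"
proof -
  have inv: "chart_inv c (snd c y) = y" if "c \<in> B" "y \<in> fst c" for c y
    by (rule injective_charts_inv[OF B(1) that])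
  have cont: "open (snd c ` {y \<in> fst c. f y \<in> W})" if c: "c \<in> B" and W: "openin (atlas_topology A) W" for c W
  proof (subst open_subopen, intro ballI)
    fix z assume "z \<in> snd c ` {y \<in> fst c. f y \<in> W}"
    then obtain x where x: "x \<in> fst c" "f x \<in> W" "z = snd c x" by auto
    obtain u V where uV: "u \<in> smooth_charts A" "open V" "snd c x \<in> V" "V \<subseteq> chart_image c"
      "\<And>z. z \<in> V \<Longrightarrow> f (chart_inv c z) \<in> fst u" "Cinf_on (\<lambda>z. snd u (f (chart_inv c z))) V"
      using loc[OF c x(1)] by blast
    define T where "T = V \<inter> (\<lambda>z. snd u (f (chart_inv c z))) -` (snd u ` (fst u \<inter> W))"
    have "open T" unfolding T_def
      by (rule continuous_open_preimage[OF Cinf_on_continuous[OF uV(6)] uV(2)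
            open_chart_image_Int[OF uV(1) W]])
    moreover have "z \<in> T" using uV(3) uV(5)[OF uV(3)] x inv[OF c x(1)] by (auto simp: T_def)
    moreover have "T \<subseteq> snd c ` {y \<in> fst c. f y \<in> W}"
    proof
      fix y assume "y \<in> T"
      then obtain w where y: "y \<in> V" "w \<in> fst u" "w \<in> W" "snd u (f (chart_inv c y)) = snd u w"
        by (auto simp: T_def)
      then have "f (chart_inv c y) \<in> W"
        using uV(5)[OF y(1)] smooth_chartD(2)[OF uV(1)] by (auto dest: inj_onD)
      moreover have "y \<in> chart_image c" using y uV(4) by blast
      ultimately have "snd c (chart_inv c y) \<in> snd c ` {y \<in> fst c. f y \<in> W}"
        using chart_inv_in[of y c] by blast
      then show "y \<in> snd c ` {y \<in> fst c. f y \<in> W}"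
        using snd_chart_inv[OF \<open>y \<in> chart_image c\<close>] by simp
    qed
    ultimately show "\<exists>T. open T \<and> z \<in> T \<and> T \<subseteq> snd c ` {y \<in> fst c. f y \<in> W}" by blast
  qed
  have "openin (atlas_topology B) {y \<in> points B. f y \<in> W}" if W: "openin (atlas_topology A) W" for W
    unfolding openin_atlas_topology[OF B(1)]
  proof (intro conjI ballI)
    fix c assume c: "c \<in> B"
    have "fst c \<inter> {y \<in> points B. f y \<in> W} = {y \<in> fst c. f y \<in> W}"
      using c by (auto simp: points_def)
    moreover have "snd c ` {y \<in> fst c. f y \<in> W} \<subseteq> chart_image c" by (rule image_mono) simp
    ultimately show "openin (top_of_set (chart_image c)) (snd c ` (fst c \<inter> {x \<in> points B. f x \<in> W}))"
      using cont[OF c W] by (simp only: openin_open_eq[OF B(2)[OF c]])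
  qed simp
  then have "continuous_map (atlas_topology B) (atlas_topology A) f"
    using f unfolding continuous_map_def topspace_atlas_topology[OF B(1)] topspace_atlas_topology[OF inj_A]
    by blast
  moreover have "smooth_on (snd c ` {x \<in> fst c. f x \<in> fst d}) (snd d \<circ> f \<circ> chart_inv c)"
    if c: "c \<in> B" and d: "d \<in> A" for c d
  proof -
    have dS: "d \<in> smooth_charts A" by (rule atlas_smooth_charts[OF d])
    define Z where "Z = snd c ` {x \<in> fst c. f x \<in> fst d}"
    have Z: "open Z" unfolding Z_def by (rule cont[OF c open_chart_domain[OF dS]])
    have fd: "f (chart_inv c z) \<in> fst d" if "z \<in> Z" for z
      using that inv[OF c] by (auto simp: Z_def)
    have "Cinf_on (\<lambda>z. snd d (f (chart_inv c z))) Z"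
    proof (rule Cinf_on_local)
      fix z assume z: "z \<in> Z"
      then obtain x where x: "x \<in> fst c" "f x \<in> fst d" "z = snd c x" by (auto simp: Z_def)
      obtain u V where uV: "u \<in> smooth_charts A" "open V" "snd c x \<in> V" "V \<subseteq> chart_image c"
        "\<And>z. z \<in> V \<Longrightarrow> f (chart_inv c z) \<in> fst u" "Cinf_on (\<lambda>z. snd u (f (chart_inv c z))) V"
        using loc[OF c x(1)] by blast
      have VZ: "open (V \<inter> Z)" using uV(2) Z by blast
      have "Cinf_on (\<lambda>z. snd d (chart_inv u (snd u (f (chart_inv c z))))) (V \<inter> Z)"
        by (rule Cinf_on_compose[OF VZ transition(1)[OF uV(1) dS] _ _ transition(2)[OF uV(1) dS]])
          (use uV(5) fd Cinf_on_subset[OF uV(6)] in auto)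
      then have "Cinf_on (\<lambda>z. snd d (f (chart_inv c z))) (V \<inter> Z)"
        by (rule Cinf_on_cong[OF VZ, rotated])
          (simp add: uV(5) chart_inv_snd[OF smooth_chartD(2)[OF uV(1)]])
      then show "\<exists>V. open V \<and> z \<in> V \<and> Cinf_on (\<lambda>z. snd d (f (chart_inv c z))) V"
        using VZ z x uV(3) by blast
    qed
    then have "smooth_on Z (snd d \<circ> f \<circ> chart_inv c)"
      unfolding smooth_on_iff_Cinf_on[OF Z] o_def .
    then show ?thesis unfolding Z_def .
  qed
  ultimately show ?thesis using f unfolding smooth_map_def by blast
qed

section \<open>Curves\<close>

lemma smooth_curve_in_chart:
  assumes u: "u \<in> smooth_charts A" and c0: "c 0 \<in> fst u"
  shows "smooth_curve A c \<longleftrightarrow>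
    (\<exists>\<epsilon>>0. (\<forall>t\<in>{-\<epsilon><..<\<epsilon>}. c t \<in> fst u) \<and> Cinf_on (\<lambda>t. snd u (c t)) {-\<epsilon><..<\<epsilon>})"
proof
  assume "smooth_curve A c"
  then obtain e where e: "e > 0" "smooth_map (interval_atlas {-e<..<e}) A c"
    unfolding smooth_curve_def by blast
  have inv: "inv_into {-e<..<e} id z = z" if "z \<in> {-e<..<e}" for z
    using inv_into_f_f[of id "{-e<..<e}" z] that by simp
  obtain V where V: "open V" "0 \<in> V" "V \<subseteq> {-e<..<e}"
    "\<forall>z\<in>V. c (inv_into {-e<..<e} id z) \<in> fst u"
    "Cinf_on (\<lambda>z. snd u (c (inv_into {-e<..<e} id z))) V"
    by (rule smooth_map_local[OF e(2), of "({-e<..<e}, id)" 0 u])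
      (use e(1) u c0 in \<open>auto simp: interval_atlas_def injective_charts_def\<close>)
  obtain d where d: "d > 0" "ball 0 d \<subseteq> V" using V(1,2) openE by blast
  have b: "ball 0 d = {-d<..<d}" by (auto simp: dist_real_def)
  have "Cinf_on (\<lambda>t. snd u (c t)) {-d<..<d}"
  proof (rule Cinf_on_cong[OF _ _ Cinf_on_subset[OF V(5)]])
    fix x assume "x \<in> {-d<..<d}"
    then have "x \<in> {-e<..<e}" using d V(3) b by blast
    then show "snd u (c (inv_into {-e<..<e} id x)) = snd u (c x)" by (simp only: inv)
  qed (use d b in auto)
  moreover have "c t \<in> fst u" if "t \<in> {-d<..<d}" for t
  proof -
    have "t \<in> V" using that d b by blast
    moreover have "inv_into {-e<..<e} id t = t" by (rule inv) (use calculation V(3) in blast)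
    ultimately show ?thesis using V(4) by (metis (lifting))
  qed
  ultimately show "\<exists>\<epsilon>>0. (\<forall>t\<in>{-\<epsilon><..<\<epsilon>}. c t \<in> fst u) \<and> Cinf_on (\<lambda>t. snd u (c t)) {-\<epsilon><..<\<epsilon>}"
    using d(1) by (intro exI[of _ d]) simp
next
  assume "\<exists>\<epsilon>>0. (\<forall>t\<in>{-\<epsilon><..<\<epsilon>}. c t \<in> fst u) \<and> Cinf_on (\<lambda>t. snd u (c t)) {-\<epsilon><..<\<epsilon>}"
  then obtain e where e: "e > 0" "\<And>t. t \<in> {-e<..<e} \<Longrightarrow> c t \<in> fst u"
    "Cinf_on (\<lambda>t. snd u (c t)) {-e<..<e}" by blast
  have inv: "inv_into {-e<..<e} id z = z" if "z \<in> {-e<..<e}" for z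
    using inv_into_f_f[of id "{-e<..<e}" z] that by simp
  have "smooth_map (interval_atlas {-e<..<e}) A c"
  proof (rule smooth_mapI_local)
    fix d x assume "d \<in> interval_atlas {-e<..<e}" "x \<in> fst d"
    then have d: "d = ({-e<..<e}, id)" "x \<in> {-e<..<e}" by (auto simp: interval_atlas_def)
    have "Cinf_on (\<lambda>z. snd u (c (inv_into {-e<..<e} id z))) {-e<..<e}"
      by (rule Cinf_on_cong[OF _ _ e(3)]) (simp_all only: inv open_greaterThanLessThan)
    moreover have "\<forall>z\<in>{-e<..<e}. c (inv_into {-e<..<e} id z) \<in> fst u"
      using e(2) inv by simp
    ultimately show "\<exists>u V. u \<in> smooth_charts A \<and> open V \<and> snd d x \<in> V \<and> V \<subseteq> chart_image d \<and>
        (\<forall>z\<in>V. c (chart_inv d z) \<in> fst u) \<and> Cinf_on (\<lambda>z. snd u (c (chart_inv d z))) V"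
      using u d by (intro exI[of _ u] exI[of _ "{-e<..<e}"]) simp
  qed (use e smooth_chartD(1)[OF u] in \<open>auto simp: interval_atlas_def injective_charts_def points_def\<close>)
  then show "smooth_curve A c" unfolding smooth_curve_def using e(1) by blast
qed

lemma smooth_curveE:
  assumes "smooth_curve A c" "u \<in> smooth_charts A" "c 0 \<in> fst u"
  obtains V where "open V" "0 \<in> V" "\<forall>t\<in>V. c t \<in> fst u" "Cinf_on (\<lambda>t. snd u (c t)) V"
proof -
  obtain e where "e > 0" "\<forall>t\<in>{-e<..<e}. c t \<in> fst u" "Cinf_on (\<lambda>t. snd u (c t)) {-e<..<e}"
    using assms(1) unfolding smooth_curve_in_chart[where c = c, OF assms(2,3)] by blast
  then show ?thesis using that[of "{-e<..<e}"] by simp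
qed

lemma smooth_curveI:
  assumes "u \<in> smooth_charts A" "open V" "0 \<in> V" "\<forall>t\<in>V. c t \<in> fst u"
    "Cinf_on (\<lambda>t. snd u (c t)) V"
  shows "smooth_curve A c"
proof -
  obtain d where d: "d > 0" "ball 0 d \<subseteq> V" using assms(2,3) openE by blast
  have b: "ball 0 d = {-d<..<d}" by (auto simp: dist_real_def)
  have "Cinf_on (\<lambda>t. snd u (c t)) {-d<..<d}" "\<forall>t\<in>{-d<..<d}. c t \<in> fst u"
    using d b assms(4) by (auto intro: Cinf_on_subset[OF assms(5)])
  then show ?thesis
    unfolding smooth_curve_in_chart[where c = c, OF assms(1) bspec[OF assms(4,3)]]
    using d(1) by (intro exI[of _ d]) simp
qed

lemma smooth_curve_points:
  assumes "smooth_curve A c" shows "c 0 \<in> points A"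
proof -
  obtain e where e: "e > 0" "c \<in> points (interval_atlas {-e<..<e}) \<rightarrow> points A"
    using assms unfolding smooth_curve_def smooth_map_def by blast
  have "0 \<in> points (interval_atlas {-e<..<e})" using e(1) by (simp add: points_def interval_atlas_def)
  then show ?thesis using e(2) by blast
qed

end

section \<open>Adapted linear coordinates\<close>

lemma linear_lincomb: "linear (lincomb I E)"
  unfolding lincomb_def
  by (rule linearI) (simp_all add: inner_add_left scaleR_add_left sum.distrib scaleR_sum_right)

lemma inner_lincomb_id:
  assumes "I \<subseteq> Basis" "i \<in> Basis"
  shows "lincomb I id y \<bullet> i = (if i \<in> I then y \<bullet> i else 0)"
proof -
  have "finite I" using assms(1) finite_Basis by (rule finite_subset)
  have "lincomb I id y \<bullet> i = (\<Sum>j\<in>I. if j = i then y \<bullet> j else 0)"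
    unfolding lincomb_def inner_sum_left using assms by (intro sum.cong) (auto simp: inner_Basis)
  then show ?thesis using \<open>finite I\<close> by simp
qed

lemma lincomb_Basis_self: "i \<in> Basis \<Longrightarrow> lincomb Basis E i = E i"
  unfolding lincomb_def by (subst sum.remove[of _ i]) (auto simp: inner_Basis split: if_splits intro!: sum.neutral)

lemma lincomb_restrict:
  assumes "I \<subseteq> Basis"
  shows "lincomb Basis E (lincomb I id y) = lincomb I E y"
proof -
  have "lincomb Basis E (lincomb I id y) = (\<Sum>i\<in>Basis. if i \<in> I then (y \<bullet> i) *\<^sub>R E i else 0)"
    unfolding lincomb_def[of Basis] by (intro sum.cong) (auto simp: inner_lincomb_id[OF assms])
  also have "\<dots> = lincomb I E y"
    unfolding lincomb_def using assms by (simp add: sum.inter_restrict[symmetric] Int_absorb1)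
  finally show ?thesis .
qed

text \<open>The maps \<open>horiz\<close> and \<open>vert\<close> are the orthogonal projections of the model space onto \<open>span P\<close> and
  \<open>span (Basis - P)\<close>.\<close>

locale coordinate_splitting =
  fixes P :: "'e::euclidean_space set"
  assumes P: "P \<subseteq> Basis"
begin

abbreviation horiz :: "'e \<Rightarrow> 'e" where "horiz \<equiv> lincomb P id"
abbreviation vert :: "'e \<Rightarrow> 'e" where "vert \<equiv> lincomb (Basis - P) id"

lemma linear_horiz: "linear horiz" and linear_vert: "linear vert"
  by (rule linear_lincomb)+

lemma bounded_linear_horiz: "bounded_linear horiz" and bounded_linear_vert: "bounded_linear vert"
  using linear_horiz linear_vert by (simp_all add: linear_conv_bounded_linear)

lemma inner_horiz: "i \<in> Basis \<Longrightarrow> horiz y \<bullet> i = (if i \<in> P then y \<bullet> i else 0)"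
  by (rule inner_lincomb_id[OF P])

lemma inner_vert: "i \<in> Basis \<Longrightarrow> vert y \<bullet> i = (if i \<in> P then 0 else y \<bullet> i)"
  by (subst inner_lincomb_id) auto

lemma horiz_vert [simp]:
  "horiz y + vert y = y" "horiz (horiz y) = horiz y" "vert (vert y) = vert y"
  "horiz (vert y) = 0" "vert (horiz y) = 0"
proof -
  show "horiz y + vert y = y"
    by (rule euclidean_eqI) (simp add: inner_horiz inner_vert inner_add_left)
  show "horiz (horiz y) = horiz y"
    by (rule euclidean_eqI) (simp add: inner_horiz)
  show "vert (vert y) = vert y"
    by (rule euclidean_eqI) (simp add: inner_vert)
  show "horiz (vert y) = 0"
    by (rule euclidean_eqI) (simp add: inner_horiz inner_vert)
  show "vert (horiz y) = 0"
    by (rule euclidean_eqI) (simp add: inner_horiz inner_vert)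
qed

lemma horiz_simps [simp]:
  "horiz (x + y) = horiz x + horiz y" "horiz (x - y) = horiz x - horiz y"
  "horiz (s *\<^sub>R y) = s *\<^sub>R horiz y" "horiz (- y) = - horiz y" "horiz 0 = 0"
  "vert (x + y) = vert x + vert y" "vert (x - y) = vert x - vert y"
  "vert (s *\<^sub>R y) = s *\<^sub>R vert y" "vert (- y) = - vert y" "vert 0 = 0"
  by (rule linear_add[OF linear_lincomb] linear_diff[OF linear_lincomb] linear_cmul[OF linear_lincomb]
      linear_neg[OF linear_lincomb] linear_0[OF linear_lincomb])+

lemma vert_eq: "vert y = y - horiz y"
  using horiz_vert(1)[of y] by (simp add: algebra_simps del: horiz_vert)

lemma span_P_iff: "y \<in> span P \<longleftrightarrow> vert y = 0"
proof
  assume y: "y \<in> span P"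
  show "vert y = 0"
  proof (rule linear_eq_0_on_span[OF linear_vert _ y])
    fix x assume "x \<in> P"
    then show "vert x = 0"
      using P by (intro euclidean_eqI[where 'a = 'e]) (auto simp: inner_vert inner_Basis)
  qed
next
  assume "vert y = 0"
  then have "y = horiz y" by (simp add: vert_eq)
  moreover have "horiz y \<in> span P"
    unfolding lincomb_def by (intro span_sum span_scale) (auto intro: span_base)
  ultimately show "y \<in> span P" by simp
qed

lemma horiz_span: "y \<in> span P \<Longrightarrow> horiz y = y"
  by (simp add: span_P_iff vert_eq)

lemma horiz_in_span: "horiz y \<in> span P"
  by (simp add: span_P_iff)

lemma span_frame: "span (E ` P) = lincomb Basis E ` span P"
proof -
  have "E ` P = lincomb Basis E ` P"
    using P by (intro image_cong) (auto simp: lincomb_Basis_self subset_iff)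
  then show ?thesis by (simp only: linear_span_image[OF linear_lincomb])
qed

lemma lincomb_horiz: "lincomb Basis E (horiz y) = lincomb P E y"
  by (rule lincomb_restrict[OF P])

lemma lincomb_vert: "lincomb Basis E (vert y) = lincomb (Basis - P) E y"
  by (rule lincomb_restrict) auto

end

section \<open>Tangent vectors in charts\<close>

lemma jet_cong:
  assumes "open V" "0 \<in> V" "\<forall>t\<in>V. snd u (c t) = \<gamma> t"
  shows "velocity u c 0 = vector_derivative \<gamma> (at 0)"
    and "acceleration u c 0 = vector_derivative (\<lambda>t. vector_derivative \<gamma> (at t)) (at 0)"
proof -
  have v: "velocity u c t = vector_derivative \<gamma> (at t)" if "t \<in> V" for t
    unfolding velocity_def
    by (rule vector_derivative_cong_eq)
      (use assms that in \<open>auto simp: eventually_nhds intro!: exI[of _ V]\<close>)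
  show "velocity u c 0 = vector_derivative \<gamma> (at 0)" using v assms by blast
  show "acceleration u c 0 = vector_derivative (\<lambda>t. vector_derivative \<gamma> (at t)) (at 0)"
    unfolding acceleration_def
    by (rule vector_derivative_cong_eq)
      (use assms v in \<open>auto simp: eventually_nhds intro!: exI[of _ V]\<close>)
qed

text \<open>For curves obtained from a smooth function of several variables by moving along a line, such as
  the orbits of a flow or the curves \<open>t \<mapsto> exp (\<delta>\<^sub>t v)\<close> for a smooth family of arrows \<open>v\<close>.\<close>

lemma jet_along_line:
  assumes V: "open V" "Cinf_on f V" "x \<in> V"
    and c: "\<And>t. x + t *\<^sub>R v \<in> V \<Longrightarrow> snd u (c t) = f (x + t *\<^sub>R v)"
  shows "velocity u c 0 = dir_deriv v f x"
    and "acceleration u c 0 = dir_deriv v (dir_deriv v f) x"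
proof -
  define T where "T = (\<lambda>t::real. x + t *\<^sub>R v) -` V"
  have T: "open T" "0 \<in> T" unfolding T_def using V(1,3) by (auto intro!: open_vimage continuous_intros)
  have eq: "\<forall>t\<in>T. snd u (c t) = f (x + t *\<^sub>R v)" using c by (simp add: T_def)
  have d: "vector_derivative (\<lambda>t. g (x + t *\<^sub>R v)) (at t) = dir_deriv v g (x + t *\<^sub>R v)"
    if "Cinf_on g V" "t \<in> T" for g :: "'a \<Rightarrow> 'b" and t
    using vector_derivative_at[OF dir_deriv_along_line[OF that(1)]] that(2) by (simp add: T_def)
  show "velocity u c 0 = dir_deriv v f x" using jet_cong(1)[OF T eq] d[OF V(2) T(2)] by simp
  have "vector_derivative (\<lambda>t. vector_derivative (\<lambda>t. f (x + t *\<^sub>R v)) (at t)) (at 0) =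
      vector_derivative (\<lambda>t. dir_deriv v f (x + t *\<^sub>R v)) (at 0)"
    by (rule vector_derivative_cong_eq)
      (use T d[OF V(2)] in \<open>auto simp: eventually_nhds intro!: exI[of _ T]\<close>)
  then show "acceleration u c 0 = dir_deriv v (dir_deriv v f) x"
    using jet_cong(2)[OF T eq] d[OF Cinf_on_dir_deriv[OF V(2)] T(2)] by simp
qed

definition chart_change :: "('x, 'e) chart \<Rightarrow> ('x, 'e) chart \<Rightarrow> 'e \<Rightarrow> 'e" where
  "chart_change u v = (\<lambda>z. snd v (chart_inv u z))"

abbreviation chart_deriv ::
  "('x, 'e::euclidean_space) chart \<Rightarrow> ('x, 'e) chart \<Rightarrow> 'x \<Rightarrow> 'e \<Rightarrow> 'e" where
  "chart_deriv u v x \<equiv> frechet_derivative (chart_change u v) (at (snd u x))"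

context manifold
begin

lemma chart_change:
  assumes "u \<in> smooth_charts A" "v \<in> smooth_charts A"
  shows "open (snd u ` (fst u \<inter> fst v))" "Cinf_on (chart_change u v) (snd u ` (fst u \<inter> fst v))"
  using transition[OF assms] by (simp_all add: chart_change_def)

lemma linear_chart_deriv:
  assumes "u \<in> smooth_charts A" "v \<in> smooth_charts A" "x \<in> fst u" "x \<in> fst v"
  shows "linear (chart_deriv u v x)"
  by (rule linear_frechet_derivative, rule Cinf_on_differentiable[OF chart_change(2)])
    (use assms in auto)

text \<open>The correction term in the acceleration depends on the velocity only. For curves with equal
  velocities, differences of accelerations thus transform like tangent vectors.\<close>

lemma jet_chart_change:
  assumes c: "smooth_curve A c" and u: "u \<in> smooth_charts A" "c 0 \<in> fst u"
    and v: "v \<in> smooth_charts A" "c 0 \<in> fst v"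
  shows "velocity v c 0 = chart_deriv u v (c 0) (velocity u c 0)"
    and "acceleration v c 0 = chart_deriv u v (c 0) (acceleration u c 0) +
      second_deriv (chart_change u v) (snd u (c 0)) (velocity u c 0)"
proof -
  obtain V1 where V1: "open V1" "0 \<in> V1" "\<forall>t\<in>V1. c t \<in> fst u" "Cinf_on (\<lambda>t. snd u (c t)) V1"
    by (rule smooth_curveE[OF c u])
  obtain V2 where V2: "open V2" "0 \<in> V2" "\<forall>t\<in>V2. c t \<in> fst v" "Cinf_on (\<lambda>t. snd v (c t)) V2"
    by (rule smooth_curveE[OF c v])
  define V where "V = V1 \<inter> V2"
  have V: "open V" "0 \<in> V" and cu: "\<And>t. t \<in> V \<Longrightarrow> c t \<in> fst u"
    using V1 V2 by (auto simp: V_def)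
  define g where "g = (\<lambda>t. snd u (c t))"
  have g: "Cinf_on g V" unfolding g_def V_def by (rule Cinf_on_subset[OF V1(4)]) simp
  have eq: "\<forall>t\<in>V. snd v (c t) = chart_change u v (g t)"
    by (simp add: g_def chart_change_def chart_inv_snd[OF smooth_chartD(2)[OF u(1)] cu])
  have g0: "g 0 \<in> snd u ` (fst u \<inter> fst v)" using u v by (simp add: g_def)
  have vel: "velocity u c = (\<lambda>t. vector_derivative g (at t))"
    by (simp add: velocity_def g_def o_def fun_eq_iff)
  note j = jet_cong[OF V eq]
  note cc = chart_change[OF u(1) v(1)]
  show "velocity v c 0 = chart_deriv u v (c 0) (velocity u c 0)"
    unfolding j(1) vel
    using vector_derivative_at[OF compose_vector_derivative[OF V(1) g cc V(2) g0]]
    by (simp add: g_def)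
  show "acceleration v c 0 = chart_deriv u v (c 0) (acceleration u c 0) +
      second_deriv (chart_change u v) (snd u (c 0)) (velocity u c 0)"
    unfolding j(2) acceleration_def[of u] vel
    using vector_derivative_at[OF compose_second_derivative[OF V(1) g cc V(2) g0]]
    by (simp add: g_def)
qed

lemma curve_from_chart:
  assumes u: "u \<in> smooth_charts A" and V: "open V" "0 \<in> V" "Cinf_on g V" and g0: "g 0 \<in> chart_image u"
  shows "smooth_curve A (\<lambda>t. chart_inv u (g t))"
    and "velocity u (\<lambda>t. chart_inv u (g t)) 0 = vector_derivative g (at 0)"
    and "acceleration u (\<lambda>t. chart_inv u (g t)) 0 =
      vector_derivative (\<lambda>t. vector_derivative g (at t)) (at 0)"
proof -
  define V' where "V' = V \<inter> g -` chart_image u"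
  have V': "open V'" "0 \<in> V'" unfolding V'_def
    using continuous_open_preimage[OF Cinf_on_continuous[OF V(3)] V(1) smooth_chartD(3)[OF u]] V(2) g0
    by auto
  have in_u: "g t \<in> chart_image u" if "t \<in> V'" for t using that by (simp add: V'_def)
  have eq: "\<forall>t\<in>V'. snd u (chart_inv u (g t)) = g t"
    by (simp add: snd_chart_inv[OF in_u])
  have g: "Cinf_on g V'" by (rule Cinf_on_subset[OF V(3)]) (simp add: V'_def)
  have "Cinf_on (\<lambda>t. snd u (chart_inv u (g t))) V'"
    by (rule Cinf_on_cong[OF V'(1) _ g]) (simp add: eq)
  then show "smooth_curve A (\<lambda>t. chart_inv u (g t))"
    by (intro smooth_curveI[OF u V'] ballI chart_inv_in in_u)
  show "velocity u (\<lambda>t. chart_inv u (g t)) 0 = vector_derivative g (at 0)"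
    "acceleration u (\<lambda>t. chart_inv u (g t)) 0 =
      vector_derivative (\<lambda>t. vector_derivative g (at t)) (at 0)"
    by (rule jet_cong[OF V' eq])+
qed

lemma quadratic_curve:
  fixes w n :: 'e
  assumes u: "u \<in> smooth_charts A" and x: "x \<in> fst u"
  defines "c \<equiv> \<lambda>t. chart_inv u (snd u x + t *\<^sub>R w + t\<^sup>2 *\<^sub>R n)"
  shows "smooth_curve A c" "c 0 = x" "velocity u c 0 = w" "acceleration u c 0 = 2 *\<^sub>R n"
proof -
  define g where "g = (\<lambda>t::real. snd u x + t *\<^sub>R w + t\<^sup>2 *\<^sub>R n)"
  have "Cinf_on (\<lambda>t::real. t) UNIV" by (rule Cinf_on_linear) (rule bounded_linear_ident)
  then have "Cinf_on g UNIV"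
    unfolding g_def power2_eq_square scaleR_scaleR[symmetric]
    by (intro Cinf_on_add Cinf_on_scaleR Cinf_on_const open_UNIV)
  note c = curve_from_chart[OF u open_UNIV UNIV_I this]
  have g0: "g 0 = snd u x" by (simp add: g_def)
  have cg: "c = (\<lambda>t. chart_inv u (g t))" by (simp add: c_def g_def)
  have d1: "vector_derivative g (at t) = w + (2 * t) *\<^sub>R n" for t
    unfolding g_def by (rule vector_derivative_at) (auto intro!: derivative_eq_intros)
  have d2: "vector_derivative (\<lambda>t. w + (2 * t) *\<^sub>R n) (at 0) = 2 *\<^sub>R n"
    by (rule vector_derivative_at) (auto intro!: derivative_eq_intros)
  show "smooth_curve A c" "velocity u c 0 = w" "acceleration u c 0 = 2 *\<^sub>R n"
    using c x unfolding cg by (simp_all add: d1 d2 g0)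
  show "c 0 = x" unfolding c_def by (simp add: chart_inv_snd[OF smooth_chartD(2)[OF u] x])
qed

lemma line_curve:
  assumes u: "u \<in> smooth_charts A" and x: "x \<in> fst u"
  shows "smooth_curve A (\<lambda>t. chart_inv u (snd u x + t *\<^sub>R w))"
    "velocity u (\<lambda>t. chart_inv u (snd u x + t *\<^sub>R w)) 0 = w"
  using quadratic_curve[OF assms, of w 0] by simp_all

lemma line_curve_0:
  assumes u: "u \<in> smooth_charts A" and x: "x \<in> fst u"
  shows "chart_inv u (snd u x + 0 *\<^sub>R w) = x"
  using quadratic_curve(2)[OF assms, of w 0] by simp

lemma tangent_class_self: "smooth_curve A c \<Longrightarrow> c \<in> tangent_class A c"
  by (simp add: tangent_class_def)

text \<open>By the chain rule, equality of velocities in one chart implies it in all charts.\<close>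

lemma tangent_class_eq_iff:
  assumes c: "smooth_curve A c" "smooth_curve A c'" and u: "u \<in> smooth_charts A" "c 0 \<in> fst u"
  shows "tangent_class A c = tangent_class A c' \<longleftrightarrow> c 0 = c' 0 \<and> velocity u c 0 = velocity u c' 0"
proof
  assume "tangent_class A c = tangent_class A c'"
  then have "c \<in> tangent_class A c'" using tangent_class_self[OF c(1)] by simp
  then show "c 0 = c' 0 \<and> velocity u c 0 = velocity u c' 0"
    using u unfolding tangent_class_def by auto
next
  assume eq: "c 0 = c' 0 \<and> velocity u c 0 = velocity u c' 0"
  have "velocity v c 0 = velocity v c' 0" if "v \<in> smooth_charts A" "c 0 \<in> fst v" for v
    using jet_chart_change(1)[OF c(1) u that] jet_chart_change(1)[OF c(2) u(1) _ that(1)] that u eq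
    by simp
  then show "tangent_class A c = tangent_class A c'"
    unfolding tangent_class_def using eq by auto
qed

lemma tangent_class_eq_vector:
  assumes "smooth_curve A c" "u \<in> smooth_charts A" "c 0 \<in> fst u"
  shows "tangent_class A c = tangent_vector A u (c 0) (velocity u c 0)"
  unfolding tangent_vector_def
  using tangent_class_eq_iff[OF assms(1) line_curve(1)[OF assms(2,3)] assms(2,3)]
    line_curve(2)[OF assms(2,3)] line_curve_0[OF assms(2,3)] by simp

lemma tangent_vector_eq_iff:
  assumes "u \<in> smooth_charts A" "x \<in> fst u"
  shows "tangent_vector A u x w = tangent_vector A u x w' \<longleftrightarrow> w = w'"
  unfolding tangent_vector_def
  using tangent_class_eq_iff[OF line_curve(1)[OF assms] line_curve(1)[OF assms] assms(1)]
    line_curve(2)[OF assms] line_curve_0[OF assms] assms(2) by simp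

lemma tangent_vector_change:
  assumes u: "u \<in> smooth_charts A" "x \<in> fst u" and v: "v \<in> smooth_charts A" "x \<in> fst v"
  shows "tangent_vector A u x w = tangent_vector A v x (chart_deriv u v x w)"
  unfolding tangent_vector_def[of A u]
  using tangent_class_eq_vector[OF line_curve(1)[OF u] v(1), of w] line_curve_0[OF u, of w] v
    jet_chart_change(1)[OF line_curve(1)[OF u] u(1) _ v(1), of w] line_curve(2)[OF u, of w] u
  by simp

lemma base_point_tangent_vector:
  assumes "u \<in> smooth_charts A" "x \<in> fst u"
  shows "base_point (tangent_vector A u x w) = x"
  unfolding base_point_def
proof (rule the_equality)
  show "\<exists>c\<in>tangent_vector A u x w. c 0 = x"
    unfolding tangent_vector_def
    by (rule bexI[OF _ tangent_class_self[OF line_curve(1)[OF assms]]]) (rule line_curve_0[OF assms])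
  show "y = x" if "\<exists>c\<in>tangent_vector A u x w. c 0 = y" for y
    using that line_curve_0[OF assms] by (auto simp: tangent_vector_def tangent_class_def)
qed

lemma tangent_add_vector:
  assumes u: "u \<in> smooth_charts A" "x \<in> fst u"
  shows "tangent_add A x (tangent_vector A u x w) (tangent_vector A u x w') =
    tangent_vector A u x (w + w')"
  unfolding tangent_add_def
proof (rule the_equality)
  show "\<exists>ua\<in>smooth_charts A. x \<in> fst ua \<and> (\<exists>wa wa'. tangent_vector A u x w = tangent_vector A ua x wa \<and>
      tangent_vector A u x w' = tangent_vector A ua x wa' \<and>
      tangent_vector A u x (w + w') = tangent_vector A ua x (wa + wa'))"
    using u by blast
next
  fix z
  assume "\<exists>ua\<in>smooth_charts A. x \<in> fst ua \<and> (\<exists>wa wa'. tangent_vector A u x w = tangent_vector A ua x wa \<and>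
      tangent_vector A u x w' = tangent_vector A ua x wa' \<and> z = tangent_vector A ua x (wa + wa'))"
  then obtain v a a' where v: "v \<in> smooth_charts A" "x \<in> fst v"
    and a: "tangent_vector A u x w = tangent_vector A v x a" "tangent_vector A u x w' = tangent_vector A v x a'"
    and z: "z = tangent_vector A v x (a + a')" by blast
  have "a = chart_deriv u v x w" "a' = chart_deriv u v x w'"
    using a unfolding tangent_vector_change[OF u v] tangent_vector_eq_iff[OF v] by simp_all
  then show "z = tangent_vector A u x (w + w')"
    unfolding z tangent_vector_change[OF u v] using linear_add[OF linear_chart_deriv[OF u(1) v(1) u(2) v(2)]]
    by simp
qed

lemma tangent_space_eq:
  assumes u: "u \<in> smooth_charts A" "x \<in> fst u"
  shows "tangent_space A x = range (tangent_vector A u x)"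
proof
  show "tangent_space A x \<subseteq> range (tangent_vector A u x)"
    unfolding tangent_space_def using tangent_class_eq_vector[OF _ u(1)] u(2) by auto
  show "range (tangent_vector A u x) \<subseteq> tangent_space A x"
    unfolding tangent_space_def tangent_vector_def
    using line_curve(1)[OF u] line_curve_0[OF u] by blast
qed

lemma normal_class_vector:
  assumes u: "u \<in> smooth_charts A" "x \<in> fst u" and H: "H x = tangent_vector A u x ` K"
  shows "normal_class A H x (tangent_vector A u x w) = tangent_vector A u x ` ((+) w ` K)"
  unfolding normal_class_def H image_image tangent_add_vector[OF u] ..

lemma normal_class_eq_iff:
  assumes u: "u \<in> smooth_charts A" "x \<in> fst u" and H: "H x = tangent_vector A u x ` K"
    and K: "subspace K"
  shows "normal_class A H x (tangent_vector A u x w) = normal_class A H x (tangent_vector A u x w')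
    \<longleftrightarrow> w - w' \<in> K"
proof -
  have inj: "inj (tangent_vector A u x)"
    using tangent_vector_eq_iff[OF u] by (simp add: inj_def)
  have "(+) w ` K = (+) w' ` K \<longleftrightarrow> w - w' \<in> K"
  proof
    assume "(+) w ` K = (+) w' ` K"
    moreover have "w \<in> (+) w ` K" using subspace_0[OF K] by force
    ultimately obtain k where "k \<in> K" "w = w' + k" by blast
    then show "w - w' \<in> K" by simp
  next
    assume d: "w - w' \<in> K"
    show "(+) w ` K = (+) w' ` K"
    proof (intro equalityI subsetI)
      fix y assume "y \<in> (+) w ` K"
      then obtain k where "k \<in> K" "y = w + k" by blast
      then show "y \<in> (+) w' ` K" using subspace_add[OF K d] by (intro image_eqI[of _ _ "w - w' + k"]) simp_all
    next
      fix y assume "y \<in> (+) w' ` K"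
      then obtain k where "k \<in> K" "y = w' + k" by blast
      then show "y \<in> (+) w ` K" using subspace_diff[OF K _ d] by (intro image_eqI[of _ _ "k - (w - w')"]) simp_all
    qed
  qed
  then show ?thesis unfolding normal_class_vector[where H = H, OF u H] inj_image_eq_iff[OF inj] .
qed

end

section \<open>Adapted frames and charts\<close>

text \<open>Composition with an affine isomorphism; this moves the origin of a chart to a given point and
  straightens a frame there.\<close>

lemma (in manifold) affine_chart:
  fixes z0 :: 'e
  assumes u: "u \<in> smooth_charts A" and L: "linear L" "linear M" "\<And>w. M (L w) = w" "\<And>w. L (M w) = w"
  defines "v \<equiv> (fst u, \<lambda>y. M (snd u y - z0))"
  shows "v \<in> smooth_charts A"
    and "x \<in> fst u \<Longrightarrow> chart_deriv v u x = L"
    and "z \<in> chart_image u \<Longrightarrow> M (z - z0) \<in> chart_image v \<and> chart_inv v (M (z - z0)) = chart_inv u z"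
    and "w \<in> chart_image v \<Longrightarrow> z0 + L w \<in> chart_image u \<and> chart_inv v w = chart_inv u (z0 + L w)"
proof -
  note inj_u = smooth_chartD(2)[OF u]
  have bl: "bounded_linear L" "bounded_linear M" using L(1,2) by (simp_all add: linear_conv_bounded_linear)
  have fv: "fst v = fst u" and sv: "snd v y = M (snd u y - z0)" for y by (simp_all add: v_def)
  have Leq: "z0 + L (M (z - z0)) = z" for z by (simp add: L(4))
  have Mi: "M y = M y' \<Longrightarrow> y = y'" for y y' using L(4) by metis
  have inj_v: "inj_on (snd v) (fst v)"
    using inj_u Mi unfolding inj_on_def fv sv by force
  have im: "snd v ` X = (\<lambda>w. z0 + L w) -` (snd u ` X)" for X
  proof (intro equalityI subsetI)
    fix w assume "w \<in> snd v ` X"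
    then show "w \<in> (\<lambda>w. z0 + L w) -` (snd u ` X)" by (auto simp: sv Leq)
  next
    fix w assume "w \<in> (\<lambda>w. z0 + L w) -` (snd u ` X)"
    then obtain x where "x \<in> X" "z0 + L w = snd u x" by auto
    then have "snd v x = w" using L(3)[of w] by (simp add: sv algebra_simps flip: \<open>z0 + L w = snd u x\<close>)
    then show "w \<in> snd v ` X" using \<open>x \<in> X\<close> by blast
  qed
  have aff: "Cinf_on (\<lambda>w. z0 + L w) V" if "open V" for V
    by (intro Cinf_on_add Cinf_on_const Cinf_on_linear that bl)
  have op: "open (snd v ` X)" if "open (snd u ` X)" for X
    unfolding im using that continuous_open_vimage Cinf_on_continuous[OF aff[OF open_UNIV]]
    by (metis open_vimage)
  have inv: "chart_inv v (snd v y) = y" if "y \<in> fst u" for y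
    by (rule inv_into_f_f) (use inj_v that fv in auto)
  show c3: "z \<in> chart_image u \<Longrightarrow> M (z - z0) \<in> chart_image v \<and> chart_inv v (M (z - z0)) = chart_inv u z" for z
  proof -
    assume z: "z \<in> chart_image u"
    have "snd v (chart_inv u z) = M (z - z0)" by (simp add: sv snd_chart_inv[OF z])
    then show ?thesis using inv[OF chart_inv_in[OF z]] chart_inv_in[OF z] fv by (metis imageI)
  qed
  show c4: "w \<in> chart_image v \<Longrightarrow> z0 + L w \<in> chart_image u \<and> chart_inv v w = chart_inv u (z0 + L w)" for w
  proof -
    assume "w \<in> chart_image v"
    then have z: "z0 + L w \<in> chart_image u" using im[of "fst u"] fv by auto
    show ?thesis using c3[OF z] z L(3) by simp
  qed
  show vS: "v \<in> smooth_charts A"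
    unfolding smooth_charts_def
  proof (intro CollectI conjI ballI)
    show "fst v \<subseteq> points A" using smooth_chartD(1)[OF u] fv by simp
    show "inj_on (snd v) (fst v)" by (rule inj_v)
    show ov: "open (chart_image v)" unfolding fv by (rule op[OF smooth_chartD(3)[OF u]])
    fix d assume d: "d \<in> A"
    note t = transition_into_atlas[OF u d]
    have o1: "open (snd v ` (fst v \<inter> fst d))" unfolding fv by (rule op[OF t(1)])
    have o2: "open (snd d ` (fst v \<inter> fst d))" unfolding fv using t(3) by (simp add: Int_commute)
    have in_u: "z0 + L w \<in> snd u ` (fst u \<inter> fst d)" if "w \<in> snd v ` (fst v \<inter> fst d)" for w
      using that im[of "fst u \<inter> fst d"] fv by auto
    have 1: "Cinf_on (\<lambda>w. snd d (chart_inv v w)) (snd v ` (fst v \<inter> fst d))"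
    proof (rule Cinf_on_cong[OF o1])
      show "Cinf_on (\<lambda>w. snd d (chart_inv u (z0 + L w))) (snd v ` (fst v \<inter> fst d))"
        by (rule Cinf_on_compose[OF o1 t(1) _ aff[OF o1] t(2)]) (use in_u in blast)
      show "snd d (chart_inv u (z0 + L w)) = snd d (chart_inv v w)" if "w \<in> snd v ` (fst v \<inter> fst d)" for w
        using c4[of w] that by auto
    qed
    have 2: "Cinf_on (\<lambda>y. snd v (chart_inv d y)) (snd d ` (fst v \<inter> fst d))"
      unfolding sv
      by (rule Cinf_on_linear_comp[OF o2 bl(2)], rule Cinf_on_diff[OF o2 _ Cinf_on_const])
        (use t(4) fv in \<open>simp add: Int_commute\<close>)
    show "compatible v d"
      unfolding compatible_def
    proof (intro conjI)
      show "openin (top_of_set (chart_image v)) (snd v ` (fst v \<inter> fst d))"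
        unfolding openin_open_eq[OF ov] using o1 by blast
      show "openin (top_of_set (chart_image d)) (snd d ` (fst v \<inter> fst d))"
        unfolding openin_open_eq[OF smooth_chartD(3)[OF atlas_smooth_charts[OF d]]] using o2 by blast
      show "smooth_on (snd v ` (fst v \<inter> fst d)) (snd d \<circ> chart_inv v)"
        unfolding smooth_on_iff_Cinf_on[OF o1] o_def by (rule 1)
      show "smooth_on (snd d ` (fst v \<inter> fst d)) (snd v \<circ> chart_inv d)"
        unfolding smooth_on_iff_Cinf_on[OF o2] o_def by (rule 2)
    qed
  qed
  show "chart_deriv v u x = L" if x: "x \<in> fst u"
  proof -
    have "((\<lambda>w. z0 + L w) has_derivative L) (at (snd v x))"
      by (auto intro!: derivative_eq_intros bounded_linear_imp_has_derivative bl)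
    then have "(chart_change v u has_derivative L) (at (snd v x))"
    proof (rule has_derivative_transform_within_open[OF _ smooth_chartD(3)[OF vS]])
      show "snd v x \<in> chart_image v" using x fv by simp
      show "z0 + L w = chart_change v u w" if "w \<in> chart_image v" for w
        using c4[OF that] snd_chart_inv[of "z0 + L w" u] by (simp add: chart_change_def)
    qed
    then show ?thesis by (rule frechet_derivative_at[symmetric])
  qed
qed

locale distributed_manifold = manifold A + coordinate_splitting P
  for A :: "('m, 'e::euclidean_space) atlas" and P :: "'e set" +
  fixes H :: "'m \<Rightarrow> 'm tangent set"
  assumes distribution: "distribution A P H"
begin

abbreviation frame_map :: "('e \<Rightarrow> 'm \<Rightarrow> 'e) \<Rightarrow> 'm \<Rightarrow> 'e \<Rightarrow> 'e" where
  "frame_map E x \<equiv> lincomb Basis (\<lambda>i. E i x)"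

lemma adapted_frameD:
  assumes "adapted_frame A P H u E"
  shows "u \<in> smooth_charts A"
    and "i \<in> Basis \<Longrightarrow> Cinf_on (\<lambda>z. E i (chart_inv u z)) (chart_image u)"
    and "x \<in> fst u \<Longrightarrow> inj (frame_map E x)"
    and "x \<in> fst u \<Longrightarrow> H x = tangent_vector A u x ` frame_map E x ` span P"
proof -
  show u: "u \<in> smooth_charts A" using assms by (simp add: adapted_frame_def)
  show "i \<in> Basis \<Longrightarrow> Cinf_on (\<lambda>z. E i (chart_inv u z)) (chart_image u)"
    using assms smooth_on_imp_Cinf_on[OF _ smooth_chartD(3)[OF u]]
    unfolding adapted_frame_def o_def by blast
  show "x \<in> fst u \<Longrightarrow> inj (frame_map E x)"
    "x \<in> fst u \<Longrightarrow> H x = tangent_vector A u x ` frame_map E x ` span P"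
    using assms by (simp_all add: adapted_frame_def span_frame)
qed

text \<open>The setting of all computations at a point: an \<open>H\<close>-coordinate chart together with a frame that
  is the standard basis at the origin.\<close>

definition centered_frame :: "('m, 'e) chart \<Rightarrow> ('e \<Rightarrow> 'm \<Rightarrow> 'e) \<Rightarrow> 'm \<Rightarrow> bool" where
  "centered_frame u E x \<longleftrightarrow> adapted_frame A P H u E \<and> x \<in> fst u \<and> snd u x = 0 \<and> (\<forall>i\<in>Basis. E i x = i)"

text \<open>Chart and frame are multiplied by the inverse of the frame matrix at the point.\<close>

lemma centered_frameI:
  assumes uE: "adapted_frame A P H u E" and x: "x \<in> fst u"
  defines "M \<equiv> inv_into UNIV (frame_map E x)"
  defines "v \<equiv> (fst u, \<lambda>y. M (snd u y - snd u x))"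
  shows "centered_frame v (\<lambda>i y. M (E i y)) x"
    and "linear M" "\<And>w. M (frame_map E x w) = w" "\<And>w. frame_map E x (M w) = w"
    and "tangent_vector A v x w = tangent_vector A u x (frame_map E x w)"
proof -
  note u = adapted_frameD(1)[OF uE]
  let ?L = "frame_map E"
  have lin: "linear (?L y)" for y by (rule linear_lincomb)
  have bij: "bij (?L x)"
    using adapted_frameD(3)[OF uE x] linear_injective_imp_surjective[OF lin] by (simp add: bij_def)
  show inv_left: "M (?L x w) = w" for w unfolding M_def using bij by (simp add: bij_is_inj)
  show inv_right: "?L x (M w) = w" for w unfolding M_def using bij by (simp add: bij_is_surj surj_f_inv_f)
  show linM: "linear M"
    using inj_linear_imp_inv_linear[OF lin adapted_frameD(3)[OF uE x]] by (simp add: M_def)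
  then have blM: "bounded_linear M" by (simp add: linear_conv_bounded_linear)
  note aff = affine_chart[where ?z0.0 = "snd u x", OF u lin linM inv_left inv_right, folded v_def]
  have fv: "fst v = fst u" by (simp add: v_def)
  have tv: "tangent_vector A v y w = tangent_vector A u y (?L x w)" if "y \<in> fst u" for y w
    using tangent_vector_change[OF aff(1) _ u that] fv that aff(2)[OF that] by simp
  then show "tangent_vector A v x w = tangent_vector A u x (?L x w)" using x by blast
  have Lcomp: "lincomb Basis (\<lambda>i. M (E i y)) w = M (?L y w)" for y w
    unfolding lincomb_def by (simp add: linear_sum[OF linM] linear_cmul[OF linM])
  have "adapted_frame A P H v (\<lambda>i y. M (E i y))"
    unfolding adapted_frame_def
  proof (intro conjI ballI)
    show vS: "v \<in> smooth_charts A" by (rule aff(1))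
    fix i :: 'e assume i: "i \<in> Basis"
    have "Cinf_on (\<lambda>w. E i (chart_inv u (snd u x + ?L x w))) (chart_image v)"
    proof (rule Cinf_on_compose[where f = "\<lambda>w. snd u x + ?L x w" and g = "\<lambda>z. E i (chart_inv u z)"])
      show "Cinf_on (\<lambda>w. snd u x + ?L x w) (chart_image v)"
        using smooth_chartD(3)[OF vS] lin
        by (intro Cinf_on_add Cinf_on_const Cinf_on_linear) (simp_all add: linear_conv_bounded_linear)
      show "(\<lambda>w. snd u x + ?L x w) ` chart_image v \<subseteq> chart_image u" using aff(4) by blast
    qed (use smooth_chartD(3) vS u adapted_frameD(2)[OF uE i] in auto)
    then have "Cinf_on (\<lambda>w. M (E i (chart_inv u (snd u x + ?L x w)))) (chart_image v)"
      by (rule Cinf_on_linear_comp[OF smooth_chartD(3)[OF vS] blM])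
    then have "Cinf_on (\<lambda>w. M (E i (chart_inv v w))) (chart_image v)"
      by (rule Cinf_on_cong[OF smooth_chartD(3)[OF vS], rotated]) (simp only: aff(4))
    then show "smooth_on (chart_image v) ((\<lambda>y. M (E i y)) \<circ> chart_inv v)"
      unfolding smooth_on_iff_Cinf_on[OF smooth_chartD(3)[OF vS]] o_def .
  next
    fix y assume "y \<in> fst v"
    then have y: "y \<in> fst u" using fv by simp
    show "inj (lincomb Basis (\<lambda>i. M (E i y)))"
      using adapted_frameD(3)[OF uE y] inv_right unfolding Lcomp inj_def by metis
    have "?L y ` span P = ?L x ` (\<lambda>w. M (?L y w)) ` span P" by (simp add: image_image inv_right)
    then have "H y = tangent_vector A v y ` (\<lambda>w. M (?L y w)) ` span P"
      unfolding adapted_frameD(4)[OF uE y] by (simp add: image_image tv[OF y])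
    then show "H y = tangent_vector A v y ` span ((\<lambda>i. M (E i y)) ` P)"
      unfolding span_frame Lcomp .
  qed
  moreover have "snd v x = 0" by (simp add: v_def linear_0[OF linM])
  moreover have "M (E i x) = i" if "i \<in> Basis" for i
    using inv_left[of i] lincomb_Basis_self[OF that, of "\<lambda>i. E i x"] by simp
  ultimately show "centered_frame v (\<lambda>i y. M (E i y)) x"
    using x fv by (simp add: centered_frame_def)
qed

lemma centered_frame_exists:
  assumes "x \<in> points A" obtains u E where "centered_frame u E x"
  using distribution assms centered_frameI(1) unfolding distribution_def by blast

lemma centered_frame_map: "centered_frame u E x \<Longrightarrow> frame_map E x w = w"
  unfolding centered_frame_def lincomb_def
  by (simp add: euclidean_representation)

lemma centered_frame_H_chart:
  assumes "centered_frame u E x" shows "u \<in> H_charts A P H x"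
  using adapted_frameD(1,4)[of u E] assms centered_frame_map[OF assms]
  unfolding H_charts_def centered_frame_def by (simp add: image_image)

section \<open>Taylor coordinates of arrows\<close>

lemma H_chartD:
  assumes "u \<in> H_charts A P H m"
  shows "u \<in> smooth_charts A" "m \<in> fst u" "snd u m = 0" "H m = tangent_vector A u m ` span P"
  using assms unfolding H_charts_def by auto

lemma horizontal_iff:
  assumes u: "u \<in> H_charts A P H m" and c: "smooth_curve A c" "c 0 = m"
  shows "tangent_class A c \<in> H m \<longleftrightarrow> velocity u c 0 \<in> span P"
    and "horizontal_curve A H c \<longleftrightarrow> velocity u c 0 \<in> span P"
proof -
  note uD = H_chartD[OF u]
  have "tangent_class A c = tangent_vector A u m (velocity u c 0)"
    using tangent_class_eq_vector[OF c(1) uD(1)] c(2) uD(2) by simp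
  then show "tangent_class A c \<in> H m \<longleftrightarrow> velocity u c 0 \<in> span P"
    unfolding uD(4) using tangent_vector_eq_iff[OF uD(1,2)] by auto
  then show "horizontal_curve A H c \<longleftrightarrow> velocity u c 0 \<in> span P"
    using c by (simp add: horizontal_curve_def)
qed

lemma chart_deriv_span:
  assumes u: "u \<in> H_charts A P H m" and v: "v \<in> H_charts A P H m" and w: "w \<in> span P"
  shows "chart_deriv u v m w \<in> span P"
proof -
  note uD = H_chartD[OF u] and vD = H_chartD[OF v]
  have "tangent_vector A v m (chart_deriv u v m w) \<in> H m"
    unfolding uD(4) using w tangent_vector_change[OF uD(1,2) vD(1,2), of w] by auto
  then show ?thesis unfolding vD(4) using tangent_vector_eq_iff[OF vD(1,2)] by auto
qed

text \<open>The curve \<open>t h + t\<^sup>2 n\<close> has acceleration \<open>2 n\<close>, whence the factor. The horizontal part of the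
  acceleration is dropped because arrows do not see it.\<close>

definition taylor :: "('m, 'e) chart \<Rightarrow> (real \<Rightarrow> 'm) \<Rightarrow> 'e" where
  "taylor u c = velocity u c 0 + vert ((1 / 2) *\<^sub>R acceleration u c 0)"

lemma taylor_parts:
  assumes u: "u \<in> H_charts A P H m" and c: "horizontal_curve A H c" "c 0 = m"
  shows "horiz (taylor u c) = velocity u c 0" "vert (taylor u c) = (1 / 2) *\<^sub>R vert (acceleration u c 0)"
proof -
  have "velocity u c 0 \<in> span P"
    using horizontal_iff(2)[OF u] c by (auto simp: horizontal_curve_def)
  then show "horiz (taylor u c) = velocity u c 0" "vert (taylor u c) = (1 / 2) *\<^sub>R vert (acceleration u c 0)"
    by (simp_all add: taylor_def span_P_iff horiz_span)
qed

text \<open>The derivative of a change of \<open>H\<close>-coordinates preserves \<open>span P\<close>, so the horizontal part of the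
  acceleration contributes nothing to the vertical part of the result. In particular the new Taylor
  coordinates are a function of the old ones.\<close>

lemma taylor_chart_change:
  assumes u: "u \<in> H_charts A P H m" and v: "v \<in> H_charts A P H m"
    and c: "horizontal_curve A H c" "c 0 = m"
  shows "taylor v c = chart_deriv u v m (horiz (taylor u c)) + vert (chart_deriv u v m (vert (taylor u c)))
    + vert ((1 / 2) *\<^sub>R second_deriv (chart_change u v) 0 (horiz (taylor u c)))"
proof -
  note uD = H_chartD[OF u] and vD = H_chartD[OF v]
  let ?D = "chart_deriv u v m" and ?a = "acceleration u c 0"
  have cs: "smooth_curve A c" using c(1) by (simp add: horizontal_curve_def)
  have lin: "linear ?D" by (rule linear_chart_deriv[OF uD(1) vD(1) uD(2) vD(2)])
  note j = jet_chart_change[OF cs uD(1) _ vD(1), unfolded c(2), OF uD(2) vD(2)]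
  have "vert (?D (horiz ?a)) = 0"
    using chart_deriv_span[OF u v horiz_in_span] by (simp add: span_P_iff)
  moreover have "?D ?a = ?D (horiz ?a) + ?D (vert ?a)"
    by (simp flip: linear_add[OF lin])
  ultimately have *: "vert (?D ?a) = vert (?D (vert ?a))" by simp
  show ?thesis
    unfolding taylor_parts[OF u c] taylor_def[of v] j uD(3)
    by (simp add: *[unfolded uD(3)] linear_cmul[OF lin[unfolded uD(3)]] scaleR_add_right)
qed

text \<open>One \<open>H\<close>-coordinate chart suffices to recognize the members of an arrow.\<close>

lemma arrow_class_eq:
  assumes u: "u \<in> H_charts A P H m" and c: "horizontal_curve A H c" "c 0 = m"
  shows "arrow_class A P H c = {c'. horizontal_curve A H c' \<and> c' 0 = m \<and> taylor u c' = taylor u c}"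
proof -
  have "(\<forall>v\<in>H_charts A P H m. velocity v c' 0 = velocity v c 0 \<and>
        acceleration v c' 0 - acceleration v c 0 \<in> span P) \<longleftrightarrow> taylor u c' = taylor u c"
    if c': "horizontal_curve A H c'" "c' 0 = m" for c'
  proof -
    have "velocity v c' 0 = velocity v c 0 \<and> acceleration v c' 0 - acceleration v c 0 \<in> span P
      \<longleftrightarrow> taylor v c' = taylor v c" if v: "v \<in> H_charts A P H m" for v
    proof -
      have "taylor v c' = taylor v c \<longleftrightarrow> horiz (taylor v c') = horiz (taylor v c) \<and> vert (taylor v c') = vert (taylor v c)"
        by (metis horiz_vert(1))
      then show ?thesis by (simp add: taylor_parts[OF v] c c' span_P_iff)
    qed
    moreover have "taylor v c' = taylor v c" if "v \<in> H_charts A P H m" "taylor u c' = taylor u c" for v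
      using taylor_chart_change[OF u that(1)] c c' that(2) by simp
    ultimately show ?thesis using u by blast
  qed
  then show ?thesis unfolding arrow_class_def c(2) by blast
qed

lemma taylor_curve:
  assumes u: "u \<in> H_charts A P H m"
  defines "c \<equiv> \<lambda>y t. chart_inv u (t *\<^sub>R horiz y + t\<^sup>2 *\<^sub>R vert y)"
  shows "horizontal_curve A H (c y)" "c y 0 = m" "taylor u (c y) = y"
proof -
  note uD = H_chartD[OF u]
  have ceq: "c y = (\<lambda>t. chart_inv u (snd u m + t *\<^sub>R horiz y + t\<^sup>2 *\<^sub>R vert y))"
    by (simp add: c_def uD(3))
  note q = quadratic_curve[OF uD(1,2), of "horiz y" "vert y", folded ceq]
  show "c y 0 = m"
    unfolding ceq using quadratic_curve(2)[OF uD(1,2), of "horiz y" "vert y"] by simp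
  then show "horizontal_curve A H (c y)"
    using horizontal_iff(2)[OF u q(1)] q(3) horiz_in_span by simp
  show "taylor u (c y) = y" by (simp add: taylor_def q)
qed

lemma taylor_arrow_eq:
  assumes u: "u \<in> H_charts A P H m"
  shows "taylor_arrow A P H u y = {c. horizontal_curve A H c \<and> c 0 = m \<and> taylor u c = y}"
  unfolding taylor_arrow_def arrow_class_eq[OF u taylor_curve(1,2)[OF u]] taylor_curve(3)[OF u] ..

lemma arrow_class_taylor_arrow:
  assumes u: "u \<in> H_charts A P H m" and c: "horizontal_curve A H c" "c 0 = m"
  shows "arrow_class A P H c = taylor_arrow A P H u (taylor u c)"
  unfolding arrow_class_eq[OF assms] taylor_arrow_eq[OF u] ..

lemma taylor_arrow_inj:
  assumes u: "u \<in> H_charts A P H m"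
  shows "taylor_arrow A P H u y = taylor_arrow A P H u y' \<longleftrightarrow> y = y'"
proof
  assume eq: "taylor_arrow A P H u y = taylor_arrow A P H u y'"
  define q where "q = (\<lambda>t. chart_inv u (t *\<^sub>R horiz y + t\<^sup>2 *\<^sub>R vert y))"
  have q: "horizontal_curve A H q" "q 0 = m" "taylor u q = y"
    unfolding q_def by (rule taylor_curve[OF u])+
  then have "q \<in> taylor_arrow A P H u y" unfolding taylor_arrow_eq[OF u] by simp
  then have "q \<in> taylor_arrow A P H u y'" by (simp only: eq)
  then show "y = y'" using q(3) by (simp add: taylor_arrow_eq[OF u])
qed simp

lemma arrows_eq:
  assumes u: "u \<in> H_charts A P H m"
  shows "arrows A P H m = range (taylor_arrow A P H u)"
proof
  show "arrows A P H m \<subseteq> range (taylor_arrow A P H u)"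
    unfolding arrows_def using arrow_class_taylor_arrow[OF u] by auto
  show "range (taylor_arrow A P H u) \<subseteq> arrows A P H m"
    unfolding arrows_def taylor_arrow_def using taylor_curve(1,2)[OF u] by blast
qed

lemma taylor_coords_arrow:
  assumes u: "u \<in> H_charts A P H m"
  shows "taylor_coords A P H u (taylor_arrow A P H u y) = y"
  unfolding taylor_coords_def
  by (rule inv_into_f_f) (simp_all add: inj_def taylor_arrow_inj[OF u])

lemma base_point_arrow:
  assumes u: "u \<in> H_charts A P H m"
  shows "base_point (taylor_arrow A P H u y) = m"
  unfolding base_point_def
proof (rule the_equality)
  show "\<exists>c\<in>taylor_arrow A P H u y. c 0 = m"
    unfolding taylor_arrow_eq[OF u]
    by (rule bexI[of _ "\<lambda>t. chart_inv u (t *\<^sub>R horiz y + t\<^sup>2 *\<^sub>R vert y)"])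
      (simp_all only: mem_Collect_eq taylor_curve[OF u] simp_thms)
qed (auto simp: taylor_arrow_eq[OF u])

lemma taylor_const:
  assumes u: "u \<in> H_charts A P H m"
  shows "arrow_class A P H (\<lambda>_. m) = taylor_arrow A P H u 0"
proof -
  note uD = H_chartD[OF u]
  have "(\<lambda>_. m) = (\<lambda>t::real. chart_inv u (t *\<^sub>R horiz 0 + t\<^sup>2 *\<^sub>R vert 0))"
    using chart_inv_snd[OF smooth_chartD(2)[OF uD(1)] uD(2)] by (simp add: uD(3))
  then show ?thesis unfolding taylor_arrow_def by simp
qed

definition dil :: "real \<Rightarrow> 'e \<Rightarrow> 'e" where "dil s y = s *\<^sub>R horiz y + s\<^sup>2 *\<^sub>R vert y"

lemma taylor_rescale:
  assumes u: "u \<in> H_charts A P H m" and c: "horizontal_curve A H c" "c 0 = m"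
  shows "horizontal_curve A H (\<lambda>t. c (s * t))" "taylor u (\<lambda>t. c (s * t)) = dil s (taylor u c)"
proof -
  note uD = H_chartD[OF u]
  have cs: "smooth_curve A c" using c(1) by (simp add: horizontal_curve_def)
  have c0: "c 0 \<in> fst u" using c(2) uD(2) by simp
  obtain V where V: "open V" "0 \<in> V" "\<forall>t\<in>V. c t \<in> fst u" "Cinf_on (\<lambda>t. snd u (c t)) V"
    by (rule smooth_curveE[OF cs uD(1) c0])
  define V' where "V' = (\<lambda>t. s * t) -` V"
  have lin: "bounded_linear (\<lambda>t::real. s * t)" by (rule bounded_linear_mult_right)
  have V': "open V'" "0 \<in> V'" unfolding V'_def
    using V(1,2) by (auto intro!: open_vimage continuous_intros)
  define g where "g = (\<lambda>t. snd u (c t))"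
  have g: "Cinf_on g V" unfolding g_def by (rule V(4))
  have "Cinf_on (\<lambda>t. g (s * t)) V'"
    by (rule Cinf_on_compose[OF V'(1) V(1) _ Cinf_on_linear[OF lin] g]) (auto simp: V'_def)
  then have sm: "smooth_curve A (\<lambda>t. c (s * t))"
    by (intro smooth_curveI[OF uD(1) V']) (use V(3) in \<open>auto simp: V'_def g_def\<close>)
  define g1 where "g1 = (\<lambda>t. vector_derivative g (at t))"
  have g1: "Cinf_on g1 V" unfolding g1_def by (rule Cinf_on_vector_derivative_smooth[OF V(1) g])
  have chain: "vector_derivative (\<lambda>t. f (s * t)) (at t) = s *\<^sub>R vector_derivative f (at (s * t))"
    if f: "Cinf_on f V" and t: "t \<in> V'" for f :: "real \<Rightarrow> 'e" and t
  proof (rule vector_derivative_at)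
    have 1: "((\<lambda>t. s * t) has_vector_derivative s) (at t)"
      by (auto intro!: derivative_eq_intros simp: has_vector_derivative_def)
    have 2: "(f has_vector_derivative vector_derivative f (at (s * t))) (at (s * t))"
      by (rule Cinf_on_vector_derivative[OF V(1) f]) (use t in \<open>simp add: V'_def\<close>)
    show "((\<lambda>t. f (s * t)) has_vector_derivative s *\<^sub>R vector_derivative f (at (s * t))) (at t)"
      using vector_diff_chain_at[OF 1 2] by (simp add: o_def)
  qed
  have d1: "vector_derivative (\<lambda>t. g (s * t)) (at t) = s *\<^sub>R g1 (s * t)" if "t \<in> V'" for t
    unfolding g1_def by (rule chain[OF g that])
  have "vector_derivative (\<lambda>t. vector_derivative (\<lambda>t. g (s * t)) (at t)) (at 0) =
    vector_derivative (\<lambda>t. s *\<^sub>R g1 (s * t)) (at 0)"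
    by (rule vector_derivative_cong_eq)
      (use V' d1 in \<open>auto simp: eventually_nhds intro!: exI[of _ V']\<close>)
  also have "\<dots> = s *\<^sub>R vector_derivative (\<lambda>t. g1 (s * t)) (at 0)"
  proof (rule vector_derivative_at, rule bounded_linear.has_vector_derivative[OF bounded_linear_scaleR_right])
    have "Cinf_on (\<lambda>t. g1 (s * t)) V'"
      by (rule Cinf_on_compose[OF V'(1) V(1) _ Cinf_on_linear[OF lin] g1]) (auto simp: V'_def)
    from Cinf_on_vector_derivative[OF V'(1) this V'(2)]
    show "((\<lambda>t. g1 (s * t)) has_vector_derivative vector_derivative (\<lambda>t. g1 (s * t)) (at 0)) (at 0)" .
  qed
  also have "vector_derivative (\<lambda>t. g1 (s * t)) (at 0) = s *\<^sub>R vector_derivative g1 (at 0)"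
    using chain[OF g1 V'(2)] by simp
  finally have d2: "vector_derivative (\<lambda>t. vector_derivative (\<lambda>t. g (s * t)) (at t)) (at 0) =
    s\<^sup>2 *\<^sub>R vector_derivative g1 (at 0)" by (simp add: power2_eq_square)
  have eq: "\<forall>t\<in>V'. snd u (c (s * t)) = g (s * t)" by (simp add: g_def)
  note j = jet_cong[OF V' eq]
  have vg: "velocity u c = g1" by (simp add: velocity_def g_def g1_def o_def fun_eq_iff)
  have vel: "velocity u (\<lambda>t. c (s * t)) 0 = s *\<^sub>R velocity u c 0"
    unfolding j(1) d1[OF V'(2)] by (simp add: vg)
  have acc: "acceleration u (\<lambda>t. c (s * t)) 0 = s\<^sup>2 *\<^sub>R acceleration u c 0"
    unfolding j(2) d2 by (simp add: acceleration_def vg)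
  show "horizontal_curve A H (\<lambda>t. c (s * t))"
    using horizontal_iff(2)[OF u sm] c(2) vel horizontal_iff(2)[OF u cs c(2)] c(1)
    by (simp add: span_P_iff)
  show "taylor u (\<lambda>t. c (s * t)) = dil s (taylor u c)"
    unfolding dil_def taylor_parts[OF u c] by (simp add: taylor_def vel acc)
qed

lemma dilation_taylor_arrow:
  assumes u: "u \<in> H_charts A P H m"
  shows "dilation A P H s (taylor_arrow A P H u y) = taylor_arrow A P H u (dil s y)"
proof -
  have *: "arrow_class A P H (\<lambda>t. c (s * t)) = taylor_arrow A P H u (dil s y)"
    if "c \<in> taylor_arrow A P H u y" for c
  proof -
    have c: "horizontal_curve A H c" "c 0 = m" "taylor u c = y"
      using that by (simp_all add: taylor_arrow_eq[OF u])
    show ?thesis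
      using arrow_class_taylor_arrow[OF u taylor_rescale(1)[OF u c(1,2)], of s] c(2)
        taylor_rescale(2)[OF u c(1,2), of s] c(3) by simp
  qed
  define q where "q = (\<lambda>t. chart_inv u (t *\<^sub>R horiz y + t\<^sup>2 *\<^sub>R vert y))"
  have "horizontal_curve A H q" "q 0 = m" "taylor u q = y"
    unfolding q_def by (rule taylor_curve[OF u])+
  then have q: "q \<in> taylor_arrow A P H u y" unfolding taylor_arrow_eq[OF u] by simp
  show ?thesis
    unfolding dilation_def
  proof (rule the_equality)
    show "\<exists>c\<in>taylor_arrow A P H u y.
        taylor_arrow A P H u (dil s y) = arrow_class A P H (\<lambda>t. c (s * t))"
      by (rule bexI[OF _ q]) (simp only: *[OF q])
  next
    fix w
    assume "\<exists>c\<in>taylor_arrow A P H u y. w = arrow_class A P H (\<lambda>t. c (s * t))"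
    then obtain c where "c \<in> taylor_arrow A P H u y" "w = arrow_class A P H (\<lambda>t. c (s * t))" ..
    then show "w = taylor_arrow A P H u (dil s y)" by (simp only: *)
  qed
qed

section \<open>The bundle \<open>H \<oplus> N\<close> in H-charts\<close>

lemma hn_point_id:
  "hn_point A P H u id x y = (tangent_vector A u x (horiz y), normal_class A H x (tangent_vector A u x (vert y)))"
  unfolding hn_point_def ..

lemma hn_point_inj:
  assumes u: "u \<in> H_charts A P H x"
  shows "hn_point A P H u id x y = hn_point A P H u id x y' \<longleftrightarrow> y = y'"
proof
  note uD = H_chartD[OF u]
  assume "hn_point A P H u id x y = hn_point A P H u id x y'"
  then have "horiz y = horiz y'" "vert y - vert y' \<in> span P"
    unfolding hn_point_id using tangent_vector_eq_iff[OF uD(1,2)]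
      normal_class_eq_iff[where H = H, OF uD(1,2,4) subspace_span] by simp_all
  then have "horiz y = horiz y'" "vert y = vert y'" by (simp_all add: span_P_iff)
  then show "y = y'" by (metis horiz_vert(1))
qed simp

lemma base_point_hn:
  assumes u: "u \<in> H_charts A P H x"
  shows "base_point (fst (hn_point A P H u id x y)) = x"
  unfolding hn_point_id using base_point_tangent_vector[OF H_chartD(1,2)[OF u]] by simp

text \<open>The coordinates of \<open>H\<^sub>x \<oplus> N\<^sub>x\<close> transform by the linear part of \<open>taylor_chart_change\<close>.\<close>

lemma hn_point_chart_change:
  assumes u: "u \<in> H_charts A P H x" and v: "v \<in> H_charts A P H x"
  shows "hn_point A P H u id x y =
    hn_point A P H v id x (chart_deriv u v x (horiz y) + vert (chart_deriv u v x (vert y)))"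
proof -
  note uD = H_chartD[OF u] and vD = H_chartD[OF v]
  let ?D = "chart_deriv u v x"
  have 1: "horiz (?D (horiz y)) = ?D (horiz y)" "vert (?D (horiz y)) = 0"
    using chart_deriv_span[OF u v horiz_in_span] by (simp_all add: horiz_span span_P_iff)
  have "normal_class A H x (tangent_vector A v x (?D (vert y))) =
    normal_class A H x (tangent_vector A v x (vert (?D (vert y))))"
    unfolding normal_class_eq_iff[where H = H, OF vD(1,2,4) subspace_span] by (simp add: span_P_iff)
  then show ?thesis
    unfolding hn_point_id tangent_vector_change[OF uD(1,2) vD(1,2)] by (simp add: 1)
qed

lemma hn_bundle_cases:
  assumes "X \<in> hn_bundle A H" and "\<And>x u E y. x \<in> points A \<Longrightarrow> centered_frame u E x \<Longrightarrow> X = hn_point A P H u id x y \<Longrightarrow> thesis"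
  shows thesis
proof -
  obtain x where x: "x \<in> points A" "X \<in> H x \<times> normal_space A H x"
    using assms(1) unfolding hn_bundle_def by blast
  obtain u E where uE: "centered_frame u E x" by (rule centered_frame_exists[OF x(1)])
  then have u: "u \<in> H_charts A P H x" by (rule centered_frame_H_chart)
  note uD = H_chartD[OF u]
  obtain h w where h: "h \<in> span P" and X: "X = (tangent_vector A u x h, normal_class A H x (tangent_vector A u x w))"
    using x(2) unfolding normal_space_def tangent_space_eq[OF uD(1,2)] uD(4) by blast
  have "normal_class A H x (tangent_vector A u x w) = normal_class A H x (tangent_vector A u x (vert w))"
    unfolding normal_class_eq_iff[where H = H, OF uD(1,2,4) subspace_span] by (simp add: span_P_iff)
  then have "X = hn_point A P H u id x (h + vert w)"
    unfolding hn_point_id X using h by (simp add: horiz_span span_P_iff)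
  then show thesis by (rule assms(2)[OF x(1) uE])
qed

lemma hn_point_in_bundle:
  assumes u: "u \<in> H_charts A P H x"
  shows "hn_point A P H u id x y \<in> hn_bundle A H"
proof -
  note uD = H_chartD[OF u]
  have "tangent_vector A u x (horiz y) \<in> H x" unfolding uD(4) using horiz_in_span by blast
  moreover have "normal_class A H x (tangent_vector A u x (vert y)) \<in> normal_space A H x"
    unfolding normal_space_def tangent_space_eq[OF uD(1,2)] by blast
  moreover have "x \<in> points A" using smooth_chartD(1)[OF uD(1)] uD(2) by blast
  ultimately show ?thesis unfolding hn_point_id hn_bundle_def by blast
qed

text \<open>Coordinates with respect to an arbitrary frame at \<open>x\<close> are coordinates with respect to the
  standard basis in the chart centered at \<open>x\<close>.\<close>

lemma hn_point_centered:
  assumes uE: "adapted_frame A P H u E" and x: "x \<in> fst u"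
  defines "v \<equiv> (fst u, \<lambda>y. inv_into UNIV (frame_map E x) (snd u y - snd u x))"
  shows "hn_point A P H u (\<lambda>i. E i x) x y = hn_point A P H v id x y"
  unfolding hn_point_id hn_point_def[of A P H u]
  using centered_frameI(5)[OF uE x, folded v_def] by (simp add: lincomb_horiz lincomb_vert)

end

section \<open>First and second order limits\<close>

text \<open>A derivative along a curve that has a velocity only at its end point and only from one side.\<close>

lemma tendsto_difference_quotient:
  fixes f :: "'a::real_normed_vector \<Rightarrow> 'b::real_normed_vector" and z :: "real \<Rightarrow> 'a"
  assumes D: "(f has_derivative D) (at 0)" and z: "((\<lambda>t. (1 / t) *\<^sub>R z t) \<longlongrightarrow> h) (at_right 0)"
  shows "(z \<longlongrightarrow> 0) (at_right 0)" "((\<lambda>t. (1 / t) *\<^sub>R (f (z t) - f 0)) \<longlongrightarrow> D h) (at_right 0)"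
proof -
  have pos: "\<forall>\<^sub>F t in at_right (0::real). 0 < t" by (rule eventually_at_right_less)
  have z1: "((\<lambda>t. t *\<^sub>R ((1 / t) *\<^sub>R z t)) \<longlongrightarrow> 0 *\<^sub>R h) (at_right 0)"
    by (intro tendsto_scaleR z tendsto_ident_at)
  have "\<forall>\<^sub>F t in at_right 0. t *\<^sub>R ((1 / t) *\<^sub>R z t) = z t"
    using pos by eventually_elim simp
  from Lim_transform_eventually[OF z1 this] show z0: "(z \<longlongrightarrow> 0) (at_right 0)" by simp
  have lin: "bounded_linear D" using D by (rule has_derivative_bounded_linear)
  define r where "r = (\<lambda>x. if x = 0 then 0 else norm (f x - f 0 - D x) / norm x)"
  have r1: "((\<lambda>x. norm (f x - f 0 - D x) / norm x) \<longlongrightarrow> 0) (at 0)"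
    using D unfolding has_derivative_at by (simp add: divide_inverse mult.commute)
  have r2: "\<forall>\<^sub>F x in at 0. norm (f x - f 0 - D x) / norm x = r x"
    by (simp add: r_def eventually_at_filter)
  have "isCont r 0" using Lim_transform_eventually[OF r1 r2] by (simp add: isCont_def r_def)
  then have rz: "((\<lambda>t. r (z t)) \<longlongrightarrow> 0) (at_right 0)"
    using isCont_tendsto_compose[OF _ z0, of r] by (simp add: r_def)
  have "((\<lambda>t. r (z t) * norm ((1 / t) *\<^sub>R z t)) \<longlongrightarrow> 0 * norm h) (at_right 0)"
    by (intro tendsto_mult rz tendsto_norm z)
  moreover have "\<forall>\<^sub>F t in at_right 0. r (z t) * norm ((1 / t) *\<^sub>R z t) =
      norm ((1 / t) *\<^sub>R (f (z t) - f 0) - D ((1 / t) *\<^sub>R z t))"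
    using pos
  proof eventually_elim
    case (elim t)
    have "(1 / t) *\<^sub>R (f (z t) - f 0) - D ((1 / t) *\<^sub>R z t) = (1 / t) *\<^sub>R (f (z t) - f 0 - D (z t))"
      using linear_cmul[OF bounded_linear.linear[OF lin]] by (simp add: scaleR_diff_right)
    then show ?case using elim linear_0[OF bounded_linear.linear[OF lin]] by (simp add: r_def)
  qed
  ultimately have "((\<lambda>t. norm ((1 / t) *\<^sub>R (f (z t) - f 0) - D ((1 / t) *\<^sub>R z t))) \<longlongrightarrow> 0) (at_right 0)"
    using Lim_transform_eventually by fastforce
  then have "((\<lambda>t. (1 / t) *\<^sub>R (f (z t) - f 0) - D ((1 / t) *\<^sub>R z t)) \<longlongrightarrow> 0) (at_right 0)"
    by (rule tendsto_norm_zero_cancel)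
  from tendsto_add[OF this bounded_linear.tendsto[OF lin z]]
  show "((\<lambda>t. (1 / t) *\<^sub>R (f (z t) - f 0)) \<longlongrightarrow> D h) (at_right 0)" by simp
qed

lemma taylor2_limit:
  fixes g :: "real \<Rightarrow> 'a::euclidean_space"
  assumes V: "open V" "0 \<in> V" "Cinf_on g V"
  shows "((\<lambda>t. (1 / t) *\<^sub>R (g t - g 0)) \<longlongrightarrow> vector_derivative g (at 0)) (at_right 0)"
    and "((\<lambda>t. (1 / t\<^sup>2) *\<^sub>R (g t - g 0 - t *\<^sub>R vector_derivative g (at 0))) \<longlongrightarrow>
      (1 / 2) *\<^sub>R vector_derivative (\<lambda>t. vector_derivative g (at t)) (at 0)) (at_right 0)"
proof -
  define g1 where "g1 = (\<lambda>t. vector_derivative g (at t))"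
  define g2 where "g2 = (\<lambda>t. vector_derivative g1 (at t))"
  have g1: "Cinf_on g1 V" unfolding g1_def by (rule Cinf_on_vector_derivative_smooth[OF V(1,3)])
  have g2: "Cinf_on g2 V" unfolding g2_def by (rule Cinf_on_vector_derivative_smooth[OF V(1) g1])
  have d: "(g has_vector_derivative g1 t) (at t)" "(g1 has_vector_derivative g2 t) (at t)" if "t \<in> V" for t
    unfolding g2_def using Cinf_on_vector_derivative[OF V(1) V(3) that] Cinf_on_vector_derivative[OF V(1) g1 that]
    by (simp_all add: g1_def)
  show "((\<lambda>t. (1 / t) *\<^sub>R (g t - g 0)) \<longlongrightarrow> vector_derivative g (at 0)) (at_right 0)"
  proof -
    have "(g has_derivative (\<lambda>h. h *\<^sub>R g1 0)) (at 0)"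
      using d(1)[OF V(2)] by (simp add: has_vector_derivative_def)
    moreover have "((\<lambda>t. (1 / t) *\<^sub>R t) \<longlongrightarrow> (1::real)) (at_right 0)"
      by (rule Lim_transform_eventually[OF tendsto_const])
        (use eventually_at_right_less[of "0::real"] in \<open>auto elim!: eventually_mono\<close>)
    ultimately show ?thesis using tendsto_difference_quotient(2)[of g] by (fastforce simp: g1_def)
  qed
  have "((\<lambda>t. (1 / t\<^sup>2) *\<^sub>R (g t - g 0 - t *\<^sub>R g1 0)) \<longlongrightarrow> (1 / 2) *\<^sub>R g2 0) (at_right 0)"
  proof (rule tendstoI)
    fix e :: real assume e: "e > 0"
    have "isCont g2 0" using Cinf_on_continuous[OF g2] V by (simp add: continuous_on_eq_continuous_at)
    then obtain r1 where r1: "r1 > 0" "\<And>s. dist s 0 < r1 \<Longrightarrow> dist (g2 s) (g2 0) < e / 2"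
      using e unfolding continuous_at_eps_delta by (metis half_gt_zero)
    obtain r2 where r2: "r2 > 0" "ball 0 r2 \<subseteq> V" using V openE by blast
    have "\<forall>\<^sub>F t in at_right 0. 0 < t \<and> t < min r1 r2"
      by (rule eventually_at_rightI[of 0 "min r1 r2"]) (use r1(1) r2(1) in auto)
    then show "\<forall>\<^sub>F t in at_right 0. dist ((1 / t\<^sup>2) *\<^sub>R (g t - g 0 - t *\<^sub>R g1 0)) ((1 / 2) *\<^sub>R g2 0) < e"
    proof eventually_elim
      case (elim t)
      have "s \<in> V" if "s \<in> {0..t}" for s using that elim r2(2) by (auto simp: dist_real_def subset_iff)
      then have "norm (g t - g 0 - t *\<^sub>R g1 0 - (t\<^sup>2 / 2) *\<^sub>R g2 0) \<le> e / 2 * t\<^sup>2"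
        using elim r1(2) by (intro taylor2_bound[where ?g2.0 = g2] d) (auto simp: dist_norm less_imp_le)
      moreover have "e / 2 * t\<^sup>2 < e * t\<^sup>2" using e elim by simp
      ultimately have "norm (g t - g 0 - t *\<^sub>R g1 0 - (t\<^sup>2 / 2) *\<^sub>R g2 0) / t\<^sup>2 < e"
        using elim by (simp add: pos_divide_less_eq)
      moreover have "(1 / t\<^sup>2) *\<^sub>R (g t - g 0 - t *\<^sub>R g1 0) - (1 / 2) *\<^sub>R g2 0 =
        (1 / t\<^sup>2) *\<^sub>R (g t - g 0 - t *\<^sub>R g1 0 - (t\<^sup>2 / 2) *\<^sub>R g2 0)"
        using elim by (simp add: scaleR_diff_right)
      ultimately show ?case by (simp add: dist_norm)
    qed
  qed
  then show "((\<lambda>t. (1 / t\<^sup>2) *\<^sub>R (g t - g 0 - t *\<^sub>R vector_derivative g (at 0))) \<longlongrightarrow>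
      (1 / 2) *\<^sub>R vector_derivative (\<lambda>t. vector_derivative g (at t)) (at 0)) (at_right 0)"
    by (simp only: g1_def g2_def)
qed

context distributed_manifold
begin

text \<open>Taylor coordinates are the limit of the curve rescaled by the inverse dilations. Together with
  the converse below, this determines arrows from first and second order expansions.\<close>

lemma taylor_limits:
  assumes u: "u \<in> H_charts A P H m" and c: "horizontal_curve A H c" "c 0 = m"
  shows "((\<lambda>t. (1 / t) *\<^sub>R snd u (c t)) \<longlongrightarrow> horiz (taylor u c)) (at_right 0)"
    and "((\<lambda>t. (1 / t\<^sup>2) *\<^sub>R vert (snd u (c t))) \<longlongrightarrow> vert (taylor u c)) (at_right 0)"
proof -
  note uD = H_chartD[OF u]
  have cs: "smooth_curve A c" using c(1) by (simp add: horizontal_curve_def)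
  have c0: "c 0 \<in> fst u" using c(2) uD(2) by simp
  obtain V where V: "open V" "0 \<in> V" "\<forall>t\<in>V. c t \<in> fst u" "Cinf_on (\<lambda>t. snd u (c t)) V"
    by (rule smooth_curveE[OF cs uD(1) c0])
  note l = taylor2_limit[OF V(1,2,4)]
  have vel: "velocity u c = (\<lambda>t. vector_derivative (\<lambda>t. snd u (c t)) (at t))"
    by (simp add: velocity_def o_def fun_eq_iff)
  show "((\<lambda>t. (1 / t) *\<^sub>R snd u (c t)) \<longlongrightarrow> horiz (taylor u c)) (at_right 0)"
    unfolding taylor_parts[OF u c] vel using l(1) c(2) uD(3) by simp
  have v0: "vert (velocity u c 0) = 0" using horizontal_iff(2)[OF u cs c(2)] c(1) by (simp add: span_P_iff)
  from bounded_linear.tendsto[OF bounded_linear_vert l(2)]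
  show "((\<lambda>t. (1 / t\<^sup>2) *\<^sub>R vert (snd u (c t))) \<longlongrightarrow> vert (taylor u c)) (at_right 0)"
    unfolding taylor_parts[OF u c] acceleration_def vel using v0[unfolded vel] c(2) uD(3) by simp
qed

lemma taylor_of_limits:
  assumes u: "u \<in> H_charts A P H m" and c: "smooth_curve A c" "c 0 = m" and h: "h \<in> span P"
    and l1: "((\<lambda>t. (1 / t) *\<^sub>R snd u (c t)) \<longlongrightarrow> h) (at_right 0)"
    and l2: "((\<lambda>t. (1 / t\<^sup>2) *\<^sub>R vert (snd u (c t))) \<longlongrightarrow> n) (at_right 0)"
  shows "horizontal_curve A H c" "taylor u c = h + n"
proof -
  note uD = H_chartD[OF u]
  have c0: "c 0 \<in> fst u" using c(2) uD(2) by simp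
  obtain V where V: "open V" "0 \<in> V" "\<forall>t\<in>V. c t \<in> fst u" "Cinf_on (\<lambda>t. snd u (c t)) V"
    by (rule smooth_curveE[OF c(1) uD(1) c0])
  have "((\<lambda>t. (1 / t) *\<^sub>R snd u (c t)) \<longlongrightarrow> velocity u c 0) (at_right 0)"
    using taylor2_limit(1)[OF V(1,2,4)] c(2) uD(3) by (simp add: velocity_def o_def)
  then have v: "velocity u c 0 = h" using tendsto_unique[OF _ _ l1] by simp
  show hc: "horizontal_curve A H c" using horizontal_iff(2)[OF u c] v h by simp
  note t = taylor_limits[OF u hc c(2)]
  have "horiz (taylor u c) = h" using tendsto_unique[OF _ t(1) l1] by simp
  moreover have "vert (taylor u c) = n" using tendsto_unique[OF _ t(2) l2] by simp
  ultimately show "taylor u c = h + n" by (metis horiz_vert(1))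
qed

section \<open>The structure bilinear form of a centered frame\<close>

abbreviation frame_at :: "('m, 'e) chart \<Rightarrow> ('e \<Rightarrow> 'm \<Rightarrow> 'e) \<Rightarrow> 'e \<Rightarrow> 'e \<Rightarrow> 'e" where
  "frame_at u E z \<equiv> frame_map E (chart_inv u z)"

text \<open>The vertical part of the derivative, in direction \<open>h'\<close> at the origin, of the vector field with
  constant frame components \<open>h\<close>. For horizontal arguments its antisymmetrization is, up to sign, the
  bilinear map \<open>H \<times> H \<rightarrow> TM / H\<close> induced by the Lie bracket of vector fields.\<close>

definition twist :: "('m, 'e) chart \<Rightarrow> ('e \<Rightarrow> 'm \<Rightarrow> 'e) \<Rightarrow> 'e \<Rightarrow> 'e \<Rightarrow> 'e" where
  "twist u E h h' =
    vert (\<Sum>i\<in>Basis. (h \<bullet> i) *\<^sub>R frechet_derivative (\<lambda>z. E i (chart_inv u z)) (at 0) h')"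

context
  fixes u E m
  assumes uE: "centered_frame u E m"
begin

lemma centeredD:
  "adapted_frame A P H u E" "u \<in> H_charts A P H m" "u \<in> smooth_charts A" "m \<in> fst u" "snd u m = 0"
  "i \<in> Basis \<Longrightarrow> E i m = i" "chart_inv u 0 = m" "0 \<in> chart_image u"
proof -
  show a: "adapted_frame A P H u E" "m \<in> fst u" "snd u m = 0" "i \<in> Basis \<Longrightarrow> E i m = i"
    using uE by (simp_all add: centered_frame_def)
  show "u \<in> H_charts A P H m" using uE by (rule centered_frame_H_chart)
  show us: "u \<in> smooth_charts A" by (rule adapted_frameD(1)[OF a(1)])
  show "chart_inv u 0 = m" using chart_inv_snd[OF smooth_chartD(2)[OF us] a(2)] a(3) by simp
  show "0 \<in> chart_image u" using a(2,3) by force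
qed

lemma frame_derivative:
  assumes "i \<in> Basis"
  shows "((\<lambda>z. E i (chart_inv u z)) has_derivative frechet_derivative (\<lambda>z. E i (chart_inv u z)) (at 0)) (at 0)"
  by (rule Cinf_on_has_derivative[OF adapted_frameD(2)[OF centeredD(1) assms] centeredD(8)])

lemma twist_linear: "linear (twist u E h)" "linear (\<lambda>h. twist u E h h')"
proof -
  have "linear (frechet_derivative (\<lambda>z. E i (chart_inv u z)) (at 0))" if "i \<in> Basis" for i
    using frame_derivative[OF that] by (rule has_derivative_linear)
  then show "linear (twist u E h)"
    by (intro linearI)
      (simp_all add: twist_def linear_add linear_cmul scaleR_add_right sum.distrib scaleR_sum_right mult.commute
        flip: horiz_simps(8))
  show "linear (\<lambda>h. twist u E h h')"
    by (intro linearI)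
      (simp_all add: twist_def inner_add_left scaleR_add_left sum.distrib scaleR_sum_right
        flip: horiz_simps(8))
qed

lemma frame_minus_identity:
  "frame_at u E z y - y = (\<Sum>i\<in>Basis. (y \<bullet> i) *\<^sub>R (E i (chart_inv u z) - i))"
  unfolding lincomb_def by (simp add: scaleR_diff_right sum_subtractf euclidean_representation)

lemma frame_near_identity:
  "norm (frame_at u E z y - y) \<le> (\<Sum>i\<in>Basis. norm (E i (chart_inv u z) - i)) * norm y"
proof -
  have "norm (frame_at u E z y - y) \<le> (\<Sum>i\<in>Basis. norm ((y \<bullet> i) *\<^sub>R (E i (chart_inv u z) - i)))"
    unfolding frame_minus_identity by (rule norm_sum)
  also have "\<dots> \<le> (\<Sum>i\<in>Basis. norm (E i (chart_inv u z) - i) * norm y)"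
    by (intro sum_mono) (simp add: mult.commute[of _ "norm y"] mult_right_mono Basis_le_norm)
  finally show ?thesis by (simp add: sum_distrib_right)
qed

lemma frame_defect_tendsto:
  assumes "(z \<longlongrightarrow> 0) F"
  shows "((\<lambda>t. \<Sum>i\<in>Basis. norm (E i (chart_inv u (z t)) - i)) \<longlongrightarrow> 0) F"
proof -
  have "((\<lambda>t. E i (chart_inv u (z t))) \<longlongrightarrow> i) F" if "i \<in> Basis" for i
    using isCont_tendsto_compose[OF has_derivative_continuous[OF frame_derivative[OF that]] assms]
    by (simp add: centeredD(6,7) that)
  then have "((\<lambda>t. \<Sum>i\<in>Basis. norm (E i (chart_inv u (z t)) - i)) \<longlongrightarrow> (\<Sum>i\<in>Basis. norm (i - i :: 'e))) F"
    by (intro tendsto_intros)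
  then show ?thesis by simp
qed

text \<open>The source of the bilinear term in the group law, and of the corresponding term in the limit of
  \<open>(a t, b t, t)\<close>. Passing from the components \<open>x\<close> of a vector at the moving point \<open>z\<close> to its
  components \<open>y\<close> in the frame at \<open>z\<close> does not change the first order part, since the frame tends to
  the standard basis. It changes the second order vertical part by the derivative of the frame in
  the direction \<open>h'\<close> in which \<open>z\<close> leaves the origin.\<close>

lemma frame_limit:
  assumes z: "((\<lambda>t. (1 / t) *\<^sub>R z t) \<longlongrightarrow> h') (at_right 0)"
    and x: "((\<lambda>t. (1 / t) *\<^sub>R x t) \<longlongrightarrow> h) (at_right 0)"
    and y: "\<forall>\<^sub>F t in at_right 0. frame_at u E (z t) (y t) = x t"
  shows "((\<lambda>t. (1 / t) *\<^sub>R y t) \<longlongrightarrow> h) (at_right 0)"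
    and "((\<lambda>t. (1 / t\<^sup>2) *\<^sub>R vert (x t - y t)) \<longlongrightarrow> twist u E h h') (at_right 0)"
proof -
  have pos: "\<forall>\<^sub>F t in at_right (0::real). 0 < t" by (rule eventually_at_right_less)
  have z0: "(z \<longlongrightarrow> 0) (at_right 0)" by (rule tendsto_difference_quotient(1)[OF has_derivative_ident z])
  define q where "q = (\<lambda>t. (1 / t) *\<^sub>R y t)"
  define c where "c = (\<lambda>t. \<Sum>i\<in>Basis. norm (E i (chart_inv u (z t)) - i))"
  have c: "(c \<longlongrightarrow> 0) (at_right 0)" unfolding c_def by (rule frame_defect_tendsto[OF z0])
  have qx: "\<forall>\<^sub>F t in at_right 0. frame_at u E (z t) (q t) = (1 / t) *\<^sub>R x t"
    using y by eventually_elim (simp add: q_def linear_cmul[OF linear_lincomb])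
  have c2: "\<forall>\<^sub>F t in at_right 0. c t < 1 / 2" using c by (rule order_tendstoD) simp
  have bnd: "\<forall>\<^sub>F t in at_right 0. norm ((1 / t) *\<^sub>R x t - q t) \<le> 2 * c t * norm ((1 / t) *\<^sub>R x t)"
    using qx c2
  proof eventually_elim
    case (elim t)
    have c0: "0 \<le> c t" unfolding c_def by (intro sum_nonneg) simp
    have 1: "norm ((1 / t) *\<^sub>R x t - q t) \<le> c t * norm (q t)"
      using frame_near_identity[of "z t" "q t"] elim by (simp add: c_def)
    have "c t * norm (q t) \<le> (1 / 2) * norm (q t)" using elim c0 by (intro mult_right_mono) auto
    moreover have "norm (q t) \<le> norm ((1 / t) *\<^sub>R x t) + norm ((1 / t) *\<^sub>R x t - q t)"
      using norm_triangle_sub[of "q t" "(1 / t) *\<^sub>R x t"] by (simp only: norm_minus_commute)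
    ultimately have "norm (q t) \<le> 2 * norm ((1 / t) *\<^sub>R x t)" using 1 by linarith
    then have "c t * norm (q t) \<le> c t * (2 * norm ((1 / t) *\<^sub>R x t))" by (rule mult_left_mono) (rule c0)
    then show ?case using 1 by linarith
  qed
  have "((\<lambda>t. 2 * c t * norm ((1 / t) *\<^sub>R x t)) \<longlongrightarrow> 2 * 0 * norm h) (at_right 0)"
    by (intro tendsto_mult tendsto_const c tendsto_norm x)
  then have "((\<lambda>t. 2 * c t * norm ((1 / t) *\<^sub>R x t)) \<longlongrightarrow> 0) (at_right 0)"
    by (simp only: mult_zero_right mult_zero_left)
  then have "((\<lambda>t. (1 / t) *\<^sub>R x t - q t) \<longlongrightarrow> 0) (at_right 0)"
    by (rule Lim_null_comparison[OF bnd])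
  from tendsto_diff[OF x this] show q: "((\<lambda>t. (1 / t) *\<^sub>R y t) \<longlongrightarrow> h) (at_right 0)" by (simp add: q_def)
  have "((\<lambda>t. \<Sum>i\<in>Basis. (q t \<bullet> i) *\<^sub>R ((1 / t) *\<^sub>R (E i (chart_inv u (z t)) - E i (chart_inv u 0)))) \<longlongrightarrow>
    (\<Sum>i\<in>Basis. (h \<bullet> i) *\<^sub>R frechet_derivative (\<lambda>z. E i (chart_inv u z)) (at 0) h')) (at_right 0)"
    using q unfolding q_def[symmetric]
    by (intro tendsto_sum tendsto_scaleR tendsto_inner tendsto_const
        tendsto_difference_quotient(2)[OF frame_derivative z])
  from bounded_linear.tendsto[OF bounded_linear_vert this]
  have "((\<lambda>t. vert (\<Sum>i\<in>Basis. (q t \<bullet> i) *\<^sub>R ((1 / t) *\<^sub>R (E i (chart_inv u (z t)) - E i (chart_inv u 0)))))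
    \<longlongrightarrow> twist u E h h') (at_right 0)"
    unfolding twist_def .
  then show "((\<lambda>t. (1 / t\<^sup>2) *\<^sub>R vert (x t - y t)) \<longlongrightarrow> twist u E h h') (at_right 0)"
  proof (rule Lim_transform_eventually)
    show "\<forall>\<^sub>F t in at_right 0. vert (\<Sum>i\<in>Basis. (q t \<bullet> i) *\<^sub>R ((1 / t) *\<^sub>R (E i (chart_inv u (z t)) - E i (chart_inv u 0)))) =
        (1 / t\<^sup>2) *\<^sub>R vert (x t - y t)"
      using y pos
    proof eventually_elim
      case (elim t)
      have "(\<Sum>i\<in>Basis. (q t \<bullet> i) *\<^sub>R ((1 / t) *\<^sub>R (E i (chart_inv u (z t)) - E i (chart_inv u 0))))
        = (1 / t) *\<^sub>R (frame_at u E (z t) (q t) - q t)"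
        unfolding frame_minus_identity scaleR_sum_right
        by (intro sum.cong) (simp_all add: centeredD(6,7) mult.commute)
      also have "frame_at u E (z t) (q t) = (1 / t) *\<^sub>R x t"
        using elim by (simp add: q_def linear_cmul[OF linear_lincomb])
      finally show ?case
        by (simp add: q_def power2_eq_square flip: scaleR_diff_right)
    qed
  qed
qed

end

end

section \<open>Parabolic flows\<close>

lemma prod_interval_atlas:
  "prod_atlas B (interval_atlas I) = (\<lambda>d. (fst d \<times> I, map_prod (snd d) (id :: real \<Rightarrow> real))) ` B"
proof (intro equalityI subsetI)
  fix x assume "x \<in> prod_atlas B (interval_atlas I)"
  then obtain d where "d \<in> B" "x = (fst d \<times> I, map_prod (snd d) (id :: real \<Rightarrow> real))"
    unfolding prod_atlas_def interval_atlas_def by auto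
  then show "x \<in> (\<lambda>d. (fst d \<times> I, map_prod (snd d) (id :: real \<Rightarrow> real))) ` B" by blast
next
  fix x assume "x \<in> (\<lambda>d. (fst d \<times> I, map_prod (snd d) (id :: real \<Rightarrow> real))) ` B"
  then obtain d where d: "d \<in> B" "x = (fst d \<times> I, map_prod (snd d) (id :: real \<Rightarrow> real))" by blast
  show "x \<in> prod_atlas B (interval_atlas I)"
    unfolding prod_atlas_def interval_atlas_def
    by (rule CollectI, rule exI[of _ d], rule exI[of _ "(I, id)"]) (simp add: d)
qed

lemma injective_prod_interval:
  assumes "injective_charts B"
  shows "injective_charts (prod_atlas B (interval_atlas I))"
  using assms unfolding injective_charts_def prod_interval_atlas by (auto simp: inj_on_def)

lemma injective_restrict:
  assumes "injective_charts B"
  shows "injective_charts (restrict_atlas B W)"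
  using assms unfolding injective_charts_def restrict_atlas_def by (auto simp: inj_on_def)

lemma chart_image_prod_interval:
  "chart_image (fst d \<times> I, map_prod (snd d) id) = chart_image d \<times> I"
  by (auto simp: map_prod_def image_iff)

context distributed_manifold
begin

lemma parabolic_flowD:
  assumes "parabolic_flow A H \<Phi>" "x \<in> points A"
  shows "\<Phi> 0 x = x" "tangent_class A (\<lambda>t. \<Phi> t x) \<in> H x"
  using assms unfolding parabolic_flow_def by auto

text \<open>Flows are smooth in the charts of \<open>A\<close>; composing with a transition map gives smoothness in both
  variables in an arbitrary chart.\<close>

lemma flow_in_chart:
  assumes \<Phi>: "parabolic_flow A H \<Phi>" and u: "u \<in> smooth_charts A" "x \<in> fst u"
  obtains V where "open V" "(snd u x, 0) \<in> V"
    "\<forall>p\<in>V. fst p \<in> chart_image u \<and> \<Phi> (snd p) (chart_inv u (fst p)) \<in> fst u"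
    "Cinf_on (\<lambda>p. snd u (\<Phi> (snd p) (chart_inv u (fst p)))) V"
proof -
  let ?Q = "prod_atlas A (interval_atlas UNIV)"
  have xA: "x \<in> points A" using u smooth_chartD(1) by blast
  obtain W where W: "openin (atlas_topology ?Q) W" "points A \<times> {0} \<subseteq> W"
    "smooth_map (restrict_atlas ?Q W) A (\<lambda>(x, t). \<Phi> t x)"
    using \<Phi> unfolding parabolic_flow_def by blast
  obtain d where d: "d \<in> A" "x \<in> fst d" by (rule chart_around[OF xA])
  have dS: "d \<in> smooth_charts A" by (rule atlas_smooth_charts[OF d(1)])
  define D where "D = (fst d \<times> (UNIV :: real set), map_prod (snd d) (id :: real \<Rightarrow> real))"
  define c where "c = (fst D \<inter> W, snd D)"
  have DQ: "D \<in> ?Q" unfolding D_def prod_interval_atlas using d(1) by blast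
  have cB: "c \<in> restrict_atlas ?Q W" unfolding c_def restrict_atlas_def using DQ by blast
  have iQ: "injective_charts ?Q" by (rule injective_prod_interval[OF inj_A])
  have iB: "injective_charts (restrict_atlas ?Q W)" by (rule injective_restrict[OF iQ])
  have oD: "open (chart_image D)" unfolding D_def chart_image_prod_interval
    by (intro open_Times open_UNIV smooth_chartD(3)[OF dS])
  have oc: "open (chart_image c)"
  proof -
    have "openin (top_of_set (chart_image D)) (snd D ` (fst D \<inter> W))"
      using W(1) DQ unfolding openin_atlas_topology[OF iQ] by blast
    then show ?thesis unfolding c_def using oD openin_open_trans by simp
  qed
  have xc: "(x, 0) \<in> fst c" using d(2) W(2) xA by (auto simp: c_def D_def)
  have fx: "(case (x, 0) of (x, t) \<Rightarrow> \<Phi> t x) \<in> fst u" using parabolic_flowD(1)[OF \<Phi> xA] u(2) by simp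
  obtain V0 where V0: "open V0" "snd c (x, 0) \<in> V0" "V0 \<subseteq> chart_image c"
    "\<forall>z\<in>V0. (case chart_inv c z of (x, t) \<Rightarrow> \<Phi> t x) \<in> fst u"
    "Cinf_on (\<lambda>z. snd u (case chart_inv c z of (x, t) \<Rightarrow> \<Phi> t x)) V0"
    by (rule smooth_map_local[OF W(3) iB cB oc xc u(1) fx])
  define U where "U = snd u ` (fst u \<inter> fst d)"
  note cc = chart_change[OF u(1) dS, folded U_def]
  define \<kappa> where "\<kappa> = (\<lambda>p :: 'e \<times> real. (chart_change u d (fst p), snd p))"
  have oU: "open (U \<times> (UNIV :: real set))" by (intro open_Times cc(1) open_UNIV)
  have \<kappa>: "Cinf_on \<kappa> (U \<times> UNIV)" unfolding \<kappa>_def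
    by (intro Cinf_on_Pair oU Cinf_on_compose[OF oU cc(1) _ _ cc(2)] Cinf_on_linear
        bounded_linear_fst bounded_linear_snd) auto
  define V where "V = (U \<times> UNIV) \<inter> \<kappa> -` V0"
  have V: "open V" unfolding V_def
    by (rule continuous_open_preimage[OF Cinf_on_continuous[OF \<kappa>] oU V0(1)])
  have inv: "chart_inv c (\<kappa> p) = (chart_inv u (fst p), snd p)" "fst p \<in> chart_image u" if p: "p \<in> V" for p
  proof -
    have "fst p \<in> U" "\<kappa> p \<in> chart_image c" using p V0(3) by (auto simp: V_def)
    then obtain q where q: "q \<in> fst u" "q \<in> fst d" "fst p = snd u q" by (auto simp: U_def)
    then show "fst p \<in> chart_image u" by blast
    obtain a where a: "a \<in> fst c" "\<kappa> p = snd c a" using \<open>\<kappa> p \<in> chart_image c\<close> by blast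
    have qi: "chart_inv u (fst p) = q" using q chart_inv_snd[OF smooth_chartD(2)[OF u(1)]] by simp
    then have "\<kappa> p = (snd d q, snd p)" by (simp add: \<kappa>_def chart_change_def)
    then have "snd d (fst a) = snd d q" "snd a = snd p" "fst a \<in> fst d"
      using a by (auto simp: c_def D_def)
    then have "a = (q, snd p)" using smooth_chartD(2)[OF dS] q(2)
      by (metis inj_onD prod.collapse)
    moreover have "chart_inv c (snd c a) = a" by (rule injective_charts_inv[OF iB cB a(1)])
    ultimately show "chart_inv c (\<kappa> p) = (chart_inv u (fst p), snd p)" using a(2) qi by simp
  qed
  show thesis
  proof (rule that[OF V])
    have "\<kappa> (snd u x, 0) = snd c (x, 0)"
      by (simp add: \<kappa>_def c_def D_def chart_change_def chart_inv_snd[OF smooth_chartD(2)[OF u(1)] u(2)])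
    then show "(snd u x, 0) \<in> V" using V0(2) u(2) d(2) by (simp add: V_def U_def)
    show "\<forall>p\<in>V. fst p \<in> chart_image u \<and> \<Phi> (snd p) (chart_inv u (fst p)) \<in> fst u"
    proof
      fix p assume p: "p \<in> V"
      then have "\<kappa> p \<in> V0" by (simp add: V_def)
      from bspec[OF V0(4) this] show "fst p \<in> chart_image u \<and> \<Phi> (snd p) (chart_inv u (fst p)) \<in> fst u"
        using inv(2)[OF p] unfolding inv(1)[OF p] by simp
    qed
    have "Cinf_on (\<lambda>p. snd u (case chart_inv c (\<kappa> p) of (x, t) \<Rightarrow> \<Phi> t x)) V"
      by (rule Cinf_on_compose[OF V V0(1) _ Cinf_on_subset[OF \<kappa>] V0(5)]) (auto simp: V_def)
    then show "Cinf_on (\<lambda>p. snd u (\<Phi> (snd p) (chart_inv u (fst p)))) V"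
      by (rule Cinf_on_cong[OF V, rotated]) (simp only: inv(1) prod.case)
  qed
qed

lemma flow_curve:
  assumes \<Phi>: "parabolic_flow A H \<Phi>" and x: "x \<in> points A"
  shows "horizontal_curve A H (\<lambda>t. \<Phi> t x)"
proof -
  obtain u where u: "u \<in> A" "x \<in> fst u" by (rule chart_around[OF x])
  have uS: "u \<in> smooth_charts A" by (rule atlas_smooth_charts[OF u(1)])
  obtain V where V: "open V" "(snd u x, 0) \<in> V"
    "\<forall>p\<in>V. fst p \<in> chart_image u \<and> \<Phi> (snd p) (chart_inv u (fst p)) \<in> fst u"
    "Cinf_on (\<lambda>p. snd u (\<Phi> (snd p) (chart_inv u (fst p)))) V"
    by (rule flow_in_chart[OF \<Phi> uS u(2)])
  define T where "T = (\<lambda>t::real. (snd u x, t)) -` V"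
  have line: "Cinf_on (\<lambda>t::real. (snd u x, t)) T" if "open T" for T
    by (intro Cinf_on_Pair Cinf_on_const Cinf_on_linear bounded_linear_ident that)
  have T: "open T" unfolding T_def
    using Cinf_on_continuous[OF line[OF open_UNIV]] V(1) by (simp add: continuous_on_open_vimage)
  have xi: "chart_inv u (snd u x) = x" by (rule chart_inv_snd[OF smooth_chartD(2)[OF uS] u(2)])
  have "Cinf_on (\<lambda>t. snd u (\<Phi> (snd (snd u x, t)) (chart_inv u (fst (snd u x, t))))) T"
    by (rule Cinf_on_compose[OF T V(1) _ line[OF T] V(4)]) (auto simp: T_def)
  then have "Cinf_on (\<lambda>t. snd u (\<Phi> t x)) T" by (simp only: fst_conv snd_conv xi)
  moreover have "\<forall>t\<in>T. \<Phi> t x \<in> fst u"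
  proof
    fix t assume "t \<in> T"
    then have "(snd u x, t) \<in> V" by (simp add: T_def)
    from bspec[OF V(3) this] show "\<Phi> t x \<in> fst u" by (simp only: fst_conv snd_conv xi)
  qed
  moreover have "0 \<in> T" using V(2) by (simp add: T_def)
  ultimately have "smooth_curve A (\<lambda>t. \<Phi> t x)" by (intro smooth_curveI[OF uS T])
  then show ?thesis using parabolic_flowD[OF \<Phi> x] by (simp add: horizontal_curve_def)
qed

text \<open>Let \<open>f (z, t)\<close> be the flow \<open>\<Phi>\<close> in the chart and \<open>g\<close> the orbit of \<open>m\<close> under \<open>\<Psi>\<close>. Because
  \<open>f (z, 0) = z\<close>, the composition \<open>f (g t, t)\<close> is \<open>g t\<close> plus \<open>t\<close> times the generating field at the
  point \<open>g t\<close> plus a second order term that is the one of \<open>\<Phi>\<close>. The generating field is a section of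
  \<open>H\<close>, so its vertical part at \<open>g t\<close> comes only from the rotation of the frame along \<open>g\<close>, which
  \<open>frame_limit\<close> evaluates.\<close>

lemma flow_compose:
  assumes uE: "centered_frame u E m" and \<Phi>: "parabolic_flow A H \<Phi>" and \<Psi>: "parabolic_flow A H \<Psi>"
  defines "c1 \<equiv> \<lambda>t. \<Phi> t m" and "c2 \<equiv> \<lambda>t. \<Psi> t m" and "c \<equiv> \<lambda>t. (\<Phi> t \<circ> \<Psi> t) m"
  shows "horizontal_curve A H c" "c 0 = m"
    "taylor u c = taylor u c1 + taylor u c2 + twist u E (horiz (taylor u c1)) (horiz (taylor u c2))"
proof -
  note uD = centeredD[OF uE]
  have mA: "m \<in> points A" using smooth_chartD(1)[OF uD(3)] uD(4) by blast
  have c10: "c1 0 = m" and c20: "c2 0 = m" and c0: "c 0 = m"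
    using parabolic_flowD(1)[OF \<Phi> mA] parabolic_flowD(1)[OF \<Psi> mA] by (simp_all add: c1_def c2_def c_def)
  have h1: "horizontal_curve A H c1" and h2: "horizontal_curve A H c2"
    unfolding c1_def c2_def by (rule flow_curve[OF \<Phi> mA] flow_curve[OF \<Psi> mA])+
  then have s2: "smooth_curve A c2" by (simp add: horizontal_curve_def)
  note l2 = taylor_limits[OF uD(2) h2 c20]
  obtain V where V: "open V" "(snd u m, 0) \<in> V"
    "\<forall>p\<in>V. fst p \<in> chart_image u \<and> \<Phi> (snd p) (chart_inv u (fst p)) \<in> fst u"
    "Cinf_on (\<lambda>p. snd u (\<Phi> (snd p) (chart_inv u (fst p)))) V"
    by (rule flow_in_chart[OF \<Phi> uD(3,4)])
  define f where "f = (\<lambda>p. snd u (\<Phi> (snd p) (chart_inv u (fst p))))"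
  have f: "Cinf_on f V" unfolding f_def by (rule V(4))
  have V0: "(0, 0) \<in> V" using V(2) uD(5) by simp
  define f1 where "f1 = dir_deriv (0, 1) f"
  define f2 where "f2 = dir_deriv (0, 1) f1"
  have f1: "Cinf_on f1 V" unfolding f1_def by (rule Cinf_on_dir_deriv[OF f])
  have f2: "Cinf_on f2 V" unfolding f2_def by (rule Cinf_on_dir_deriv[OF f1])
  obtain U T where U: "open U" "open T" "(0, 0) \<in> U \<times> T" "U \<times> T \<subseteq> V"
    by (rule open_prod_elim[OF V(1) V0])
  have inV: "(z, t) \<in> V" if "z \<in> U" "t \<in> T" for z t using U(4) that by blast
  have U0: "0 \<in> U" "0 \<in> T" using U(3) by auto
  have fz0: "f (z, 0) = z" "chart_inv u z \<in> fst u" "z \<in> chart_image u" if z: "z \<in> U" for z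
  proof -
    show zi: "z \<in> chart_image u" using bspec[OF V(3) inV[OF z U0(2)]] by simp
    show "chart_inv u z \<in> fst u" by (rule chart_inv_in[OF zi])
    then show "f (z, 0) = z"
      using parabolic_flowD(1)[OF \<Phi>, of "chart_inv u z"] smooth_chartD(1)[OF uD(3)] snd_chart_inv[OF zi]
      by (auto simp: f_def)
  qed
  have jet: "velocity u (\<lambda>t. \<Phi> t (chart_inv u z)) 0 = f1 (z, 0)"
    "acceleration u (\<lambda>t. \<Phi> t (chart_inv u z)) 0 = f2 (z, 0)" if z: "z \<in> U" for z
    unfolding f2_def f1_def
    by (rule jet_along_line[OF V(1) f inV[OF z U0(2)]]; simp add: f_def)+
  have hor: "\<exists>y. y \<in> span P \<and> frame_at u E z y = f1 (z, 0)" if z: "z \<in> U" for z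
  proof -
    let ?x = "chart_inv u z"
    have xu: "?x \<in> fst u" by (rule fz0(2)[OF z])
    then have xA: "?x \<in> points A" using smooth_chartD(1)[OF uD(3)] by blast
    have sm: "smooth_curve A (\<lambda>t. \<Phi> t ?x)" using flow_curve[OF \<Phi> xA] by (simp add: horizontal_curve_def)
    have p0: "\<Phi> 0 ?x = ?x" by (rule parabolic_flowD(1)[OF \<Phi> xA])
    have "tangent_class A (\<lambda>t. \<Phi> t ?x) = tangent_vector A u ?x (f1 (z, 0))"
      using tangent_class_eq_vector[OF sm uD(3)] xu by (simp add: p0 jet(1)[OF z])
    then have "tangent_vector A u ?x (f1 (z, 0)) \<in> H ?x" using parabolic_flowD(2)[OF \<Phi> xA] by simp
    then show ?thesis
      unfolding adapted_frameD(4)[OF uD(1) xu] using tangent_vector_eq_iff[OF uD(3) xu] by auto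
  qed
  define g where "g = (\<lambda>t. snd u (c2 t))"
  have c2u: "c2 0 \<in> fst u" using c20 uD(4) by simp
  obtain V2 where V2: "open V2" "0 \<in> V2" "\<forall>t\<in>V2. c2 t \<in> fst u" "Cinf_on (\<lambda>t. snd u (c2 t)) V2"
    by (rule smooth_curveE[OF s2 uD(3) c2u])
  have g: "Cinf_on g V2" unfolding g_def by (rule V2(4))
  have g0: "g 0 = 0" by (simp add: g_def c20 uD(5))
  have gp: "Cinf_on (\<lambda>t. (g t, t)) V2"
    by (intro Cinf_on_Pair V2(1) g Cinf_on_linear bounded_linear_ident)
  define V3 where "V3 = V2 \<inter> (\<lambda>t. (g t, t)) -` V"
  have V3: "open V3" "0 \<in> V3" unfolding V3_def
    using continuous_open_preimage[OF Cinf_on_continuous[OF gp] V2(1) V(1)] V2(2) V0 g0 by auto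
  have ck: "c t \<in> fst u" "snd u (c t) = f (g t, t)" if t: "t \<in> V3" for t
  proof -
    have *: "chart_inv u (g t) = c2 t" unfolding g_def
      using chart_inv_snd[OF smooth_chartD(2)[OF uD(3)], of "c2 t"] V2(3) t by (simp add: V3_def)
    show "snd u (c t) = f (g t, t)" by (simp add: f_def * c_def c2_def)
    have "(g t, t) \<in> V" using t by (simp add: V3_def)
    from bspec[OF V(3) this] show "c t \<in> fst u" by (simp add: * c_def c2_def)
  qed
  have "Cinf_on (\<lambda>t. f (g t, t)) V3"
    by (rule Cinf_on_compose[OF V3(1) V(1) _ Cinf_on_subset[OF gp] f]) (auto simp: V3_def)
  then have "Cinf_on (\<lambda>t. snd u (c t)) V3"
    by (rule Cinf_on_cong[OF V3(1), rotated]) (simp only: ck)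
  then have sc: "smooth_curve A c"
    by (intro smooth_curveI[OF uD(3) V3]) (use ck(1) in blast)+
  \<comment> \<open>Expand \<open>f (g t, t)\<close> in its second variable at the moving point \<open>g t\<close>. The components of the
    generating field in the frame at \<open>g t\<close> are \<open>y0 (g t)\<close>; they are horizontal.\<close>
  have "isCont g 0" using Cinf_on_continuous[OF g] V2 by (simp add: continuous_on_eq_continuous_at)
  then have glim: "(g \<longlongrightarrow> 0) (at_right 0)"
    unfolding isCont_def g0 by (rule tendsto_mono[OF at_le, rotated]) simp
  have gl1: "((\<lambda>t. (1 / t) *\<^sub>R g t) \<longlongrightarrow> horiz (taylor u c2)) (at_right 0)"
    unfolding g_def by (rule l2(1))
  have gU: "\<forall>\<^sub>F t in at_right 0. g t \<in> U" by (rule topological_tendstoD[OF glim U(1) U0(1)])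
  have pos: "\<forall>\<^sub>F t in at_right (0::real). 0 < t" by (rule eventually_at_right_less)
  define y0 where "y0 = (\<lambda>z. SOME y. y \<in> span P \<and> frame_at u E z y = f1 (z, 0))"
  have y0: "y0 z \<in> span P" "frame_at u E z (y0 z) = f1 (z, 0)" if "z \<in> U" for z
    using someI_ex[OF hor[OF that]] by (simp_all add: y0_def)
  define x where "x = (\<lambda>t. t *\<^sub>R f1 (g t, 0))"
  define y where "y = (\<lambda>t. t *\<^sub>R y0 (g t))"
  have f1c: "isCont f1 (0, 0)" and f2c: "isCont f2 (0, 0)"
    using Cinf_on_continuous[OF f1] Cinf_on_continuous[OF f2] V(1) V0
    by (simp_all add: continuous_on_eq_continuous_at)
  have taylor1: "horiz (taylor u c1) = f1 (0, 0)" "vert (taylor u c1) = (1 / 2) *\<^sub>R vert (f2 (0, 0))"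
    using taylor_parts[OF uD(2) h1 c10] jet[OF U0(1)] by (simp_all add: c1_def uD(7))
  have xlim: "((\<lambda>t. (1 / t) *\<^sub>R x t) \<longlongrightarrow> f1 (0, 0)) (at_right 0)"
  proof (rule Lim_transform_eventually)
    show "((\<lambda>t. f1 (g t, 0)) \<longlongrightarrow> f1 (0, 0)) (at_right 0)"
      by (rule isCont_tendsto_compose[OF f1c]) (intro tendsto_Pair glim tendsto_const)
    show "\<forall>\<^sub>F t in at_right 0. f1 (g t, 0) = (1 / t) *\<^sub>R x t"
      using pos by eventually_elim (simp add: x_def)
  qed
  have xy: "\<forall>\<^sub>F t in at_right 0. frame_at u E (g t) (y t) = x t"
    using gU by eventually_elim (simp add: y_def x_def linear_cmul[OF linear_lincomb] y0)
  note fl = frame_limit(2)[OF uE gl1 xlim xy]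
  define \<rho> where "\<rho> = (\<lambda>t. f (g t, t) - g t - x t)"
  have \<rho>: "((\<lambda>t. (1 / t\<^sup>2) *\<^sub>R \<rho> t) \<longlongrightarrow> (1 / 2) *\<^sub>R f2 (0, 0)) (at_right 0)"
  proof (rule tendstoI)
    fix e :: real assume e: "e > 0"
    have "\<forall>\<^sub>F p in nhds (0, 0). dist (f2 p) (f2 (0, 0)) < e / 2"
      using f2c e unfolding continuous_within tendsto_at_iff_tendsto_nhds
      by (intro tendstoD) auto
    then obtain N where N: "open N" "(0, 0) \<in> N" "\<forall>p\<in>N. dist (f2 p) (f2 (0, 0)) < e / 2"
      unfolding eventually_nhds by blast
    obtain U' T' where U': "open U'" "open T'" "(0, 0) \<in> U' \<times> T'" "U' \<times> T' \<subseteq> N"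
      by (rule open_prod_elim[OF N(1,2)])
    have "\<forall>\<^sub>F t in at_right 0. g t \<in> U'" using topological_tendstoD[OF glim U'(1)] U'(3) by auto
    moreover have "0 \<in> T \<inter> T'" "open (T \<inter> T')" using U' U0 U(2) by auto
    then obtain r where r: "r > 0" "ball 0 r \<subseteq> T \<inter> T'" using openE by blast
    have "\<forall>\<^sub>F t in at_right 0. t < r"
      by (rule eventually_at_rightI[of 0 r]) (use r(1) in auto)
    ultimately show "\<forall>\<^sub>F t in at_right 0. dist ((1 / t\<^sup>2) *\<^sub>R \<rho> t) ((1 / 2) *\<^sub>R f2 (0, 0)) < e"
      using gU pos
    proof eventually_elim
      case (elim t)
      have sT: "s \<in> T" "s \<in> T'" if "s \<in> {0..t}" for s
      proof -
        have "s \<in> ball 0 r" using that elim by (simp add: dist_real_def)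
        then show "s \<in> T" "s \<in> T'" using r(2) by auto
      qed
      have "norm (f (g t, t) - f (g t, 0) - t *\<^sub>R f1 (g t, 0) - (t\<^sup>2 / 2) *\<^sub>R f2 (0, 0)) \<le> e / 2 * t\<^sup>2"
      proof -
        have "norm (f2 (g t, s) - f2 (0, 0)) \<le> e / 2" if s: "s \<in> {0..t}" for s
        proof -
          have "(g t, s) \<in> N" using U'(4) elim sT(2)[OF s] by blast
          then show ?thesis using N(3) by (simp add: dist_norm less_imp_le)
        qed
        then show ?thesis
          using taylor2_along_line[OF f, of t "(g t, 0)" "(0, 1)" "f2 (0, 0)" "e / 2"] elim inV sT(1)
          by (simp add: f1_def f2_def)
      qed
      then have "norm (\<rho> t - (t\<^sup>2 / 2) *\<^sub>R f2 (0, 0)) \<le> e / 2 * t\<^sup>2"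
        using fz0(1)[of "g t"] elim by (simp add: \<rho>_def x_def)
      moreover have "e / 2 * t\<^sup>2 < e * t\<^sup>2" using e elim by simp
      ultimately have "norm (\<rho> t - (t\<^sup>2 / 2) *\<^sub>R f2 (0, 0)) / t\<^sup>2 < e"
        using elim by (simp add: pos_divide_less_eq)
      moreover have "(1 / t\<^sup>2) *\<^sub>R \<rho> t - (1 / 2) *\<^sub>R f2 (0, 0) = (1 / t\<^sup>2) *\<^sub>R (\<rho> t - (t\<^sup>2 / 2) *\<^sub>R f2 (0, 0))"
        using elim by (simp add: scaleR_diff_right)
      ultimately show ?case by (simp add: dist_norm)
    qed
  qed
  have "((\<lambda>t. t *\<^sub>R ((1 / t\<^sup>2) *\<^sub>R \<rho> t)) \<longlongrightarrow> 0 *\<^sub>R ((1 / 2) *\<^sub>R f2 (0, 0))) (at_right 0)"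
    by (intro tendsto_scaleR \<rho> tendsto_ident_at)
  from tendsto_add[OF tendsto_add[OF gl1 xlim] this]
  have k1: "((\<lambda>t. (1 / t) *\<^sub>R g t + (1 / t) *\<^sub>R x t + t *\<^sub>R ((1 / t\<^sup>2) *\<^sub>R \<rho> t)) \<longlongrightarrow>
      horiz (taylor u c1) + horiz (taylor u c2)) (at_right 0)"
    by (simp add: taylor1(1) add.commute)
  from tendsto_add[OF tendsto_add[OF l2(2) fl] bounded_linear.tendsto[OF bounded_linear_vert \<rho>]]
  have k2: "((\<lambda>t. (1 / t\<^sup>2) *\<^sub>R vert (g t) + (1 / t\<^sup>2) *\<^sub>R vert (x t - y t) + vert ((1 / t\<^sup>2) *\<^sub>R \<rho> t)) \<longlongrightarrow>
      vert (taylor u c2) + twist u E (horiz (taylor u c1)) (horiz (taylor u c2)) + vert (taylor u c1)) (at_right 0)"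
    by (simp add: taylor1 g_def)
  have inV3: "\<forall>\<^sub>F t in at_right 0. t \<in> V3"
    using eventually_nhds_in_open[OF V3] by (simp add: eventually_at_filter eventually_mono)
  have "\<forall>\<^sub>F t in at_right 0. (1 / t) *\<^sub>R g t + (1 / t) *\<^sub>R x t + t *\<^sub>R ((1 / t\<^sup>2) *\<^sub>R \<rho> t) = (1 / t) *\<^sub>R snd u (c t)"
    using inV3 pos
    by eventually_elim (simp add: ck \<rho>_def power2_eq_square flip: scaleR_add_right)
  from Lim_transform_eventually[OF k1 this]
  have L1: "((\<lambda>t. (1 / t) *\<^sub>R snd u (c t)) \<longlongrightarrow> horiz (taylor u c1) + horiz (taylor u c2)) (at_right 0)" .
  have "\<forall>\<^sub>F t in at_right 0. (1 / t\<^sup>2) *\<^sub>R vert (g t) + (1 / t\<^sup>2) *\<^sub>R vert (x t - y t) + vert ((1 / t\<^sup>2) *\<^sub>R \<rho> t)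
      = (1 / t\<^sup>2) *\<^sub>R vert (snd u (c t))"
    using inV3 gU
  proof eventually_elim
    case (elim t)
    have "vert (y t) = 0" using y0(1)[of "g t"] elim by (simp add: y_def span_P_iff)
    then show ?case by (simp add: ck(2)[OF elim(1)] \<rho>_def flip: scaleR_add_right)
  qed
  from Lim_transform_eventually[OF k2 this]
  have L2: "((\<lambda>t. (1 / t\<^sup>2) *\<^sub>R vert (snd u (c t))) \<longlongrightarrow>
      vert (taylor u c2) + twist u E (horiz (taylor u c1)) (horiz (taylor u c2)) + vert (taylor u c1)) (at_right 0)" .
  have hs: "horiz (taylor u c1) + horiz (taylor u c2) \<in> span P" by (intro span_add horiz_in_span)
  show "c 0 = m" by (rule c0)
  show "horizontal_curve A H c" by (rule taylor_of_limits(1)[OF uD(2) sc c0 hs L1 L2])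
  have "taylor u c = horiz (taylor u c1) + horiz (taylor u c2) +
      (vert (taylor u c2) + twist u E (horiz (taylor u c1)) (horiz (taylor u c2)) + vert (taylor u c1))"
    by (rule taylor_of_limits(2)[OF uD(2) sc c0 hs L1 L2])
  also have "\<dots> = (horiz (taylor u c1) + vert (taylor u c1)) + (horiz (taylor u c2) + vert (taylor u c2))
      + twist u E (horiz (taylor u c1)) (horiz (taylor u c2))" by (simp only: ac_simps)
  finally show "taylor u c = taylor u c1 + taylor u c2 + twist u E (horiz (taylor u c1)) (horiz (taylor u c2))"
    by (simp only: horiz_vert(1))
qed

end

section \<open>Existence of parabolic flows\<close>

lemma smooth_bump_exists:
  assumes "r > 0"
  obtains \<beta> :: "'a::euclidean_space \<Rightarrow> real"
  where "Cinf_on \<beta> UNIV" "\<beta> 0 = 1" "\<And>z. norm z \<ge> r \<Longrightarrow> \<beta> z = 0"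
proof -
  let ?b = "bump 0 (r\<^sup>2)"
  define \<beta> where "\<beta> = (\<lambda>z::'a. inverse ?b *\<^sub>R bump 0 (r\<^sup>2 - (\<Sum>i\<in>Basis. (z \<bullet> i) *\<^sub>R (z \<bullet> i))))"
  have sq: "(\<Sum>i\<in>Basis. (z \<bullet> i) *\<^sub>R (z \<bullet> i)) = (norm z)\<^sup>2" for z :: 'a
    by (simp add: power2_norm_eq_inner euclidean_inner[of z z])
  have "Cinf_on (\<lambda>z::'a. r\<^sup>2 - (\<Sum>i\<in>Basis. (z \<bullet> i) *\<^sub>R (z \<bullet> i))) UNIV"
    by (intro Cinf_on_diff Cinf_on_const Cinf_on_sum Cinf_on_scaleR open_UNIV Cinf_on_linear
        bounded_linear_inner_left)
  from Cinf_on_compose[OF open_UNIV open_UNIV subset_UNIV this Cinf_on_bump[of 0]]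
  have "Cinf_on \<beta> UNIV" unfolding \<beta>_def by (intro Cinf_on_scaleR Cinf_on_const open_UNIV)
  moreover have "?b > 0" using assms by (simp add: bump_def)
  then have "\<beta> 0 = 1" by (simp add: \<beta>_def)
  moreover have "\<beta> z = 0" if "norm z \<ge> r" for z
  proof -
    have "r\<^sup>2 \<le> (norm z)\<^sup>2" using that assms by (intro power_mono) auto
    then show ?thesis unfolding \<beta>_def sq by (simp add: bump_def)
  qed
  ultimately show thesis using that by blast
qed

context distributed_manifold
begin

text \<open>Here the Hausdorff property enters: outside the closed image of a compact set, a local
  construction can be continued by the identity.\<close>

lemma closed_chart_inv_image:
  assumes u: "u \<in> smooth_charts A" and C: "compact C" "C \<subseteq> chart_image u"
  shows "closedin (atlas_topology A) (chart_inv u ` C)"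
proof -
  have "continuous_map (top_of_set (chart_image u)) (atlas_topology A) (chart_inv u)"
    unfolding continuous_map_def topspace_atlas_topology[OF inj_A]
  proof (intro conjI allI impI)
    show "chart_inv u \<in> topspace (top_of_set (chart_image u)) \<rightarrow> points A"
    proof
      fix z assume "z \<in> topspace (top_of_set (chart_image u))"
      then have "chart_inv u z \<in> fst u" by (intro chart_inv_in) simp
      then show "chart_inv u z \<in> points A" using smooth_chartD(1)[OF u] by blast
    qed
    fix W assume W: "openin (atlas_topology A) W"
    have "{z \<in> chart_image u. chart_inv u z \<in> W} = snd u ` (fst u \<inter> W)"
    proof (intro equalityI subsetI)
      fix z assume "z \<in> {z \<in> chart_image u. chart_inv u z \<in> W}"
      then have z: "z \<in> chart_image u" "chart_inv u z \<in> W" by auto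
      have "snd u (chart_inv u z) \<in> snd u ` (fst u \<inter> W)" using chart_inv_in[OF z(1)] z(2) by blast
      then show "z \<in> snd u ` (fst u \<inter> W)" by (simp only: snd_chart_inv[OF z(1)])
    next
      fix z assume "z \<in> snd u ` (fst u \<inter> W)"
      then obtain x where "x \<in> fst u" "x \<in> W" "z = snd u x" by blast
      then show "z \<in> {z \<in> chart_image u. chart_inv u z \<in> W}"
        using chart_inv_snd[OF smooth_chartD(2)[OF u]] by simp
    qed
    then have "open {z \<in> chart_image u. chart_inv u z \<in> W}" using open_chart_image_Int[OF u W] by simp
    then have "openin (top_of_set (chart_image u)) {z \<in> chart_image u. chart_inv u z \<in> W}"
      by (intro open_openin_trans smooth_chartD(3)[OF u]) auto
    then show "openin (top_of_set (chart_image u)) {z \<in> topspace (top_of_set (chart_image u)). chart_inv u z \<in> W}"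
      by simp
  qed
  moreover have "compactin (top_of_set (chart_image u)) C"
    using C by (simp add: compactin_subtopology)
  ultimately have "compactin (atlas_topology A) (chart_inv u ` C)" by (rule image_compactin[rotated])
  moreover have "Hausdorff_space (atlas_topology A)" using manifold by (simp add: smooth_manifold_def)
  ultimately show ?thesis by (intro compactin_imp_closedin)
qed

lemma Cinf_on_frame_at:
  assumes "adapted_frame A P H u E"
  shows "Cinf_on (\<lambda>z. frame_at u E z y) (chart_image u)"
  unfolding lincomb_def
  by (intro Cinf_on_sum Cinf_on_scaleR Cinf_on_const smooth_chartD(3) adapted_frameD[OF assms])

lemma const_tangent_in_H:
  assumes x: "x \<in> points A"
  shows "tangent_class A (\<lambda>t. x) \<in> H x"
proof -
  obtain u E where uE: "centered_frame u E x" by (rule centered_frame_exists[OF x])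
  note u = centeredD[OF uE]
  have s: "smooth_curve A (\<lambda>t. x)"
    by (rule smooth_curveI[OF u(3) open_UNIV]) (use u(4) in simp_all)
  have "velocity u (\<lambda>t. x) 0 = 0" by (simp add: velocity_def o_def)
  then show ?thesis using horizontal_iff(1)[OF u(2) s] by (simp add: span_zero)
qed

text \<open>In the chart, \<open>z + \<beta> z (t V z + t\<^sup>2 vert y)\<close> with a bump function \<open>\<beta>\<close> and the field \<open>V\<close> with constant
  frame components \<open>horiz y\<close> is a flow along \<open>H\<close> that is the identity outside a compact part
  of the chart. So the definite description in the product of arrows ranges over a nonempty set of flows.\<close>

lemma flow_exists:
  assumes uE: "centered_frame u E m"
  obtains \<Phi> where "parabolic_flow A H \<Phi>"
    "arrow_class A P H (\<lambda>t. \<Phi> t m) = taylor_arrow A P H u y"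
proof -
  note uD = centeredD[OF uE]
  note ou = smooth_chartD(3)[OF uD(3)]
  obtain r0 where r0: "r0 > 0" "cball 0 r0 \<subseteq> chart_image u"
    using ou uD(8) open_contains_cball by blast
  define r where "r = r0 / 2"
  have r: "r > 0" "cball 0 r \<subseteq> chart_image u" using r0 by (auto simp: r_def)
  obtain \<beta> :: "'e \<Rightarrow> real" where \<beta>: "Cinf_on \<beta> UNIV" "\<beta> 0 = 1" "\<And>z. norm z \<ge> r \<Longrightarrow> \<beta> z = 0"
    by (rule smooth_bump_exists[OF r(1)]) blast
  define X where "X = (\<lambda>z. \<beta> z *\<^sub>R frame_at u E z (horiz y))"
  define Y where "Y = (\<lambda>z. \<beta> z *\<^sub>R vert y)"
  have X: "Cinf_on X (chart_image u)" unfolding X_def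
    by (intro Cinf_on_scaleR ou Cinf_on_subset[OF \<beta>(1)] Cinf_on_frame_at uD(1)) simp
  have Y: "Cinf_on Y (chart_image u)" unfolding Y_def
    by (intro Cinf_on_scaleR ou Cinf_on_subset[OF \<beta>(1)] Cinf_on_const) simp
  have cb: "bounded (f ` cball 0 r)" if "Cinf_on f (chart_image u)" for f :: "'e \<Rightarrow> 'e"
    by (intro compact_imp_bounded compact_continuous_image continuous_on_subset[OF Cinf_on_continuous[OF that] r(2)])
      simp
  obtain B1 where B1: "B1 > 0" "\<And>z. z \<in> cball 0 r \<Longrightarrow> norm (X z) \<le> B1"
    using cb[OF X] unfolding bounded_pos by blast
  obtain B2 where B2: "B2 > 0" "\<And>z. z \<in> cball 0 r \<Longrightarrow> norm (Y z) \<le> B2"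
    using cb[OF Y] unfolding bounded_pos by blast
  \<comment> \<open>For \<open>\<bar>t\<bar> < \<delta>\<close> the displacement is at most \<open>r\<close> and vanishes outside the ball of radius \<open>r\<close>, so
    points stay in the ball of radius \<open>2 r\<close> inside the chart.\<close>
  define \<delta> where "\<delta> = min 1 (r / (B1 + B2))"
  have \<delta>: "\<delta> > 0" using r B1 B2 by (simp add: \<delta>_def)
  define g where "g = (\<lambda>p. fst p + snd p *\<^sub>R X (fst p) + (snd p)\<^sup>2 *\<^sub>R Y (fst p))"
  have gz: "g (z, t) = z" if "norm z \<ge> r" for z t using \<beta>(3)[OF that] by (simp add: g_def X_def Y_def)
  have gin: "g (z, t) \<in> chart_image u" if z: "z \<in> chart_image u" and t: "\<bar>t\<bar> < \<delta>" for z t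
  proof (cases "norm z \<le> r")
    case True
    then have zb: "z \<in> cball 0 r" by simp
    have t1: "\<bar>t\<bar> \<le> 1" "\<bar>t\<bar> \<le> r / (B1 + B2)" using t by (simp_all add: \<delta>_def)
    have "t\<^sup>2 \<le> \<bar>t\<bar>" using t1(1) by (metis abs_ge_zero mult.right_neutral mult_left_mono power2_abs power2_eq_square)
    then have "norm (t *\<^sub>R X z + t\<^sup>2 *\<^sub>R Y z) \<le> \<bar>t\<bar> * B1 + \<bar>t\<bar> * B2"
      using B1(2)[OF zb] B2(2)[OF zb]
      by (intro norm_triangle_mono) (auto intro!: mult_mono)
    also have "\<dots> = \<bar>t\<bar> * (B1 + B2)" by (simp add: distrib_left)
    also have "\<dots> \<le> r / (B1 + B2) * (B1 + B2)" using t1(2) B1 B2 by (intro mult_right_mono) auto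
    also have "\<dots> = r" using B1 B2 by simp
    finally have "norm (g (z, t)) \<le> r + r"
      using True norm_triangle_ineq[of z "t *\<^sub>R X z + t\<^sup>2 *\<^sub>R Y z"] by (simp add: g_def add.assoc)
    then show ?thesis using r0(2) by (auto simp: r_def)
  qed (use gz z in auto)
  define I where "I = {-\<delta><..<\<delta>}"
  have oI: "open (chart_image u \<times> I)" unfolding I_def by (intro open_Times ou open_greaterThanLessThan)
  have g: "Cinf_on g (chart_image u \<times> I)" unfolding g_def power2_eq_square
    by (intro Cinf_on_add Cinf_on_scaleR oI Cinf_on_linear bounded_linear_fst bounded_linear_snd
        Cinf_on_compose[OF oI ou _ _ X] Cinf_on_compose[OF oI ou _ _ Y]
        Cinf_on_scaleR[where 'b = real, unfolded real_scaleR_def]) auto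
  define \<Phi> where "\<Phi> = (\<lambda>t x. if x \<in> fst u then chart_inv u (g (snd u x, t)) else x)"
  have \<Phi>u: "\<Phi> t x \<in> fst u" "snd u (\<Phi> t x) = g (snd u x, t)" if "x \<in> fst u" "t \<in> I" for t x
  proof -
    have "g (snd u x, t) \<in> chart_image u" using that by (intro gin) (auto simp: I_def)
    then show "\<Phi> t x \<in> fst u" "snd u (\<Phi> t x) = g (snd u x, t)"
      using that chart_inv_in[of "g (snd u x, t)" u] snd_chart_inv[of "g (snd u x, t)" u] by (simp_all add: \<Phi>_def)
  qed
  define W where "W = points A \<times> I"
  let ?Q = "prod_atlas A (interval_atlas UNIV)"
  have iQ: "injective_charts ?Q" by (rule injective_prod_interval[OF inj_A])
  have QW: "D \<in> ?Q \<Longrightarrow> \<exists>d\<in>A. D = (fst d \<times> UNIV, map_prod (snd d) id)" for D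
    unfolding prod_interval_atlas by blast
  have im: "snd D ` (fst D \<inter> W) = chart_image d \<times> I" "fst D \<inter> W = fst d \<times> I"
    if "d \<in> A" "D = (fst d \<times> UNIV, map_prod (snd d) id)" for d D
  proof -
    show "fst D \<inter> W = fst d \<times> I" using that by (auto simp: W_def points_def)
    then show "snd D ` (fst D \<inter> W) = chart_image d \<times> I"
      using that chart_image_prod_interval[of d I] by simp
  qed
  have oW: "openin (atlas_topology ?Q) W"
    unfolding openin_atlas_topology[OF iQ]
  proof (intro conjI ballI)
    show "W \<subseteq> points ?Q" unfolding W_def points_def prod_interval_atlas by auto
    fix D assume "D \<in> ?Q"
    then obtain d where d: "d \<in> A" "D = (fst d \<times> UNIV, map_prod (snd d) id)" using QW by blast
    have "open (chart_image d \<times> I)" unfolding I_def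
      by (intro open_Times smooth_chartD(3) atlas_smooth_charts d(1) open_greaterThanLessThan)
    moreover have "chart_image D = chart_image d \<times> UNIV"
      unfolding d(2) by (rule chart_image_prod_interval)
    ultimately show "openin (top_of_set (chart_image D)) (snd D ` (fst D \<inter> W))"
      unfolding im(1)[OF d] by (intro open_subset) auto
  qed
  have smooth: "smooth_map (restrict_atlas ?Q W) A (\<lambda>(x, t). \<Phi> t x)"
  proof (rule smooth_mapI_local)
    show "injective_charts (restrict_atlas ?Q W)" by (rule injective_restrict[OF iQ])
    have B: "\<exists>d\<in>A. c = (fst d \<times> I, map_prod (snd d) id)" if cR: "c \<in> restrict_atlas ?Q W" for c
    proof -
      obtain D where D: "D \<in> ?Q" "c = (fst D \<inter> W, snd D)" using cR unfolding restrict_atlas_def by blast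
      obtain d where d: "d \<in> A" "D = (fst d \<times> UNIV, map_prod (snd d) id)" using QW[OF D(1)] by blast
      have "c = (fst d \<times> I, map_prod (snd d) id)" unfolding D(2) im(2)[OF d] using d(2) by simp
      then show ?thesis using d(1) by (rule bexI)
    qed
    show "open (chart_image c)" if c: "c \<in> restrict_atlas ?Q W" for c
    proof -
      obtain d where d: "d \<in> A" "c = (fst d \<times> I, map_prod (snd d) id)" using B[OF c] by blast
      show ?thesis unfolding d(2) chart_image_prod_interval I_def
        by (intro open_Times smooth_chartD(3) atlas_smooth_charts d(1) open_greaterThanLessThan)
    qed
    show "(\<lambda>(x, t). \<Phi> t x) \<in> points (restrict_atlas ?Q W) \<rightarrow> points A"
    proof
      fix p assume "p \<in> points (restrict_atlas ?Q W)"
      then obtain c where "c \<in> restrict_atlas ?Q W" "p \<in> fst c" unfolding points_def by blast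
      then obtain d where d: "d \<in> A" "p \<in> fst d \<times> I" using B by fastforce
      show "(case p of (x, t) \<Rightarrow> \<Phi> t x) \<in> points A"
      proof (cases "fst p \<in> fst u")
        case True
        then have "\<Phi> (snd p) (fst p) \<in> fst u" using d by (intro \<Phi>u(1)) auto
        then show ?thesis using smooth_chartD(1)[OF uD(3)] by (auto simp: case_prod_unfold)
      next
        case False
        then show ?thesis using d by (auto simp: case_prod_unfold \<Phi>_def points_def)
      qed
    qed
    fix c p assume c: "c \<in> restrict_atlas ?Q W" and p: "p \<in> fst c"
    obtain d where d: "d \<in> A" and cd: "c = (fst d \<times> I, map_prod (snd d) id)" using B[OF c] by blast
    have dS: "d \<in> smooth_charts A" by (rule atlas_smooth_charts[OF d])
    have inv: "chart_inv c q = (chart_inv d (fst q), snd q)" if q: "fst q \<in> chart_image d" "snd q \<in> I" for q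
    proof -
      have m: "(chart_inv d (fst q), snd q) \<in> fst c" using q chart_inv_in[OF q(1)] by (simp add: cd)
      have "snd c (chart_inv d (fst q), snd q) = q" using snd_chart_inv[OF q(1)] by (simp add: cd)
      then show ?thesis
        using injective_charts_inv[OF injective_restrict[OF iQ] c m] by simp
    qed
    obtain x t where xt: "p = (x, t)" "x \<in> fst d" "t \<in> I" using p by (auto simp: cd)
    have sp: "snd c p = (snd d x, t)" by (simp add: cd xt)
    show "\<exists>v V. v \<in> smooth_charts A \<and> open V \<and> snd c p \<in> V \<and> V \<subseteq> chart_image c \<and>
        (\<forall>z\<in>V. (case chart_inv c z of (x, t) \<Rightarrow> \<Phi> t x) \<in> fst v) \<and>
        Cinf_on (\<lambda>z. snd v (case chart_inv c z of (x, t) \<Rightarrow> \<Phi> t x)) V"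
    proof (cases "x \<in> fst u")
      case True
      define U where "U = snd d ` (fst d \<inter> fst u)"
      note cc = chart_change[OF dS uD(3), folded U_def]
      define V where "V = U \<times> I"
      have V: "open V" unfolding V_def I_def by (intro open_Times cc(1) open_greaterThanLessThan)
      have invV: "chart_inv c q = (chart_inv d (fst q), snd q)" "chart_inv d (fst q) \<in> fst u"
        "chart_change d u (fst q) \<in> chart_image u" "snd q \<in> I" if q: "q \<in> V" for q
      proof -
        obtain x' where x': "x' \<in> fst d" "x' \<in> fst u" "fst q = snd d x'" using q by (auto simp: V_def U_def)
        show "snd q \<in> I" using q by (auto simp: V_def)
        then show "chart_inv c q = (chart_inv d (fst q), snd q)" using x' by (intro inv) auto
        have i: "chart_inv d (fst q) = x'" unfolding x'(3) by (rule chart_inv_snd[OF smooth_chartD(2)[OF dS] x'(1)])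
        show "chart_inv d (fst q) \<in> fst u" using i x' by simp
        show "chart_change d u (fst q) \<in> chart_image u" unfolding chart_change_def i using x' by simp
      qed
      have "Cinf_on (\<lambda>q. g (chart_change d u (fst q), snd q)) V"
      proof (rule Cinf_on_compose[OF V oI _ _ g])
        show "Cinf_on (\<lambda>q. (chart_change d u (fst q), snd q)) V"
          by (intro Cinf_on_Pair V Cinf_on_compose[OF V cc(1) _ _ cc(2)] Cinf_on_linear
              bounded_linear_fst bounded_linear_snd) (auto simp: V_def)
        show "(\<lambda>q. (chart_change d u (fst q), snd q)) ` V \<subseteq> chart_image u \<times> I"
          using invV by blast
      qed
      then have "Cinf_on (\<lambda>z. snd u (case chart_inv c z of (x, t) \<Rightarrow> \<Phi> t x)) V"
        by (rule Cinf_on_cong[OF V, rotated]) (simp add: invV \<Phi>u chart_change_def)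
      moreover have "\<forall>z\<in>V. (case chart_inv c z of (x, t) \<Rightarrow> \<Phi> t x) \<in> fst u"
        by (simp add: invV \<Phi>u)
      moreover have "snd c p \<in> V" unfolding sp V_def U_def using True xt by blast
      moreover have "V \<subseteq> chart_image c" unfolding cd chart_image_prod_interval V_def U_def by blast
      ultimately show ?thesis using uD(3) V by (intro exI[of _ u] exI[of _ V] conjI)
    next
      case False
      \<comment> \<open>A neighbourhood of \<open>x\<close> misses the support of the bump, and the flow is the identity there.\<close>
      define K where "K = chart_inv u ` cball 0 r"
      have K: "closedin (atlas_topology A) K" unfolding K_def
        by (rule closed_chart_inv_image[OF uD(3) compact_cball r(2)])
      have oK: "openin (atlas_topology A) (points A - K)"
        using K unfolding closedin_def topspace_atlas_topology[OF inj_A] by blast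
      have Ku: "K \<subseteq> fst u" unfolding K_def
        by (intro image_subsetI chart_inv_in) (rule subsetD[OF r(2)])
      have \<Phi>id: "\<Phi> t' x' = x'" if "x' \<notin> K" for t' x'
      proof (cases "x' \<in> fst u")
        case True
        have i: "chart_inv u (snd u x') = x'" by (rule chart_inv_snd[OF smooth_chartD(2)[OF uD(3)] True])
        then have "snd u x' \<notin> cball 0 r" using that unfolding K_def by (metis imageI)
        then have "g (snd u x', t') = snd u x'" by (intro gz) simp
        then show ?thesis using True i by (simp add: \<Phi>_def)
      qed (simp add: \<Phi>_def)
      define U where "U = snd d ` (fst d \<inter> (points A - K))"
      have U: "open U" unfolding U_def by (rule open_chart_image_Int[OF dS oK])
      define V where "V = U \<times> I"
      have V: "open V" unfolding V_def I_def by (intro open_Times U open_greaterThanLessThan)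
      have val: "(case chart_inv c q of (x, t) \<Rightarrow> \<Phi> t x) \<in> fst d"
        "snd d (case chart_inv c q of (x, t) \<Rightarrow> \<Phi> t x) = fst q" if q: "q \<in> V" for q
      proof -
        obtain x' where x': "x' \<in> fst d" "x' \<notin> K" "fst q = snd d x'" using q by (auto simp: V_def U_def)
        have i: "chart_inv d (fst q) = x'" unfolding x'(3) by (rule chart_inv_snd[OF smooth_chartD(2)[OF dS] x'(1)])
        have "chart_inv c q = (x', snd q)" using inv[of q] x' q i by (auto simp: V_def)
        then show "(case chart_inv c q of (x, t) \<Rightarrow> \<Phi> t x) \<in> fst d"
          "snd d (case chart_inv c q of (x, t) \<Rightarrow> \<Phi> t x) = fst q"
          using x' by (simp_all add: \<Phi>id)
      qed
      have "Cinf_on (\<lambda>z. snd d (case chart_inv c z of (x, t) \<Rightarrow> \<Phi> t x)) V"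
        by (rule Cinf_on_cong[OF V _ Cinf_on_linear[OF bounded_linear_fst]]) (simp only: val)
      moreover have "snd c p \<in> V"
      proof -
        have "x \<notin> K" using Ku False by blast
        moreover have "x \<in> points A" using xt(2) d by (auto simp: points_def)
        ultimately show ?thesis unfolding sp V_def U_def using xt by blast
      qed
      moreover have "V \<subseteq> chart_image c" unfolding cd chart_image_prod_interval V_def U_def by blast
      ultimately show ?thesis using dS V val(1) by (intro exI[of _ d] exI[of _ V] conjI ballI)
    qed
  qed
  have g0: "g (z, 0) = z" for z by (simp add: g_def)
  have flow: "\<Phi> 0 x = x" "tangent_class A (\<lambda>t. \<Phi> t x) \<in> H x" if xA: "x \<in> points A" for x
  proof -
    show p0: "\<Phi> 0 x = x"
      using chart_inv_snd[OF smooth_chartD(2)[OF uD(3)]] by (simp add: \<Phi>_def g0)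
    show "tangent_class A (\<lambda>t. \<Phi> t x) \<in> H x"
    proof (cases "x \<in> fst u")
      case True
      have \<Phi>x: "(\<lambda>t. \<Phi> t x) = (\<lambda>t. chart_inv u (snd u x + t *\<^sub>R X (snd u x) + t\<^sup>2 *\<^sub>R Y (snd u x)))"
        using True by (simp add: \<Phi>_def g_def)
      note q = quadratic_curve[OF uD(3) True, of "X (snd u x)" "Y (snd u x)", folded \<Phi>x]
      have "tangent_class A (\<lambda>t. \<Phi> t x) = tangent_vector A u x (X (snd u x))"
        using tangent_class_eq_vector[OF q(1) uD(3)] True q(3) by (simp add: p0)
      moreover have "X (snd u x) = frame_map E x (\<beta> (snd u x) *\<^sub>R horiz y)"
        using chart_inv_snd[OF smooth_chartD(2)[OF uD(3)] True]
        by (simp add: X_def linear_cmul[OF linear_lincomb])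
      moreover have "\<beta> (snd u x) *\<^sub>R horiz y \<in> span P" by (intro span_scale horiz_in_span)
      ultimately show ?thesis unfolding adapted_frameD(4)[OF uD(1) True] by simp
    next
      case False
      then show ?thesis using const_tangent_in_H[OF xA] by (simp add: \<Phi>_def)
    qed
  qed
  have "points A \<times> {0} \<subseteq> W" using \<delta> by (auto simp: W_def I_def)
  then have pf: "parabolic_flow A H \<Phi>"
    unfolding parabolic_flow_def using oW smooth flow by blast
  have "X 0 = horiz y" "Y 0 = vert y"
    using \<beta>(2) centered_frame_map[OF uE] uD(7) by (simp_all add: X_def Y_def)
  then have "(\<lambda>t. \<Phi> t m) = (\<lambda>t. chart_inv u (t *\<^sub>R horiz y + t\<^sup>2 *\<^sub>R vert y))"
    using uD(4,5) by (simp add: \<Phi>_def g_def)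
  then have "arrow_class A P H (\<lambda>t. \<Phi> t m) = taylor_arrow A P H u y" by (simp only: taylor_arrow_def)
  then show thesis using that pf by blast
qed

end

section \<open>The osculating group in Taylor coordinates\<close>

text \<open>Additivity propagates the derivative at \<open>0\<close> to all points.\<close>

lemma additive_has_vector_derivative:
  fixes f :: "real \<Rightarrow> 'a::real_normed_vector"
  assumes add: "\<And>s t. f (s + t) = f s + f t" and D: "(f has_vector_derivative y) (at 0)"
  shows "f s = s *\<^sub>R y"
proof -
  have f0: "f 0 = 0" using add[of 0 0] by simp
  have "((\<lambda>t. f t - t *\<^sub>R y) has_derivative (\<lambda>h. 0)) (at t)" for t
  proof -
    have 1: "((\<lambda>x. x - t) has_vector_derivative 1) (at t)"
      by (auto intro!: derivative_eq_intros)
    have 2: "(f has_vector_derivative y) (at (t - t))" using D by simp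
    have "((\<lambda>x. f t + f (x - t)) has_vector_derivative y) (at t)"
      using vector_diff_chain_at[OF 1 2] by (auto intro!: derivative_eq_intros simp: o_def)
    then have "(f has_vector_derivative y) (at t)" by (simp flip: add)
    then have "((\<lambda>t. f t - t *\<^sub>R y) has_vector_derivative y - y) (at t)"
      by (intro has_vector_derivative_diff) (auto intro!: derivative_eq_intros)
    then show ?thesis by (simp add: has_vector_derivative_def)
  qed
  then obtain c where "\<And>t. f t - t *\<^sub>R y = c"
    using has_derivative_zero_constant[of UNIV "\<lambda>t. f t - t *\<^sub>R y"] by auto
  from this[of s] this[of 0] f0 show ?thesis by simp
qed

context distributed_manifold
begin

lemma twist_simps:
  assumes uE: "centered_frame u E m"
  shows "horiz (twist u E h h') = 0" "vert (twist u E h h') = twist u E h h'"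
    "twist u E (s *\<^sub>R h) h' = s *\<^sub>R twist u E h h'" "twist u E h (s *\<^sub>R h') = s *\<^sub>R twist u E h h'"
    "twist u E (- h) h' = - twist u E h h'" "twist u E h (- h') = - twist u E h h'"
    "twist u E (h1 + h2) h' = twist u E h1 h' + twist u E h2 h'"
    "twist u E h (h1 + h2) = twist u E h h1 + twist u E h h2"
    "twist u E 0 h' = 0" "twist u E h 0 = 0"
proof -
  note l1 = twist_linear(1)[OF uE] and l2 = twist_linear(2)[OF uE]
  show "horiz (twist u E h h') = 0" "vert (twist u E h h') = twist u E h h'"
    unfolding twist_def by (rule horiz_vert)+
  show "twist u E (s *\<^sub>R h) h' = s *\<^sub>R twist u E h h'" by (rule linear_cmul[OF l2])
  show "twist u E h (s *\<^sub>R h') = s *\<^sub>R twist u E h h'" by (rule linear_cmul[OF l1])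
  show "twist u E (- h) h' = - twist u E h h'" by (rule linear_neg[OF l2])
  show "twist u E h (- h') = - twist u E h h'" by (rule linear_neg[OF l1])
  show "twist u E (h1 + h2) h' = twist u E h1 h' + twist u E h2 h'" by (rule linear_add[OF l2])
  show "twist u E h (h1 + h2) = twist u E h h1 + twist u E h h2" by (rule linear_add[OF l1])
  show "twist u E 0 h' = 0" by (rule linear_0[OF l2])
  show "twist u E h 0 = 0" by (rule linear_0[OF l1])
qed

text \<open>The group of arrows in Taylor coordinates; it is the osculating group of the distribution.\<close>

definition osc_mult :: "('m, 'e) chart \<Rightarrow> ('e \<Rightarrow> 'm \<Rightarrow> 'e) \<Rightarrow> 'e \<Rightarrow> 'e \<Rightarrow> 'e" where
  "osc_mult u E y y' = y + y' + twist u E (horiz y) (horiz y')"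

text \<open>The product is well defined because \<open>flow_compose\<close> involves the flows only through the Taylor
  coordinates of their orbits.\<close>

lemma arrow_mult_taylor:
  assumes uE: "centered_frame u E m"
  shows "arrow_mult A P H m (taylor_arrow A P H u y) (taylor_arrow A P H u y') =
    taylor_arrow A P H u (osc_mult u E y y')"
proof -
  note uD = centeredD[OF uE]
  have mA: "m \<in> points A" using smooth_chartD(1)[OF uD(3)] uD(4) by blast
  have tay: "taylor u (\<lambda>t. \<Phi> t m) = z"
    if "parabolic_flow A H \<Phi>" "arrow_class A P H (\<lambda>t. \<Phi> t m) = taylor_arrow A P H u z" for \<Phi> z
    using arrow_class_taylor_arrow[OF uD(2) flow_curve[OF that(1) mA]] parabolic_flowD(1)[OF that(1) mA]
      that(2) taylor_arrow_inj[OF uD(2)] by simp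
  have comp: "arrow_class A P H (\<lambda>t. (\<Phi> t \<circ> \<Psi> t) m) = taylor_arrow A P H u (osc_mult u E y y')"
    if \<Phi>: "parabolic_flow A H \<Phi>" "arrow_class A P H (\<lambda>t. \<Phi> t m) = taylor_arrow A P H u y"
      and \<Psi>: "parabolic_flow A H \<Psi>" "arrow_class A P H (\<lambda>t. \<Psi> t m) = taylor_arrow A P H u y'" for \<Phi> \<Psi>
  proof -
    note c = flow_compose[OF uE \<Phi>(1) \<Psi>(1)]
    show ?thesis
      unfolding arrow_class_taylor_arrow[OF uD(2) c(1,2)] c(3) tay[OF \<Phi>] tay[OF \<Psi>] osc_mult_def ..
  qed
  obtain \<Phi> where \<Phi>: "parabolic_flow A H \<Phi>" "arrow_class A P H (\<lambda>t. \<Phi> t m) = taylor_arrow A P H u y"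
    by (rule flow_exists[OF uE])
  obtain \<Psi> where \<Psi>: "parabolic_flow A H \<Psi>" "arrow_class A P H (\<lambda>t. \<Psi> t m) = taylor_arrow A P H u y'"
    by (rule flow_exists[OF uE])
  show ?thesis
    unfolding arrow_mult_def
  proof (rule the_equality)
    show "\<exists>\<Phi> \<Psi>. parabolic_flow A H \<Phi> \<and> parabolic_flow A H \<Psi> \<and>
      taylor_arrow A P H u y = arrow_class A P H (\<lambda>t. \<Phi> t m) \<and>
      taylor_arrow A P H u y' = arrow_class A P H (\<lambda>t. \<Psi> t m) \<and>
      taylor_arrow A P H u (osc_mult u E y y') = arrow_class A P H (\<lambda>t. (\<Phi> t \<circ> \<Psi> t) m)"
      by (rule exI[of _ \<Phi>], rule exI[of _ \<Psi>]) (simp only: \<Phi> \<Psi> comp[OF \<Phi> \<Psi>] simp_thms)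
    fix z
    assume "\<exists>\<Phi> \<Psi>. parabolic_flow A H \<Phi> \<and> parabolic_flow A H \<Psi> \<and>
      taylor_arrow A P H u y = arrow_class A P H (\<lambda>t. \<Phi> t m) \<and>
      taylor_arrow A P H u y' = arrow_class A P H (\<lambda>t. \<Psi> t m) \<and>
      z = arrow_class A P H (\<lambda>t. (\<Phi> t \<circ> \<Psi> t) m)"
    then obtain \<Phi>' \<Psi>' where *: "parabolic_flow A H \<Phi>'" "parabolic_flow A H \<Psi>'"
      "taylor_arrow A P H u y = arrow_class A P H (\<lambda>t. \<Phi>' t m)"
      "taylor_arrow A P H u y' = arrow_class A P H (\<lambda>t. \<Psi>' t m)"
      "z = arrow_class A P H (\<lambda>t. (\<Phi>' t \<circ> \<Psi>' t) m)" by (elim exE conjE)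
    then show "z = taylor_arrow A P H u (osc_mult u E y y')"
      using comp[OF *(1) *(3)[symmetric] *(2) *(4)[symmetric]] by simp
  qed
qed

lemma arrow_group_inverse:
  assumes uE: "centered_frame u E m"
  shows "m_inv (arrow_group A P H m) (taylor_arrow A P H u y) =
    taylor_arrow A P H u (- y + twist u E (horiz y) (horiz y))"
proof -
  note uD = centeredD[OF uE] and tw = twist_simps[OF uE]
  note inj = taylor_arrow_inj[OF uD(2)]
  let ?T = "taylor_arrow A P H u"
  have one: "one (arrow_group A P H m) = ?T 0"
    by (simp add: arrow_group_def taylor_const[OF uD(2)])
  have mult: "?T a \<otimes>\<^bsub>arrow_group A P H m\<^esub> ?T b = ?T (osc_mult u E a b)" for a b
    by (simp add: arrow_group_def arrow_mult_taylor[OF uE])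
  have car: "carrier (arrow_group A P H m) = range ?T"
    by (simp add: arrow_group_def arrows_eq[OF uD(2)])
  show ?thesis
    unfolding m_inv_def
  proof (rule the_equality)
    show "?T (- y + twist u E (horiz y) (horiz y)) \<in> carrier (arrow_group A P H m) \<and>
        ?T y \<otimes>\<^bsub>arrow_group A P H m\<^esub> ?T (- y + twist u E (horiz y) (horiz y)) = \<one>\<^bsub>arrow_group A P H m\<^esub> \<and>
        ?T (- y + twist u E (horiz y) (horiz y)) \<otimes>\<^bsub>arrow_group A P H m\<^esub> ?T y = \<one>\<^bsub>arrow_group A P H m\<^esub>"
      unfolding one mult car inj by (simp add: osc_mult_def tw)
    fix z
    assume "z \<in> carrier (arrow_group A P H m) \<and>
        ?T y \<otimes>\<^bsub>arrow_group A P H m\<^esub> z = \<one>\<^bsub>arrow_group A P H m\<^esub> \<and>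
        z \<otimes>\<^bsub>arrow_group A P H m\<^esub> ?T y = \<one>\<^bsub>arrow_group A P H m\<^esub>"
    then obtain b where z: "z = ?T b" and b: "?T y \<otimes>\<^bsub>arrow_group A P H m\<^esub> ?T b = \<one>\<^bsub>arrow_group A P H m\<^esub>"
      unfolding car by blast
    have 0: "osc_mult u E y b = 0" using b unfolding one mult inj .
    then have "horiz (osc_mult u E y b) = 0" by simp
    then have "horiz b = - horiz y" by (simp add: osc_mult_def tw add_eq_0_iff)
    then have "y + b - twist u E (horiz y) (horiz y) = 0" using 0 by (simp add: osc_mult_def tw)
    then have "b = - y + twist u E (horiz y) (horiz y)" by (simp add: algebra_simps)
    then show "z = ?T (- y + twist u E (horiz y) (horiz y))" unfolding z by simp
  qed
qed

section \<open>The Lie exponential map\<close>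

definition osc_exp :: "('m, 'e) chart \<Rightarrow> ('e \<Rightarrow> 'm \<Rightarrow> 'e) \<Rightarrow> 'e \<Rightarrow> 'e" where
  "osc_exp u E y = y + (1 / 2) *\<^sub>R twist u E (horiz y) (horiz y)"

lemma taylor_coords_chart_change:
  assumes u: "u \<in> H_charts A P H m" and v: "v \<in> H_charts A P H m"
  shows "taylor_coords A P H v (taylor_arrow A P H u y) =
    chart_deriv u v m (horiz y) + vert (chart_deriv u v m (vert y))
    + vert ((1 / 2) *\<^sub>R second_deriv (chart_change u v) 0 (horiz y))"
proof -
  define q where "q = (\<lambda>t. chart_inv u (t *\<^sub>R horiz y + t\<^sup>2 *\<^sub>R vert y))"
  have q: "horizontal_curve A H q" "q 0 = m" "taylor u q = y"
    unfolding q_def by (rule taylor_curve[OF u])+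
  have "taylor_arrow A P H u y = taylor_arrow A P H v (taylor v q)"
    using arrow_class_taylor_arrow[OF u q(1,2)] arrow_class_taylor_arrow[OF v q(1,2)] q(3) by simp
  then show ?thesis
    using taylor_chart_change[OF u v q(1,2)] q(3) by (simp add: taylor_coords_arrow[OF v])
qed

text \<open>Along \<open>s y\<close> the bilinear term is \<open>s\<^sup>2 B(h, h) / 2\<close>, whose cross terms are those of the group law.
  In another \<open>H\<close>-coordinate chart the subgroup is again a quadratic polynomial in \<open>s\<close>, and its
  linear coefficient is the coordinate vector of the same Lie algebra element.\<close>

lemma one_parameter_subgroup_exp:
  fixes y :: 'e
  assumes uE: "centered_frame u E m"
  defines "\<gamma> \<equiv> \<lambda>s. taylor_arrow A P H u (osc_exp u E (s *\<^sub>R y))"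
  shows "one_parameter_subgroup A P H m (hn_point A P H u id m y) \<gamma>"
proof -
  note uD = centeredD[OF uE] and tw = twist_simps[OF uE]
  have "osc_mult u E (osc_exp u E (s *\<^sub>R y)) (osc_exp u E (t *\<^sub>R y)) = osc_exp u E ((s + t) *\<^sub>R y)" for s t
    by (simp add: osc_mult_def osc_exp_def tw algebra_simps)
      (simp flip: scaleR_add_left)
  then have hom: "\<gamma> \<in> hom \<lparr>carrier = UNIV, monoid.mult = (+), one = 0\<rparr> (arrow_group A P H m)"
    by (simp add: hom_def arrow_group_def \<gamma>_def arrow_mult_taylor[OF uE] arrows_eq[OF uD(2)])
  have "smooth_on UNIV (taylor_coords A P H v \<circ> \<gamma>) \<and>
        (\<exists>z. hn_point A P H u id m y = hn_point A P H v id m z \<and>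
          ((taylor_coords A P H v \<circ> \<gamma>) has_vector_derivative z) (at 0))"
    if v: "v \<in> H_charts A P H m" for v
  proof -
    note vD = H_chartD[OF v]
    let ?D = "chart_deriv u v m"
    let ?S = "second_deriv (chart_change u v) 0"
    have lin: "linear ?D" by (rule linear_chart_deriv[OF uD(3) vD(1) uD(4) vD(2)])
    have "0 \<in> snd u ` (fst u \<inter> fst v)" using uD(4,5) vD(2) by (metis IntI imageI)
    then have S: "?S (s *\<^sub>R h) = s\<^sup>2 *\<^sub>R ?S h" for s h
      by (rule second_deriv_scaleR[OF chart_change(2)[OF uD(3) vD(1)]])
    define a where "a = ?D (horiz y) + vert (?D (vert y))"
    define b where "b = vert (?D ((1 / 2) *\<^sub>R twist u E (horiz y) (horiz y))) + vert ((1 / 2) *\<^sub>R ?S (horiz y))"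
    have eq: "taylor_coords A P H v \<circ> \<gamma> = (\<lambda>s. s *\<^sub>R a + s\<^sup>2 *\<^sub>R b)"
    proof
      fix s
      show "(taylor_coords A P H v \<circ> \<gamma>) s = s *\<^sub>R a + s\<^sup>2 *\<^sub>R b"
        unfolding o_def \<gamma>_def taylor_coords_chart_change[OF uD(2) v]
        by (simp add: osc_exp_def tw linear_add[OF lin] linear_cmul[OF lin] S a_def b_def
            power2_eq_square algebra_simps)
    qed
    have id: "Cinf_on (\<lambda>s::real. s) UNIV" by (rule Cinf_on_linear[OF bounded_linear_ident])
    have "Cinf_on (\<lambda>s::real. s *\<^sub>R a + s\<^sup>2 *\<^sub>R b) UNIV"
      unfolding power2_eq_square scaleR_scaleR[symmetric]
      by (intro Cinf_on_add Cinf_on_scaleR Cinf_on_const id open_UNIV)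
    then have 1: "smooth_on UNIV (taylor_coords A P H v \<circ> \<gamma>)"
      unfolding eq smooth_on_iff_Cinf_on[OF open_UNIV] .
    have 2: "hn_point A P H u id m y = hn_point A P H v id m a"
      unfolding a_def by (rule hn_point_chart_change[OF uD(2) v])
    have "((\<lambda>s. s *\<^sub>R a + s\<^sup>2 *\<^sub>R b) has_vector_derivative a) (at 0)"
      by (auto intro!: derivative_eq_intros)
    then show ?thesis using 1 2 unfolding eq by blast
  qed
  then show ?thesis using hom unfolding one_parameter_subgroup_def by blast
qed

text \<open>The horizontal part is additive, hence linear. After the bilinear term, which is then known, has
  been subtracted, the whole curve is additive.\<close>

lemma one_parameter_subgroup_unique:
  assumes uE: "centered_frame u E m"
    and \<gamma>: "one_parameter_subgroup A P H m (hn_point A P H u id m y) \<gamma>"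
  shows "\<gamma> s = taylor_arrow A P H u (osc_exp u E (s *\<^sub>R y))"
proof -
  note uD = centeredD[OF uE] and tw = twist_simps[OF uE]
  define \<eta> where "\<eta> = taylor_coords A P H u \<circ> \<gamma>"
  have hom: "\<gamma> \<in> hom \<lparr>carrier = UNIV, monoid.mult = (+), one = 0\<rparr> (arrow_group A P H m)"
    using \<gamma> by (simp add: one_parameter_subgroup_def)
  have "\<gamma> s \<in> range (taylor_arrow A P H u)" for s
    using hom unfolding hom_def arrow_group_def by (auto simp: arrows_eq[OF uD(2)])
  then have g: "\<gamma> s = taylor_arrow A P H u (\<eta> s)" for s
    unfolding \<eta>_def o_def using taylor_coords_arrow[OF uD(2)] by (metis rangeE)
  have "\<gamma> (s + t) = arrow_mult A P H m (\<gamma> s) (\<gamma> t)" for s t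
    using hom by (simp add: hom_def arrow_group_def)
  then have add: "\<eta> (s + t) = osc_mult u E (\<eta> s) (\<eta> t)" for s t
    unfolding g arrow_mult_taylor[OF uE] taylor_arrow_inj[OF uD(2)] .
  obtain z where z: "hn_point A P H u id m y = hn_point A P H u id m z" "(\<eta> has_vector_derivative z) (at 0)"
    using \<gamma> uD(2) unfolding one_parameter_subgroup_def \<eta>_def by blast
  then have D: "(\<eta> has_vector_derivative y) (at 0)" using hn_point_inj[OF uD(2)] by simp
  have hor: "horiz (\<eta> s) = s *\<^sub>R horiz y" for s
    by (rule additive_has_vector_derivative[where f = "\<lambda>s. horiz (\<eta> s)"])
      (simp_all add: add osc_mult_def tw bounded_linear.has_vector_derivative[OF bounded_linear_horiz D])
  define \<zeta> where "\<zeta> = (\<lambda>s. \<eta> s - (s\<^sup>2 / 2) *\<^sub>R twist u E (horiz y) (horiz y))"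
  have "\<zeta> s = s *\<^sub>R y" for s
  proof (rule additive_has_vector_derivative[where f = \<zeta>])
    show "\<zeta> (s + t) = \<zeta> s + \<zeta> t" for s t
    proof -
      have "((s + t)\<^sup>2 / 2) *\<^sub>R w = (s\<^sup>2 / 2) *\<^sub>R w + (t\<^sup>2 / 2) *\<^sub>R w + s *\<^sub>R t *\<^sub>R w" for w :: 'e
        by (simp add: power2_sum add_divide_distrib scaleR_add_left)
      then show ?thesis unfolding \<zeta>_def add osc_mult_def hor tw by simp
    qed
    show "(\<zeta> has_vector_derivative y) (at 0)"
      unfolding \<zeta>_def using D by (auto intro!: derivative_eq_intros)
  qed
  then have "\<eta> s = s *\<^sub>R y + (s\<^sup>2 / 2) *\<^sub>R twist u E (horiz y) (horiz y)"
    unfolding \<zeta>_def by (simp add: diff_eq_eq)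
  then show ?thesis unfolding g by (simp add: osc_exp_def tw power2_eq_square)
qed

lemma lie_exp_eq:
  assumes uE: "centered_frame u E m"
  shows "lie_exp A P H (hn_point A P H u id m y) = taylor_arrow A P H u (osc_exp u E y)"
  unfolding lie_exp_def base_point_hn[OF centeredD(2)[OF uE]]
proof (rule the_equality)
  show "\<exists>\<gamma>. one_parameter_subgroup A P H m (hn_point A P H u id m y) \<gamma> \<and>
      taylor_arrow A P H u (osc_exp u E y) = \<gamma> 1"
    by (intro exI conjI, rule one_parameter_subgroup_exp[OF uE]) simp
  show "v = taylor_arrow A P H u (osc_exp u E y)"
    if "\<exists>\<gamma>. one_parameter_subgroup A P H m (hn_point A P H u id m y) \<gamma> \<and> v = \<gamma> 1" for v
    using that one_parameter_subgroup_unique[OF uE, of y _ 1] by auto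
qed

lemma osc_exp_dil:
  assumes uE: "centered_frame u E m"
  shows "dil s (osc_exp u E y) = osc_exp u E (dil s y)"
  by (simp add: dil_def osc_exp_def twist_simps[OF uE] power2_eq_square algebra_simps)

lemma osc_exp_inj:
  assumes uE: "centered_frame u E m"
  shows "osc_exp u E y = osc_exp u E y' \<longleftrightarrow> y = y'"
proof
  assume eq: "osc_exp u E y = osc_exp u E y'"
  then have "horiz (osc_exp u E y) = horiz (osc_exp u E y')" by simp
  then have "horiz y = horiz y'" by (simp add: osc_exp_def twist_simps[OF uE])
  then show "y = y'" using eq by (simp add: osc_exp_def)
qed simp

text \<open>The base point can be recovered from the arrow, and over a point \<open>osc_exp\<close> is injective.\<close>

lemma lie_exp_inj: "inj_on (lie_exp A P H) (hn_bundle A H)"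
proof (rule inj_onI)
  fix X X'
  assume X: "X \<in> hn_bundle A H" and X': "X' \<in> hn_bundle A H" and eq: "lie_exp A P H X = lie_exp A P H X'"
  obtain x u E y where u: "centered_frame u E x" and Xeq: "X = hn_point A P H u id x y"
    using hn_bundle_cases[OF X] by metis
  obtain x' u' E' y' where u': "centered_frame u' E' x'" and Xeq': "X' = hn_point A P H u' id x' y'"
    using hn_bundle_cases[OF X'] by metis
  note H = centeredD(2)[OF u] and H' = centeredD(2)[OF u']
  have "base_point (lie_exp A P H X) = x" "base_point (lie_exp A P H X') = x'"
    unfolding Xeq Xeq' lie_exp_eq[OF u] lie_exp_eq[OF u'] by (rule base_point_arrow[OF H] base_point_arrow[OF H'])+
  then have "x' = x" using eq by simp
  then obtain w where w: "X' = hn_point A P H u id x w"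
    unfolding Xeq' using hn_point_chart_change[OF H'[unfolded \<open>x' = x\<close>] H] by blast
  show "X = X'"
    using eq unfolding Xeq w lie_exp_eq[OF u] taylor_arrow_inj[OF H] osc_exp_inj[OF u] by simp
qed

section \<open>Charts of the total space\<close>

definition hn_param :: "('m, 'e) chart \<Rightarrow> ('e \<Rightarrow> 'm \<Rightarrow> 'e) \<Rightarrow> 'e \<times> 'e \<Rightarrow> 'm hn" where
  "hn_param u E = (\<lambda>(z, y). hn_point A P H u (\<lambda>i. E i (chart_inv u z)) (chart_inv u z) y)"

text \<open>The arrow with coordinates \<open>(z, y)\<close>, where \<open>z\<close> is the base point in the chart and \<open>y\<close> are the
  frame components of the Lie algebra element.\<close>

definition arrow_at :: "('m, 'e) chart \<Rightarrow> ('e \<Rightarrow> 'm \<Rightarrow> 'e) \<Rightarrow> 'e \<times> 'e \<Rightarrow> 'm arrow" where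
  "arrow_at u E p = lie_exp A P H (hn_param u E p)"

definition arrow_chart :: "('m, 'e) chart \<Rightarrow> ('e \<Rightarrow> 'm \<Rightarrow> 'e) \<Rightarrow> ('m arrow, 'e \<times> 'e) chart" where
  "arrow_chart u E = (lie_exp A P H ` fst (hn_chart A P H u E),
     snd (hn_chart A P H u E) \<circ> inv_into (hn_bundle A H) (lie_exp A P H))"

lemma arrow_atlas_eq: "arrow_atlas A P H = {arrow_chart u E | u E. adapted_frame A P H u E}"
  unfolding arrow_atlas_def hn_atlas_def arrow_chart_def by blast

context
  fixes u E
  assumes uE: "adapted_frame A P H u E"
begin

text \<open>The chart of \<open>centered_frameI\<close> at the point with coordinates \<open>z\<close>; \<open>center_frame\<close> is its frame.\<close>

definition center :: "'e \<Rightarrow> ('m, 'e) chart" where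
  "center z = (fst u, \<lambda>y. inv_into UNIV (frame_map E (chart_inv u z)) (snd u y - snd u (chart_inv u z)))"

definition center_frame :: "'e \<Rightarrow> 'e \<Rightarrow> 'm \<Rightarrow> 'e" where
  "center_frame z = (\<lambda>i y. inv_into UNIV (frame_map E (chart_inv u z)) (E i y))"

lemma centered_center:
  assumes "z \<in> chart_image u"
  shows "centered_frame (center z) (center_frame z) (chart_inv u z)"
    and "hn_param u E (z, y) = hn_point A P H (center z) id (chart_inv u z) y"
  unfolding center_def center_frame_def hn_param_def prod.case
  by (rule centered_frameI(1)[OF uE chart_inv_in[OF assms]] hn_point_centered[OF uE chart_inv_in[OF assms]])+

lemma arrow_at_eq:
  assumes "z \<in> chart_image u"
  shows "arrow_at u E (z, y) = taylor_arrow A P H (center z) (osc_exp (center z) (center_frame z) y)"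
  unfolding arrow_at_def centered_center(2)[OF assms] by (rule lie_exp_eq[OF centered_center(1)[OF assms]])

lemma base_point_arrow_at:
  assumes "z \<in> chart_image u"
  shows "base_point (arrow_at u E (z, y)) = chart_inv u z"
  unfolding arrow_at_eq[OF assms] by (rule base_point_arrow[OF centeredD(2)[OF centered_center(1)[OF assms]]])

lemma dilation_arrow_at:
  assumes "z \<in> chart_image u"
  shows "dilation A P H s (arrow_at u E (z, y)) = arrow_at u E (z, dil s y)"
  unfolding arrow_at_eq[OF assms] dilation_taylor_arrow[OF centeredD(2)[OF centered_center(1)[OF assms]]]
    osc_exp_dil[OF centered_center(1)[OF assms]] ..

lemma arrow_at_in_space:
  assumes "z \<in> chart_image u"
  shows "arrow_at u E (z, y) \<in> arrow_space A P H"
proof -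
  have "chart_inv u z \<in> points A"
    using chart_inv_in[OF assms] smooth_chartD(1)[OF adapted_frameD(1)[OF uE]] by blast
  then show ?thesis
    unfolding arrow_at_eq[OF assms] arrow_space_def
    using arrows_eq[OF centeredD(2)[OF centered_center(1)[OF assms]]] by blast
qed

lemma inj_hn_param: "inj_on (hn_param u E) (chart_image u \<times> UNIV)"
proof (rule inj_onI)
  fix p q assume p: "p \<in> chart_image u \<times> UNIV" and q: "q \<in> chart_image u \<times> UNIV"
    and eq: "hn_param u E p = hn_param u E q"
  obtain z y where zy: "p = (z, y)" "z \<in> chart_image u" using p by auto
  obtain z' y' where zy': "q = (z', y')" "z' \<in> chart_image u" using q by auto
  have "base_point (fst (hn_param u E p)) = chart_inv u z" "base_point (fst (hn_param u E q)) = chart_inv u z'"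
    unfolding zy zy' centered_center(2)[OF zy(2)] centered_center(2)[OF zy'(2)]
    by (rule base_point_hn[OF centeredD(2)[OF centered_center(1)[OF zy(2)]]]
        base_point_hn[OF centeredD(2)[OF centered_center(1)[OF zy'(2)]]])+
  then have "chart_inv u z = chart_inv u z'" using eq by simp
  then have "snd u (chart_inv u z) = snd u (chart_inv u z')" by simp
  then have zz: "z = z'" unfolding snd_chart_inv[OF zy(2)] snd_chart_inv[OF zy'(2)] .
  have "y = y'"
    using eq unfolding zy zy' zz centered_center(2)[OF zy'(2)]
      hn_point_inj[OF centeredD(2)[OF centered_center(1)[OF zy'(2)]]] .
  then show "p = q" using zy zy' zz by simp
qed

lemma arrow_chart:
  shows "arrow_chart u E \<in> arrow_atlas A P H"
    and "chart_image (arrow_chart u E) = chart_image u \<times> UNIV"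
    and "open (chart_image (arrow_chart u E))"
    and "inj_on (snd (arrow_chart u E)) (fst (arrow_chart u E))"
    and "p \<in> chart_image u \<times> UNIV \<Longrightarrow> arrow_at u E p \<in> fst (arrow_chart u E)"
    and "p \<in> chart_image u \<times> UNIV \<Longrightarrow> snd (arrow_chart u E) (arrow_at u E p) = p"
    and "p \<in> chart_image u \<times> UNIV \<Longrightarrow> chart_inv (arrow_chart u E) p = arrow_at u E p"
proof -
  let ?D = "chart_image u \<times> (UNIV :: 'e set)" and ?G = "hn_param u E"
  show "arrow_chart u E \<in> arrow_atlas A P H" unfolding arrow_atlas_eq using uE by blast
  have hn: "hn_chart A P H u E = (?G ` ?D, inv_into ?D ?G)"
    unfolding hn_chart_def hn_param_def Let_def ..
  have GB: "?G p \<in> hn_bundle A H" if "p \<in> ?D" for p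
  proof -
    obtain z y where zy: "p = (z, y)" "z \<in> chart_image u" using \<open>p \<in> ?D\<close> by auto
    show ?thesis unfolding zy(1) centered_center(2)[OF zy(2)]
      by (rule hn_point_in_bundle[OF centeredD(2)[OF centered_center(1)[OF zy(2)]]])
  qed
  have f: "fst (arrow_chart u E) = arrow_at u E ` ?D"
    unfolding arrow_chart_def hn arrow_at_def by (simp add: image_image)
  have s: "snd (arrow_chart u E) (arrow_at u E p) = p" if "p \<in> ?D" for p
    unfolding arrow_chart_def hn arrow_at_def o_def snd_conv
      inv_into_f_f[OF lie_exp_inj GB[OF that]] inv_into_f_f[OF inj_hn_param that] ..
  then show "p \<in> ?D \<Longrightarrow> snd (arrow_chart u E) (arrow_at u E p) = p" .
  show fi: "p \<in> ?D \<Longrightarrow> arrow_at u E p \<in> fst (arrow_chart u E)" for p unfolding f by (rule imageI)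
  show im: "chart_image (arrow_chart u E) = ?D" unfolding f image_image using s by (simp cong: image_cong)
  show "open (chart_image (arrow_chart u E))" unfolding im
    by (intro open_Times open_UNIV smooth_chartD(3) adapted_frameD(1)[OF uE])
  show inj: "inj_on (snd (arrow_chart u E)) (fst (arrow_chart u E))"
  proof (rule inj_onI)
    fix a b assume "a \<in> fst (arrow_chart u E)" "b \<in> fst (arrow_chart u E)"
      and e: "snd (arrow_chart u E) a = snd (arrow_chart u E) b"
    then obtain p q where pq: "p \<in> ?D" "q \<in> ?D" "a = arrow_at u E p" "b = arrow_at u E q" unfolding f by blast
    then show "a = b" using e s by simp
  qed
  show "p \<in> ?D \<Longrightarrow> chart_inv (arrow_chart u E) p = arrow_at u E p"
    using chart_inv_snd[OF inj fi[of p]] s[of p] by simp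
qed

end

lemma injective_arrow_atlas: "injective_charts (arrow_atlas A P H)"
  unfolding injective_charts_def arrow_atlas_eq using arrow_chart(4) by blast

section \<open>Expansion of an adapted exponential map\<close>

lemma norm_horiz_le: "norm (horiz x) \<le> norm x" and norm_vert_le: "norm (vert x) \<le> norm x"
  by (rule norm_le_componentwise; simp add: inner_horiz inner_vert)+

lemma dil_0 [simp]: "dil 0 y = 0"
  by (simp add: dil_def)

text \<open>The curve represents an arrow at its base point, which determines its value and velocity at \<open>0\<close>.
  Dilations act on the coordinates \<open>(z, y)\<close> at every base point, not only at the origin.\<close>

lemma exp_curve:
  assumes uE: "adapted_frame A P H u E" and e: "adapted_exponential A P H e" and z: "z \<in> chart_image u"
  defines "c \<equiv> \<lambda>y t. e (arrow_at u E (z, dil t y))"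
  shows "smooth_curve A (c y)" "c y 0 = chart_inv u z" "velocity u (c y) 0 = frame_at u E z (horiz y)"
proof -
  note u = adapted_frameD(1)[OF uE]
  note vE = centered_center(1)[OF uE z]
  define v where "v = center u E z"
  define E' where "E' = center_frame u E z"
  note vE' = vE[folded v_def E'_def]
  note v = centeredD[OF vE']
  have xu: "chart_inv u z \<in> fst u" by (rule chart_inv_in[OF z])
  have "(\<lambda>t. e (dilation A P H t (arrow_at u E (z, y)))) \<in> arrow_at u E (z, y)"
    using e arrow_at_in_space[OF uE z] unfolding adapted_exponential_def by blast
  then have "c y \<in> arrow_at u E (z, y)" unfolding dilation_arrow_at[OF uE z] c_def .
  then have mem: "c y \<in> taylor_arrow A P H v (osc_exp v E' y)"
    unfolding v_def E'_def arrow_at_eq[OF uE z] .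
  then have c: "horizontal_curve A H (c y)" "c y 0 = chart_inv u z" "taylor v (c y) = osc_exp v E' y"
    unfolding taylor_arrow_eq[OF v(2)] by auto
  show "c y 0 = chart_inv u z" by (rule c(2))
  show sm: "smooth_curve A (c y)" using c(1) by (simp add: horizontal_curve_def)
  have vel: "velocity v (c y) 0 = horiz y"
    using taylor_parts(1)[OF v(2) c(1,2)] c(3) by (simp add: osc_exp_def twist_simps[OF vE'])
  have "tangent_class A (c y) = tangent_vector A v (chart_inv u z) (horiz y)"
    using tangent_class_eq_vector[OF sm v(3)] c(2) v(4) vel by simp
  also have "\<dots> = tangent_vector A u (chart_inv u z) (frame_at u E z (horiz y))"
    unfolding v_def center_def[OF uE] by (rule centered_frameI(5)[OF uE xu])
  finally have "tangent_vector A u (chart_inv u z) (velocity u (c y) 0) =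
      tangent_vector A u (chart_inv u z) (frame_at u E z (horiz y))"
    using tangent_class_eq_vector[OF sm u] c(2) xu by simp
  then show "velocity u (c y) 0 = frame_at u E z (horiz y)"
    unfolding tangent_vector_eq_iff[OF u xu] .
qed

lemma arrow_at_0:
  assumes uE: "centered_frame u E m"
  shows "arrow_at u E (0, y) = taylor_arrow A P H u (osc_exp u E y)"
proof -
  note uD = centeredD[OF uE]
  have "lincomb I (\<lambda>i. E i m) y = lincomb I id y" if "I \<subseteq> Basis" for I
    unfolding lincomb_def using that uD(6) by (intro sum.cong) auto
  then have "hn_param u E (0, y) = hn_point A P H u id m y"
    using P by (simp add: hn_param_def hn_point_def uD(7))
  then show ?thesis unfolding arrow_at_def by (simp only: lie_exp_eq[OF uE])
qed

text \<open>At the origin also the vertical acceleration is needed; it is prescribed by the arrow.\<close>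

lemma exp_curve_taylor:
  assumes uE: "centered_frame u E m" and e: "adapted_exponential A P H e"
  shows "(1 / 2) *\<^sub>R vert (acceleration u (\<lambda>t. e (arrow_at u E (0, dil t y))) 0) = vert (osc_exp u E y)"
proof -
  note uD = centeredD[OF uE]
  let ?c = "\<lambda>t. e (arrow_at u E (0, dil t y))"
  have "(\<lambda>t. e (dilation A P H t (arrow_at u E (0, y)))) \<in> arrow_at u E (0, y)"
    using e arrow_at_in_space[OF uD(1,8)] unfolding adapted_exponential_def by blast
  then have "?c \<in> arrow_at u E (0, y)" unfolding dilation_arrow_at[OF uD(1,8)] .
  then have "?c \<in> taylor_arrow A P H u (osc_exp u E y)" by (simp only: arrow_at_0[OF uE, of y])
  then have "horizontal_curve A H ?c" "?c 0 = m" "taylor u ?c = osc_exp u E y"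
    unfolding taylor_arrow_eq[OF uD(2)] by auto
  then show ?thesis using taylor_parts(2)[OF uD(2)] by metis
qed

text \<open>The remainder is uniform over base points \<open>z\<close> near the origin and \<open>w\<close> in a compact set, while the
  quadratic term is frozen at the origin. The second derivative in \<open>t\<close> is continuous in all
  variables, so by the tube lemma it stays close to its value at \<open>t = 0\<close>, \<open>z = 0\<close> uniformly in \<open>w\<close>.\<close>

lemma exp_expansion:
  fixes C :: "'e set"
  assumes uE: "centered_frame u E m" and e: "adapted_exponential A P H e"
    and C: "compact C" and \<delta>: "\<delta> > 0"
  defines "G \<equiv> \<lambda>t z w. snd u (e (arrow_at u E (z, dil t w)))"
    and "B \<equiv> \<lambda>w. acceleration u (\<lambda>t. e (arrow_at u E (0, dil t w))) 0"
  obtains r where "r > 0" "ball 0 r \<subseteq> chart_image u"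
    "\<And>t z w. 0 \<le> t \<Longrightarrow> t < r \<Longrightarrow> norm z < r \<Longrightarrow> w \<in> C \<Longrightarrow>
      e (arrow_at u E (z, dil t w)) \<in> fst u \<and>
      norm (G t z w - z - t *\<^sub>R frame_at u E z (horiz w) - (t\<^sup>2 / 2) *\<^sub>R B w) \<le> \<delta> * t\<^sup>2"
    "\<And>t z. 0 \<le> t \<Longrightarrow> t < r \<Longrightarrow> norm z < r \<Longrightarrow> continuous_on C (G t z)"
    "bounded (B ` C)"
proof -
  note uD = centeredD[OF uE]
  let ?c = "arrow_chart u E"
  note ac = arrow_chart[OF uD(1)]
  have D0: "(0, 0) \<in> chart_image u \<times> (UNIV :: 'e set)" using uD(8) by simp
  have "e (arrow_at u E (0, dil 0 0)) = chart_inv u 0" by (rule exp_curve(2)[OF uD(1) e uD(8)])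
  then have ex: "e (arrow_at u E (0, 0)) \<in> fst u" using uD(4,7) by simp
  have es: "smooth_map (arrow_atlas A P H) A e" using e by (simp add: adapted_exponential_def)
  obtain V0 where V0: "open V0" "snd ?c (arrow_at u E (0, 0)) \<in> V0" "V0 \<subseteq> chart_image ?c"
    "\<forall>p\<in>V0. e (chart_inv ?c p) \<in> fst u" "Cinf_on (\<lambda>p. snd u (e (chart_inv ?c p))) V0"
    by (rule smooth_map_local[OF es injective_arrow_atlas ac(1,3) ac(5)[OF D0] uD(3) ex])
  have V00: "(0, 0) \<in> V0" using V0(2) ac(6)[OF D0] by simp
  have V0D: "V0 \<subseteq> chart_image u \<times> UNIV" using V0(3) ac(2) by simp
  have inv: "chart_inv ?c p = arrow_at u E p" if "p \<in> V0" for p using V0D that by (intro ac(7)) blast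
  have V0u: "e (arrow_at u E p) \<in> fst u" if "p \<in> V0" for p using bspec[OF V0(4) that] inv[OF that] by simp
  have G0: "Cinf_on (\<lambda>p. snd u (e (arrow_at u E p))) V0"
    by (rule Cinf_on_cong[OF V0(1) _ V0(5)]) (simp add: inv)
  \<comment> \<open>The variables are paired as \<open>((t, z), w)\<close> so that the tube lemma applies to compact sets of \<open>w\<close>.\<close>
  define \<kappa> where "\<kappa> = (\<lambda>q :: (real \<times> 'e) \<times> 'e. (snd (fst q), dil (fst (fst q)) (snd q)))"
  have \<kappa>: "Cinf_on \<kappa> UNIV" unfolding \<kappa>_def dil_def power2_eq_square scaleR_scaleR[symmetric]
    by (intro Cinf_on_Pair Cinf_on_add Cinf_on_scaleR Cinf_on_linear open_UNIV
        bounded_linear_compose[OF bounded_linear_fst bounded_linear_fst]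
        bounded_linear_compose[OF bounded_linear_snd bounded_linear_fst]
        bounded_linear_compose[OF bounded_linear_horiz bounded_linear_snd]
        bounded_linear_compose[OF bounded_linear_vert bounded_linear_snd])
  define O' where "O' = \<kappa> -` V0"
  have O': "open O'" unfolding O'_def
    using Cinf_on_continuous[OF \<kappa>] V0(1) by (simp add: continuous_on_open_vimage)
  define g where "g = (\<lambda>q. snd u (e (arrow_at u E (\<kappa> q))))"
  have g: "Cinf_on g O'" unfolding g_def
    by (rule Cinf_on_compose[OF O' V0(1) _ Cinf_on_subset[OF \<kappa>] G0]) (auto simp: O'_def)
  have gG: "g ((t, z), w) = G t z w" for t z w by (simp add: g_def \<kappa>_def G_def)
  define g1 where "g1 = dir_deriv ((1, 0), 0) g"
  define g2 where "g2 = dir_deriv ((1, 0), 0) g1"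
  have g1: "Cinf_on g1 O'" unfolding g1_def by (rule Cinf_on_dir_deriv[OF g])
  have g2: "Cinf_on g2 O'" unfolding g2_def by (rule Cinf_on_dir_deriv[OF g1])
  have zO: "((0, 0), w) \<in> O'" for w using V00 by (simp add: O'_def \<kappa>_def)
  have jet: "velocity u (\<lambda>t. e (arrow_at u E (z, dil t w))) 0 = g1 ((0, z), w)"
    "acceleration u (\<lambda>t. e (arrow_at u E (z, dil t w))) 0 = g2 ((0, z), w)" if zw: "((0, z), w) \<in> O'" for z w
    unfolding g2_def g1_def by (rule jet_along_line[OF O' g zw]; simp add: g_def \<kappa>_def)+
  have Bg: "B w = g2 ((0, 0), w)" for w unfolding B_def by (rule jet(2)[OF zO])
  have Bc: "continuous_on UNIV B" unfolding Bg
    by (rule continuous_on_compose2[OF Cinf_on_continuous[OF g2], where f = "\<lambda>w. ((0, 0), w)"])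
      (use zO in \<open>auto intro!: continuous_intros\<close>)
  \<comment> \<open>The set where the second derivative in \<open>t\<close> differs by less than \<open>\<delta>\<close> from its value at the origin.\<close>
  define h where "h = (\<lambda>q. norm (g2 q - B (snd q)))"
  have hc: "continuous_on O' h" unfolding h_def
    by (intro continuous_on_norm continuous_on_diff Cinf_on_continuous[OF g2]
        continuous_on_compose2[OF Bc continuous_on_snd[OF continuous_on_id]]) simp
  define N where "N = O' \<inter> h -` {..<\<delta>}"
  have N: "open N" unfolding N_def by (rule continuous_open_preimage[OF hc O' open_lessThan])
  have "{(0, 0)} \<times> C \<subseteq> N" using zO \<delta> by (auto simp: N_def h_def Bg)
  then obtain X0 where X0: "(0, 0) \<in> X0" "open X0" "X0 \<times> C \<subseteq> N"
    using Elementary_Topology.tube_lemma[OF C N] by blast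
  obtain U1 U2 where U: "open U1" "open U2" "(0, 0) \<in> U1 \<times> U2" "U1 \<times> U2 \<subseteq> X0"
    by (rule open_prod_elim[OF X0(2,1)])
  obtain r1 where r1: "r1 > 0" "ball 0 r1 \<subseteq> U1" using U openE by blast
  obtain r2 where r2: "r2 > 0" "ball 0 r2 \<subseteq> U2" using U openE by blast
  obtain r3 where r3: "r3 > 0" "ball 0 r3 \<subseteq> chart_image u"
    using smooth_chartD(3)[OF uD(3)] uD(8) openE by blast
  define r where "r = min r1 (min r2 r3)"
  have inN: "((s, z), w) \<in> N" if "0 \<le> s" "s < r" "norm z < r" "w \<in> C" for s z w
  proof -
    have "s \<in> ball 0 r1" "z \<in> ball 0 r2" using that by (simp_all add: r_def dist_real_def)
    then show ?thesis using r1(2) r2(2) U(4) X0(3) that(4) by blast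
  qed
  have inO: "((s, z), w) \<in> O'" if "0 \<le> s" "s < r" "norm z < r" "w \<in> C" for s z w
    using inN[OF that] by (simp add: N_def)
  show thesis
  proof (rule that[of r])
    show "r > 0" using r1 r2 r3 by (simp add: r_def)
    show rb: "ball 0 r \<subseteq> chart_image u" using r3(2) by (auto simp: r_def)
    fix t :: real and z :: 'e assume tz: "0 \<le> t" "t < r" "norm z < r"
    have zu: "z \<in> chart_image u" using rb tz(3) by auto
    show "continuous_on C (G t z)"
      unfolding gG[symmetric]
      by (rule continuous_on_compose2[OF Cinf_on_continuous[OF g], where f = "\<lambda>w. ((t, z), w)"])
        (use inO[OF tz] in \<open>auto intro!: continuous_intros\<close>)
    fix w assume w: "w \<in> C"
    have "\<kappa> ((t, z), w) \<in> V0" using inO[OF tz w] by (simp add: O'_def)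
    then have 1: "e (arrow_at u E (z, dil t w)) \<in> fst u" using V0u by (simp add: \<kappa>_def)
    have z0: "((0, z), w) \<in> O'" using tz by (intro inO w) auto
    have "norm (g ((t, z), w) - g ((0, z), w) - t *\<^sub>R g1 ((0, z), w) - (t\<^sup>2 / 2) *\<^sub>R B w) \<le> \<delta> * t\<^sup>2"
    proof -
      have "((s, z), w) \<in> O'" "norm (g2 ((s, z), w) - B w) \<le> \<delta>" if "s \<in> {0..t}" for s
        using inN[of s z w] that tz w by (simp_all add: N_def h_def)
      then show ?thesis
        using taylor2_along_line[OF g tz(1), of "((0, z), w)" "((1, 0), 0)" "B w" \<delta>]
        by (simp add: g1_def g2_def)
    qed
    moreover have "g ((0, z), w) = z"
      using exp_curve(2)[OF uD(1) e zu, of w] snd_chart_inv[OF zu] by (simp add: g_def \<kappa>_def)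
    moreover have "g1 ((0, z), w) = frame_at u E z (horiz w)"
      using exp_curve(3)[OF uD(1) e zu, of w] jet(1)[OF z0] by simp
    ultimately show "e (arrow_at u E (z, dil t w)) \<in> fst u \<and>
      norm (G t z w - z - t *\<^sub>R frame_at u E z (horiz w) - (t\<^sup>2 / 2) *\<^sub>R B w) \<le> \<delta> * t\<^sup>2"
      using 1 by (simp add: gG)
  next
    show "bounded (B ` C)"
      by (intro compact_imp_bounded compact_continuous_image C continuous_on_subset[OF Bc]) simp
  qed
qed

definition osc_log :: "('m, 'e) chart \<Rightarrow> ('e \<Rightarrow> 'm \<Rightarrow> 'e) \<Rightarrow> 'e \<Rightarrow> 'e" where
  "osc_log u E y = y - (1 / 2) *\<^sub>R twist u E (horiz y) (horiz y)"

lemma osc_exp_log: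
  assumes "centered_frame u E m"
  shows "osc_exp u E (osc_log u E y) = y" "osc_log u E (osc_exp u E y) = y"
  by (simp_all add: osc_exp_def osc_log_def twist_simps[OF assms])

lemma continuous_osc:
  assumes uE: "centered_frame u E m"
  shows "continuous_on S (osc_exp u E)" "continuous_on S (osc_log u E)"
proof -
  have "continuous_on S (\<lambda>y. twist u E (horiz y) (horiz y))"
    unfolding twist_def
    by (intro bounded_linear.continuous_on[OF bounded_linear_vert] continuous_on_sum continuous_on_scaleR
        continuous_on_inner continuous_on_const bounded_linear.continuous_on[OF bounded_linear_horiz] continuous_on_id
        bounded_linear.continuous_on[OF has_derivative_bounded_linear[OF frame_derivative[OF uE]]])
  then show "continuous_on S (osc_exp u E)" "continuous_on S (osc_log u E)"
    unfolding osc_exp_def[abs_def] osc_log_def[abs_def] by (intro continuous_intros; assumption)+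
qed

section \<open>Solving for the arrow\<close>

text \<open>The rescaled equation \<open>F w = Y t\<close> is solved by Brouwer's theorem: \<open>F\<close> is uniformly close to the
  homeomorphism \<open>osc_exp\<close>, and \<open>Y t\<close> is close to the value of the latter at \<open>w0\<close>.\<close>

lemma exp_solution:
  assumes uE: "centered_frame u E m" and e: "adapted_exponential A P H e"
    and a: "horizontal_curve A H a" "a 0 = m" and b: "horizontal_curve A H b" "b 0 = m"
    and w0: "osc_exp u E w0 = osc_mult u E (taylor u a)
      (- taylor u b + twist u E (horiz (taylor u b)) (horiz (taylor u b)))"
    and \<epsilon>: "\<epsilon> > 0"
  shows "\<forall>\<^sub>F t in at_right 0. b t \<in> fst u \<and>
    (\<exists>w\<in>cball w0 \<epsilon>. e (arrow_at u E (snd u (b t), dil t w)) = a t)"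
proof -
  note uD = centeredD[OF uE] and tw = twist_simps[OF uE]
  define \<alpha> where "\<alpha> = (\<lambda>t. snd u (a t))"
  define \<beta> where "\<beta> = (\<lambda>t. snd u (b t))"
  define ha where "ha = horiz (taylor u a)"
  define hb where "hb = horiz (taylor u b)"
  have la1: "((\<lambda>t. (1 / t) *\<^sub>R \<alpha> t) \<longlongrightarrow> ha) (at_right 0)"
    and la2: "((\<lambda>t. (1 / t\<^sup>2) *\<^sub>R vert (\<alpha> t)) \<longlongrightarrow> vert (taylor u a)) (at_right 0)"
    and lb1: "((\<lambda>t. (1 / t) *\<^sub>R \<beta> t) \<longlongrightarrow> hb) (at_right 0)"
    and lb2: "((\<lambda>t. (1 / t\<^sup>2) *\<^sub>R vert (\<beta> t)) \<longlongrightarrow> vert (taylor u b)) (at_right 0)"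
    unfolding \<alpha>_def \<beta>_def ha_def hb_def
    by (rule taylor_limits[OF uD(2) a] taylor_limits[OF uD(2) b])+
  define \<eta> where "\<eta> = osc_exp u E w0"
  have "isCont (osc_log u E) \<eta>"
    using continuous_osc(2)[OF uE, of UNIV] by (simp add: continuous_on_eq_continuous_at)
  then obtain \<delta>0 where \<delta>0: "\<delta>0 > 0" "\<And>y. dist y \<eta> < \<delta>0 \<Longrightarrow> dist (osc_log u E y) (osc_log u E \<eta>) < \<epsilon>"
    using \<epsilon> unfolding continuous_at_eps_delta by blast
  \<comment> \<open>Three errors of size \<open>\<delta>\<close> must stay below half of the tolerance \<open>\<delta>0\<close>.\<close>
  define \<delta> where "\<delta> = \<delta>0 / 8"
  have \<delta>: "\<delta> > 0" using \<delta>0 by (simp add: \<delta>_def)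
  define C where "C = cball w0 \<epsilon>"
  have C: "compact C" "convex C" "C \<noteq> {}" using \<epsilon> by (simp_all add: C_def)
  define G where "G = (\<lambda>t z w. snd u (e (arrow_at u E (z, dil t w))))"
  define B where "B = (\<lambda>w. acceleration u (\<lambda>t. e (arrow_at u E (0, dil t w))) 0)"
  obtain r where r: "r > 0" "ball 0 r \<subseteq> chart_image u"
    and exp: "\<And>t z w. 0 \<le> t \<Longrightarrow> t < r \<Longrightarrow> norm z < r \<Longrightarrow> w \<in> C \<Longrightarrow>
      e (arrow_at u E (z, dil t w)) \<in> fst u \<and>
      norm (G t z w - z - t *\<^sub>R frame_at u E z (horiz w) - (t\<^sup>2 / 2) *\<^sub>R B w) \<le> \<delta> * t\<^sup>2"
    and Gc: "\<And>t z. 0 \<le> t \<Longrightarrow> t < r \<Longrightarrow> norm z < r \<Longrightarrow> continuous_on C (G t z)"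
    and Bb: "bounded (B ` C)"
    using exp_expansion[OF uE e C(1) \<delta>] unfolding G_def B_def by blast
  obtain M where M: "M > 0" "\<And>w. w \<in> C \<Longrightarrow> norm (B w) \<le> M"
    using Bb unfolding bounded_pos by blast
  define R where "R = M / 2 + \<delta>"
  have R: "R > 0" using M \<delta> by (simp add: R_def)
  define inv_at where "inv_at = (\<lambda>z. inv_into UNIV (frame_at u E z))"
  have inv_at: "linear (inv_at z)" "inv_at z (frame_at u E z x) = x" "frame_at u E z (inv_at z x) = x"
    if "norm z < r" for z x
  proof -
    have "chart_inv u z \<in> fst u" using that r(2) by (intro chart_inv_in) auto
    from centered_frameI(2-4)[OF uD(1) this]
    show "linear (inv_at z)" "inv_at z (frame_at u E z x) = x" "frame_at u E z (inv_at z x) = x"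
      by (simp_all only: inv_at_def)
  qed
  have pos: "\<forall>\<^sub>F t in at_right (0::real). 0 < t" by (rule eventually_at_right_less)
  have \<beta>0: "(\<beta> \<longlongrightarrow> 0) (at_right 0)" by (rule tendsto_difference_quotient(1)[OF has_derivative_ident lb1])
  have \<beta>r: "\<forall>\<^sub>F t in at_right 0. norm (\<beta> t) < r"
    using tendstoD[OF \<beta>0 r(1)] by simp
  define y where "y = (\<lambda>t. inv_at (\<beta> t) (\<alpha> t - \<beta> t))"
  have xlim: "((\<lambda>t. (1 / t) *\<^sub>R (\<alpha> t - \<beta> t)) \<longlongrightarrow> ha - hb) (at_right 0)"
    unfolding scaleR_diff_right by (rule tendsto_diff[OF la1 lb1])
  have xy: "\<forall>\<^sub>F t in at_right 0. frame_at u E (\<beta> t) (y t) = \<alpha> t - \<beta> t"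
    using \<beta>r by eventually_elim (simp add: y_def inv_at)
  note fl = frame_limit[OF uE lb1 xlim xy]
  define Y where "Y = (\<lambda>t. (1 / t) *\<^sub>R horiz (y t) + (1 / t\<^sup>2) *\<^sub>R vert (y t))"
  have "((\<lambda>t. horiz ((1 / t) *\<^sub>R y t) + ((1 / t\<^sup>2) *\<^sub>R vert (\<alpha> t) - (1 / t\<^sup>2) *\<^sub>R vert (\<beta> t)
      - (1 / t\<^sup>2) *\<^sub>R vert (\<alpha> t - \<beta> t - y t))) \<longlongrightarrow>
      horiz (ha - hb) + (vert (taylor u a) - vert (taylor u b) - twist u E (ha - hb) hb)) (at_right 0)"
    by (intro tendsto_add tendsto_diff la2 lb2 fl(2) bounded_linear.tendsto[OF bounded_linear_horiz fl(1)])
  moreover have "horiz ((1 / t) *\<^sub>R y t) + ((1 / t\<^sup>2) *\<^sub>R vert (\<alpha> t) - (1 / t\<^sup>2) *\<^sub>R vert (\<beta> t)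
      - (1 / t\<^sup>2) *\<^sub>R vert (\<alpha> t - \<beta> t - y t)) = Y t" for t
    by (simp add: Y_def scaleR_diff_right)
  moreover have "horiz (ha - hb) + (vert (taylor u a) - vert (taylor u b) - twist u E (ha - hb) hb) = \<eta>"
  proof -
    define va where "va = vert (taylor u a)"
    define vb where "vb = vert (taylor u b)"
    have t: "taylor u a = ha + va" "taylor u b = hb + vb"
      by (simp_all add: ha_def hb_def va_def vb_def)
    have hh: "horiz ha = ha" "horiz hb = hb" by (simp_all add: ha_def hb_def)
    \<comment> \<open>The values of \<open>twist\<close> produced by \<open>frame_limit\<close> are those of the product with the inverse.\<close>
    have tw1: "twist u E (ha - hb) hb = twist u E ha hb - twist u E hb hb"
      using tw(7)[of ha "- hb" hb] tw(5)[of hb hb] by simp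
    have "\<eta> = taylor u a + (- taylor u b + twist u E hb hb) - twist u E ha hb"
      unfolding \<eta>_def w0 osc_mult_def by (simp add: tw flip: ha_def hb_def)
    then have \<eta>eq: "\<eta> = ha + va + (- (hb + vb) + twist u E hb hb) - twist u E ha hb"
      unfolding t .
    show ?thesis
      unfolding va_def[symmetric] vb_def[symmetric] tw1 \<eta>eq horiz_simps hh by (simp add: algebra_simps)
  qed
  ultimately have Ylim: "(Y \<longlongrightarrow> \<eta>) (at_right 0)" by simp
  have Y\<delta>: "\<forall>\<^sub>F t in at_right 0. dist (Y t) \<eta> < \<delta>0 / 2" using tendstoD[OF Ylim, of "\<delta>0 / 2"] \<delta>0(1) by simp
  define c where "c = (\<lambda>t. \<Sum>i\<in>Basis. norm (E i (chart_inv u (\<beta> t)) - i))"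
  have c: "(c \<longlongrightarrow> 0) (at_right 0)" unfolding c_def by (rule frame_defect_tendsto[OF uE \<beta>0])
  have c\<delta>: "\<forall>\<^sub>F t in at_right 0. c t < min (1 / 2) (\<delta> / (2 * R))"
    by (rule order_tendstoD(2)[OF c]) (use \<delta> R in simp)
  have small: "\<forall>\<^sub>F t in at_right 0. t < min r (\<delta> / (2 * R))"
    by (rule eventually_at_rightI[of 0 "min r (\<delta> / (2 * R))"]) (use r(1) \<delta> R in auto)
  have in_u: "\<forall>\<^sub>F t in at_right 0. k t \<in> fst u" if k: "horizontal_curve A H k" "k 0 = m" for k
  proof -
    have "smooth_curve A k" "k 0 \<in> fst u" using k uD(4) by (simp_all add: horizontal_curve_def)
    then obtain V where "open V" "0 \<in> V" "\<forall>t\<in>V. k t \<in> fst u" "Cinf_on (\<lambda>t. snd u (k t)) V"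
      by (rule smooth_curveE[OF _ uD(3)])
    then have "\<forall>\<^sub>F t in nhds 0. k t \<in> fst u" unfolding eventually_nhds by blast
    then show ?thesis by (simp add: eventually_at_filter eventually_mono)
  qed
  show ?thesis
    using pos \<beta>r Y\<delta> c\<delta> small in_u[OF a] in_u[OF b]
  proof eventually_elim
    case (elim t)
    have t: "0 < t" "t < r" "norm (\<beta> t) < r" using elim by auto
    define F where "F = (\<lambda>w. (1 / t) *\<^sub>R horiz (inv_at (\<beta> t) (G t (\<beta> t) w - \<beta> t))
      + (1 / t\<^sup>2) *\<^sub>R vert (inv_at (\<beta> t) (G t (\<beta> t) w - \<beta> t)))"
    have lin: "linear (inv_at (\<beta> t))" by (rule inv_at(1)[OF t(3)])
    have bl: "bounded_linear (inv_at (\<beta> t))" using lin by (simp add: linear_conv_bounded_linear)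
    have c0: "0 \<le> c t" unfolding c_def by (intro sum_nonneg) simp
    \<comment> \<open>By \<open>exp_expansion\<close> the displacement is \<open>t L (horiz w) + t\<^sup>2 \<rho>\<close>. Applying the inverse of \<open>L\<close>
      leaves \<open>horiz w\<close> and turns \<open>\<rho>\<close> into \<open>\<sigma>\<close>. Three errors occur: the horizontal part of \<open>\<sigma>\<close>, which
      keeps a factor \<open>t\<close>, the difference of \<open>\<sigma>\<close> and \<open>\<rho>\<close>, and the remainder in \<open>\<rho>\<close>.\<close>
    have close: "norm (F w - osc_exp u E w) \<le> 3 * \<delta>" if w: "w \<in> C" for w
    proof -
      define \<rho> where "\<rho> = (1 / t\<^sup>2) *\<^sub>R (G t (\<beta> t) w - \<beta> t - t *\<^sub>R frame_at u E (\<beta> t) (horiz w))"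
      define \<sigma> where "\<sigma> = inv_at (\<beta> t) \<rho>"
      have "norm (G t (\<beta> t) w - \<beta> t - t *\<^sub>R frame_at u E (\<beta> t) (horiz w) - (t\<^sup>2 / 2) *\<^sub>R B w) \<le> \<delta> * t\<^sup>2"
        using exp[OF less_imp_le[OF t(1)] t(2,3) w] by blast
      moreover have "\<rho> - (1 / 2) *\<^sub>R B w = (1 / t\<^sup>2) *\<^sub>R
          (G t (\<beta> t) w - \<beta> t - t *\<^sub>R frame_at u E (\<beta> t) (horiz w) - (t\<^sup>2 / 2) *\<^sub>R B w)"
        using t(1) by (simp add: \<rho>_def scaleR_diff_right)
      ultimately have \<rho>B: "norm (\<rho> - (1 / 2) *\<^sub>R B w) \<le> \<delta>"
        using t(1) by (simp add: pos_divide_le_eq)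
      have "norm \<rho> \<le> norm ((1 / 2) *\<^sub>R B w) + norm (\<rho> - (1 / 2) *\<^sub>R B w)" by (rule norm_triangle_sub)
      then have \<rho>R: "norm \<rho> \<le> R" using \<rho>B M(2)[OF w] by (simp add: R_def)
      have L\<sigma>: "frame_at u E (\<beta> t) \<sigma> = \<rho>" unfolding \<sigma>_def by (rule inv_at(3)[OF t(3)])
      have 1: "norm (\<rho> - \<sigma>) \<le> c t * norm \<sigma>"
        using frame_near_identity[OF uE, of "\<beta> t" \<sigma>] unfolding L\<sigma> c_def .
      have "c t * norm \<sigma> \<le> (1 / 2) * norm \<sigma>" using elim by (intro mult_right_mono) auto
      moreover have "norm \<sigma> \<le> norm \<rho> + norm (\<rho> - \<sigma>)"
        using norm_triangle_sub[of \<sigma> \<rho>] by (simp only: norm_minus_commute)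
      ultimately have \<sigma>R: "norm \<sigma> \<le> 2 * R" using 1 \<rho>R by linarith
      have "c t * norm \<sigma> \<le> \<delta> / (2 * R) * (2 * R)"
        using elim c0 \<sigma>R R \<delta> by (intro mult_mono) auto
      then have 2: "norm (\<sigma> - \<rho>) \<le> \<delta>" using 1 R by (simp add: norm_minus_commute)
      have "t * norm (horiz \<sigma>) \<le> \<delta> / (2 * R) * (2 * R)"
        using elim \<sigma>R R \<delta> norm_horiz_le[of \<sigma>] by (intro mult_mono) auto
      then have 3: "norm (t *\<^sub>R horiz \<sigma>) \<le> \<delta>" using R t(1) by simp
      have "G t (\<beta> t) w - \<beta> t = t *\<^sub>R frame_at u E (\<beta> t) (horiz w) + t\<^sup>2 *\<^sub>R \<rho>"
        using t(1) by (simp add: \<rho>_def)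
      then have "inv_at (\<beta> t) (G t (\<beta> t) w - \<beta> t) = t *\<^sub>R horiz w + t\<^sup>2 *\<^sub>R \<sigma>"
        by (simp add: linear_add[OF lin] linear_cmul[OF lin] inv_at(2)[OF t(3)] \<sigma>_def)
      then have "F w = horiz w + t *\<^sub>R horiz \<sigma> + vert \<sigma>"
        unfolding F_def using t(1) by (simp add: scaleR_add_right power2_eq_square)
      moreover have "osc_exp u E w = horiz w + vert ((1 / 2) *\<^sub>R B w)"
      proof -
        have "vert (osc_exp u E w) = vert ((1 / 2) *\<^sub>R B w)"
          using exp_curve_taylor[OF uE e, of w] by (simp add: B_def)
        moreover have "horiz (osc_exp u E w) = horiz w" by (simp add: osc_exp_def tw)
        ultimately show ?thesis using horiz_vert(1)[of "osc_exp u E w"] by (simp only:)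
      qed
      ultimately have "F w - osc_exp u E w = t *\<^sub>R horiz \<sigma> + vert (\<sigma> - \<rho>) + vert (\<rho> - (1 / 2) *\<^sub>R B w)"
        by simp
      also have "norm \<dots> \<le> \<delta> + \<delta> + \<delta>"
        using 3 order_trans[OF norm_vert_le 2] order_trans[OF norm_vert_le \<rho>B]
        by (intro norm_triangle_mono)
      finally show ?thesis by simp
    qed
    \<comment> \<open>A fixed point \<open>w\<close> of \<open>K\<close> satisfies \<open>F w = Y t\<close>.\<close>
    define K where "K = (\<lambda>w. osc_log u E (osc_exp u E w - F w + Y t))"
    have Kin: "K w \<in> C" if w: "w \<in> C" for w
    proof -
      have "norm (osc_exp u E w - F w + Y t - \<eta>) \<le> norm (osc_exp u E w - F w) + norm (Y t - \<eta>)"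
        using norm_triangle_ineq[of "osc_exp u E w - F w" "Y t - \<eta>"] by (simp add: add_diff_eq)
      also have "\<dots> < \<delta>0"
        using close[OF w] elim(3) \<delta>0(1) by (simp add: norm_minus_commute[of "osc_exp u E w"] dist_norm \<delta>_def)
      finally have "dist (osc_exp u E w - F w + Y t) \<eta> < \<delta>0" by (simp add: dist_norm)
      from \<delta>0(2)[OF this] show ?thesis
        by (simp add: C_def K_def \<eta>_def osc_exp_log[OF uE] dist_commute)
    qed
    have "continuous_on C F" unfolding F_def
      by (intro continuous_on_add continuous_on_scaleR continuous_on_const
          bounded_linear.continuous_on[OF bounded_linear_horiz] bounded_linear.continuous_on[OF bounded_linear_vert]
          bounded_linear.continuous_on[OF bl] continuous_on_diff Gc less_imp_le[OF t(1)] t(2,3))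
    then have "continuous_on C (\<lambda>w. osc_exp u E w - F w + Y t)"
      by (intro continuous_on_add continuous_on_diff continuous_on_const continuous_osc[OF uE])
    then have Kc: "continuous_on C K" unfolding K_def
      by (rule continuous_on_compose2[OF continuous_osc(2)[OF uE, of UNIV]]) simp
    have Kf: "K \<in> C \<rightarrow> C" using Kin by blast
    obtain w where w: "w \<in> C" "K w = w" by (rule brouwer[OF C Kc Kf])
    have "osc_exp u E (K w) = osc_exp u E w" using w(2) by simp
    then have FY: "F w = Y t" unfolding K_def osc_exp_log[OF uE] by simp
    let ?x = "inv_at (\<beta> t) (G t (\<beta> t) w - \<beta> t)"
    have "horiz (F w) = horiz (Y t)" "vert (F w) = vert (Y t)" using FY by simp_all
    then have "horiz ?x = horiz (y t)" "vert ?x = vert (y t)"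
      using t(1) by (simp_all add: F_def Y_def)
    then have "?x = y t" by (metis horiz_vert(1))
    then have "frame_at u E (\<beta> t) ?x = frame_at u E (\<beta> t) (y t)" by (rule arg_cong)
    then have "G t (\<beta> t) w = \<alpha> t" unfolding y_def inv_at(3)[OF t(3)] by simp
    then have eq: "snd u (e (arrow_at u E (\<beta> t, dil t w))) = snd u (a t)" by (simp add: G_def \<alpha>_def)
    have "e (arrow_at u E (\<beta> t, dil t w)) \<in> fst u"
      using exp[OF less_imp_le[OF t(1)] t(2,3) w(1)] by blast
    then have "e (arrow_at u E (\<beta> t, dil t w)) = a t"
      using inj_onD[OF smooth_chartD(2)[OF uD(3)] eq] elim by blast
    then show ?case using w(1) elim unfolding C_def \<beta>_def by blast
  qed
qed

section \<open>Convergence in the groupoid\<close>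

text \<open>Continuity of \<open>groupoid_param\<close> at a point with \<open>t = 0\<close>, in the coordinates \<open>(z, w)\<close> of the space
  of arrows. The domain \<open>W\<close> is open, so a neighbourhood for its restricted atlas contains a full
  neighbourhood in the coordinates, cut off at \<open>t \<ge> 0\<close>.\<close>

lemma groupoid_neighbourhood:
  assumes e: "adapted_exponential A P H e"
    and S: "injective_charts S" and WW: "arrow_space A P H \<times> {0} \<subseteq> W"
    and diffeo: "open_diffeomorphism_on W (prod_atlas (arrow_atlas A P H) (interval_atlas {0..<1})) S
          (groupoid_param A P H e)"
    and uE: "adapted_frame A P H u E" and z: "z \<in> chart_image u"
    and U: "openin (atlas_topology S) U" "Inl (arrow_at u E (z, w)) \<in> U"
  obtains \<epsilon> where "\<epsilon> > 0"
    "\<And>z' w' t. z' \<in> chart_image u \<Longrightarrow> dist z' z < \<epsilon> \<Longrightarrow> dist w' w \<le> \<epsilon> \<Longrightarrow> 0 < t \<Longrightarrow> t < \<epsilon> \<Longrightarrow>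
      Inr (e (arrow_at u E (z', dil t w')), chart_inv u z', t) \<in> U"
proof -
  let ?Q = "prod_atlas (arrow_atlas A P H) (interval_atlas {0..<1})"
  let ?\<psi> = "groupoid_param A P H e"
  note ac = arrow_chart[OF uE]
  have iQ: "injective_charts ?Q" by (rule injective_prod_interval[OF injective_arrow_atlas])
  have iQW: "injective_charts (restrict_atlas ?Q W)" by (rule injective_restrict[OF iQ])
  have iSW: "injective_charts (restrict_atlas S (?\<psi> ` W))" by (rule injective_restrict[OF S])
  have oW: "openin (atlas_topology ?Q) W" and
    cont: "continuous_map (atlas_topology (restrict_atlas ?Q W)) (atlas_topology (restrict_atlas S (?\<psi> ` W))) ?\<psi>"
    using diffeo unfolding open_diffeomorphism_on_def diffeomorphism_def smooth_map_def by blast+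
  have oU: "openin (atlas_topology (restrict_atlas S (?\<psi> ` W))) (U \<inter> ?\<psi> ` W)"
    unfolding openin_atlas_topology[OF iSW]
  proof (intro conjI ballI)
    have "U \<subseteq> points S" using U(1) unfolding openin_atlas_topology[OF S] by blast
    then show "U \<inter> ?\<psi> ` W \<subseteq> points (restrict_atlas S (?\<psi> ` W))"
      unfolding points_def restrict_atlas_def by fastforce
    fix c' assume "c' \<in> restrict_atlas S (?\<psi> ` W)"
    then obtain c where c: "c \<in> S" "c' = (fst c \<inter> ?\<psi> ` W, snd c)" unfolding restrict_atlas_def by blast
    have "openin (top_of_set (chart_image c)) (snd c ` (fst c \<inter> U))"
      using U(1) c(1) unfolding openin_atlas_topology[OF S] by blast
    then obtain T where T: "open T" "snd c ` (fst c \<inter> U) = chart_image c \<inter> T"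
      unfolding openin_open by blast
    have inj: "inj_on (snd c) (fst c)" using S c(1) by (simp add: injective_charts_def)
    have "fst c' \<inter> (U \<inter> ?\<psi> ` W) = (fst c \<inter> ?\<psi> ` W) \<inter> (fst c \<inter> U)" "snd c' = snd c"
      unfolding c(2) by auto
    then have "snd c' ` (fst c' \<inter> (U \<inter> ?\<psi> ` W)) = snd c ` ((fst c \<inter> ?\<psi> ` W) \<inter> (fst c \<inter> U))"
      by simp
    also have "\<dots> = snd c ` (fst c \<inter> ?\<psi> ` W) \<inter> snd c ` (fst c \<inter> U)"
      by (rule inj_on_image_Int[OF inj]) auto
    also have "\<dots> = chart_image c' \<inter> T" unfolding T(2) c(2) by auto
    finally have eq: "snd c' ` (fst c' \<inter> (U \<inter> ?\<psi> ` W)) = chart_image c' \<inter> T" .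
    show "openin (top_of_set (chart_image c')) (snd c' ` (fst c' \<inter> (U \<inter> ?\<psi> ` W)))"
      unfolding eq using T(1) by (rule openin_open_Int)
  qed
  define Z where "Z = {p \<in> points (restrict_atlas ?Q W). ?\<psi> p \<in> U \<inter> ?\<psi> ` W}"
  have oZ: "openin (atlas_topology (restrict_atlas ?Q W)) Z"
    unfolding Z_def using openin_continuous_map_preimage[OF cont oU]
    unfolding topspace_atlas_topology[OF iQW] .
  define D where "D = (fst (arrow_chart u E) \<times> {0..<1::real}, map_prod (snd (arrow_chart u E)) (id :: real \<Rightarrow> real))"
  have DQ: "D \<in> ?Q" unfolding D_def prod_interval_atlas using ac(1) by blast
  have imD: "chart_image D = (chart_image u \<times> UNIV) \<times> {0..<1}"
    unfolding D_def chart_image_prod_interval ac(2) ..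
  have injD: "inj_on (snd D) (fst D)" using iQ DQ by (simp add: injective_charts_def)
  have D'Q: "(fst D \<inter> W, snd D) \<in> restrict_atlas ?Q W" unfolding restrict_atlas_def using DQ by blast
  have "openin (top_of_set (snd D ` (fst D \<inter> W))) (snd D ` (fst D \<inter> W \<inter> Z))"
    using oZ D'Q unfolding openin_atlas_topology[OF iQW] by fastforce
  moreover have "openin (top_of_set (chart_image D)) (snd D ` (fst D \<inter> W))"
    using oW DQ unfolding openin_atlas_topology[OF iQ] by blast
  ultimately have "openin (top_of_set (chart_image D)) (snd D ` (fst D \<inter> W \<inter> Z))"
    by (rule openin_trans)
  then obtain T where T: "open T" "snd D ` (fst D \<inter> W \<inter> Z) = chart_image D \<inter> T"
    unfolding openin_open by blast
  have pD: "(arrow_at u E (z', w'), t) \<in> fst D" "snd D (arrow_at u E (z', w'), t) = ((z', w'), t)"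
    if "z' \<in> chart_image u" "t \<in> {0..<1}" for z' w' t
    using that ac(5,6)[of "(z', w')"] by (simp_all add: D_def)
  have base: "(arrow_at u E (z, w), 0) \<in> fst D \<inter> W \<inter> Z"
  proof -
    have D0: "(arrow_at u E (z, w), 0) \<in> fst D" by (rule pD(1)[OF z]) simp
    have W0: "(arrow_at u E (z, w), 0) \<in> W" using WW arrow_at_in_space[OF uE z] by blast
    have "?\<psi> (arrow_at u E (z, w), 0) = Inl (arrow_at u E (z, w))" by (simp add: groupoid_param_def)
    then have "?\<psi> (arrow_at u E (z, w), 0) \<in> U" using U(2) by simp
    moreover have "?\<psi> (arrow_at u E (z, w), 0) \<in> ?\<psi> ` W" using W0 by (rule imageI)
    moreover have "(arrow_at u E (z, w), 0) \<in> points (restrict_atlas ?Q W)"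
      unfolding points_def by (rule UN_I[OF D'Q]) (use D0 W0 in simp)
    ultimately show ?thesis using D0 W0 by (simp add: Z_def)
  qed
  have "((z, w), 0) = snd D (arrow_at u E (z, w), 0)" using pD(2)[OF z] by simp
  then have "((z, w), 0) \<in> T" using base T(2) by blast
  then obtain T1 T3 where T13: "open T1" "open T3" "((z, w), 0) \<in> T1 \<times> T3" "T1 \<times> T3 \<subseteq> T"
    using open_prod_elim[OF T(1)] by metis
  then have "(z, w) \<in> T1" by simp
  then obtain T2 T4 where T24: "open T2" "open T4" "(z, w) \<in> T2 \<times> T4" "T2 \<times> T4 \<subseteq> T1"
    using open_prod_elim[OF T13(1)] by metis
  obtain e1 where e1: "e1 > 0" "ball z e1 \<subseteq> T2" using T24 openE by blast
  obtain e2 where e2: "e2 > 0" "ball w e2 \<subseteq> T4" using T24 openE by blast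
  obtain e3 where e3: "e3 > 0" "ball 0 e3 \<subseteq> T3" using T13 openE by blast
  define \<epsilon> where "\<epsilon> = min (min e1 (e2 / 2)) (min e3 1)"
  show thesis
  proof (rule that[of \<epsilon>])
    show "\<epsilon> > 0" using e1 e2 e3 by (simp add: \<epsilon>_def)
    fix z' w' and t :: real
    assume z': "z' \<in> chart_image u" "dist z' z < \<epsilon>" and w': "dist w' w \<le> \<epsilon>" and t: "0 < t" "t < \<epsilon>"
    have t1: "t \<in> {0..<1}" using t by (simp add: \<epsilon>_def)
    have "z' \<in> ball z e1" "w' \<in> ball w e2" "t \<in> ball 0 e3"
      using z'(2) w' t e2(1) by (simp_all add: \<epsilon>_def dist_commute dist_real_def)
    then have "((z', w'), t) \<in> T" using e1(2) e2(2) e3(2) T13(4) T24(4) by blast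
    moreover have "((z', w'), t) \<in> chart_image D" unfolding imD using z'(1) t1 by simp
    ultimately have "((z', w'), t) \<in> snd D ` (fst D \<inter> W \<inter> Z)" unfolding T(2) by blast
    then obtain p where p: "p \<in> fst D" "p \<in> Z" "snd D p = ((z', w'), t)" by force
    have "p = (arrow_at u E (z', w'), t)"
      by (rule inj_onD[OF injD _ p(1) pD(1)[OF z'(1) t1]]) (simp add: p(3) pD(2)[OF z'(1) t1])
    then have "?\<psi> (arrow_at u E (z', w'), t) \<in> U" using p(2) by (simp add: Z_def)
    then show "Inr (e (arrow_at u E (z', dil t w')), chart_inv u z', t) \<in> U"
      using t(1) by (simp add: groupoid_param_def dilation_arrow_at[OF uE z'(1)] base_point_arrow_at[OF uE z'(1)])
  qed
qed

end

theorem proposition22: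
  fixes A :: "('m, 'e::euclidean_space) atlas"
    and P :: "'e set"
    and H :: "'m \<Rightarrow> 'm tangent set"
    and S :: "('m groupoid, ('e \<times> 'e) \<times> real) atlas"
    and a b :: "real \<Rightarrow> 'm"
    and m :: 'm
  assumes "smooth_manifold A"
    and "distribution A P H"
    and "tangent_groupoid_structure A P H S"
    and "smooth_curve A a" and "smooth_curve A b"
    and "a 0 = m" and "b 0 = m"
    and "tangent_class A a \<in> H m" and "tangent_class A b \<in> H m"
  shows "limitin (atlas_topology S) (\<lambda>t. Inr (a t, b t, t))
           (Inl (arrow_class A P H a \<otimes>\<^bsub>arrow_group A P H m\<^esub>
                 inv\<^bsub>arrow_group A P H m\<^esub> arrow_class A P H b))
           (at_right 0)"
proof -
  interpret distributed_manifold A P H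
    by unfold_locales (use assms(1,2) in \<open>simp_all add: distribution_def\<close>)
  have ha: "horizontal_curve A H a" and hb: "horizontal_curve A H b"
    using assms(4-9) by (simp_all add: horizontal_curve_def)
  have mA: "m \<in> points A" using smooth_curve_points[OF assms(4)] assms(6) by simp
  obtain u E where uE: "centered_frame u E m" by (rule centered_frame_exists[OF mA])
  note uD = centeredD[OF uE]
  define y where "y = osc_mult u E (taylor u a)
      (- taylor u b + twist u E (horiz (taylor u b)) (horiz (taylor u b)))"
  define w0 where "w0 = osc_log u E y"
  have ey: "osc_exp u E w0 = y" unfolding w0_def by (rule osc_exp_log(1)[OF uE])
  have v: "arrow_class A P H a \<otimes>\<^bsub>arrow_group A P H m\<^esub> inv\<^bsub>arrow_group A P H m\<^esub> arrow_class A P H b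
      = arrow_at u E (0, w0)"
    unfolding arrow_class_taylor_arrow[OF uD(2) ha assms(6)] arrow_class_taylor_arrow[OF uD(2) hb assms(7)]
      arrow_group_inverse[OF uE] arrow_at_0[OF uE] ey y_def
    by (simp add: arrow_group_def arrow_mult_taylor[OF uE])
  obtain e W where e: "adapted_exponential A P H e" and W: "arrow_space A P H \<times> {0} \<subseteq> W"
    and diffeo: "open_diffeomorphism_on W (prod_atlas (arrow_atlas A P H) (interval_atlas {0..<1})) S
          (groupoid_param A P H e)"
    using assms(3) unfolding tangent_groupoid_structure_def by blast
  have S: "injective_charts S" "points S = tangent_groupoid A P H"
    using assms(3) unfolding tangent_groupoid_structure_def smooth_manifold_with_boundary_def
      smooth_atlas_def injective_charts_def by blast+
  show ?thesis
    unfolding v limitin_def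
  proof (intro conjI allI impI)
    show "Inl (arrow_at u E (0, w0)) \<in> topspace (atlas_topology S)"
      unfolding topspace_atlas_topology[OF S(1)] S(2) tangent_groupoid_def
      using arrow_at_in_space[OF uD(1,8)] by blast
    fix U assume U: "openin (atlas_topology S) U \<and> Inl (arrow_at u E (0, w0)) \<in> U"
    obtain \<epsilon> where \<epsilon>: "\<epsilon> > 0"
      "\<And>z' w' t. z' \<in> chart_image u \<Longrightarrow> dist z' 0 < \<epsilon> \<Longrightarrow> dist w' w0 \<le> \<epsilon> \<Longrightarrow> 0 < t \<Longrightarrow> t < \<epsilon> \<Longrightarrow>
        Inr (e (arrow_at u E (z', dil t w')), chart_inv u z', t) \<in> U"
      using groupoid_neighbourhood[OF e S(1) W diffeo uD(1,8)] U by metis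
    have sol: "\<forall>\<^sub>F t in at_right 0. b t \<in> fst u \<and>
        (\<exists>w\<in>cball w0 \<epsilon>. e (arrow_at u E (snd u (b t), dil t w)) = a t)"
      by (rule exp_solution[OF uE e ha assms(6) hb assms(7) _ \<epsilon>(1)]) (simp only: ey y_def)
    have "((\<lambda>t. snd u (b t)) \<longlongrightarrow> 0) (at_right 0)"
      by (rule tendsto_difference_quotient(1)[OF has_derivative_ident taylor_limits(1)[OF uD(2) hb assms(7)]])
    then have near: "\<forall>\<^sub>F t in at_right 0. dist (snd u (b t)) 0 < \<epsilon>" using \<epsilon>(1) by (rule tendstoD)
    have pos: "\<forall>\<^sub>F t in at_right (0::real). t \<in> {0<..<\<epsilon>}"
      by (rule eventually_at_rightI[of 0 \<epsilon>]) (use \<epsilon>(1) in auto)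
    show "\<forall>\<^sub>F t in at_right 0. Inr (a t, b t, t) \<in> U"
      using sol near pos
    proof eventually_elim
      case (elim t)
      then obtain w where w: "w \<in> cball w0 \<epsilon>" "e (arrow_at u E (snd u (b t), dil t w)) = a t" by blast
      have "snd u (b t) \<in> chart_image u" "chart_inv u (snd u (b t)) = b t"
        using elim chart_inv_snd[OF smooth_chartD(2)[OF uD(3)]] by auto
      then show ?case using \<epsilon>(2)[of "snd u (b t)" w t] w elim by (simp add: dist_commute)
    qed
  qed
qed

end
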